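(* Let $N\ge 2$ be an integer. There exist a constant $\sigma_{N,1}>0$, depending only on $N$, and, for every $0<\gamma<1$, a finite constant $C_{N,1,\gamma}>0$, depending only on $N$ and $\gamma$, with $C_{N,1,\gamma}\to+\infty$ as $\gamma\to 1$, such that for every $0<\gamma<1$ and every open set $\Omega\subseteq\mathbb{R}^N$ $$\sigma_{N,1}\,\gamma\,\frac{1}{R_{1,\gamma}(\Omega)}\le h(\Omega)\le C_{N,1,\gamma}\,\frac{1}{R_{1,\gamma}(\Omega)}.$$ In particular, $h(\Omega)>0$ if and only if $R_{1,\gamma}(\Omega)<+\infty$, and the last condition does not depend on $0<\gamma<1$.
   Context: $B_r(x_0)=\{x\in\mathbb{R}^N: |x-x_0|<r\}$. $C^\infty_0(E)$ is the space of infinitely differentiable functions whose support is a compact subset of $E$. The Cheeger constant of an open set $\Omega\subseteq\mathbb{R}^N$ is $$h(\Omega)=\inf\left\{\frac{\mathcal{H}^{N-1}(\partial E)}{|E|} : E\Subset\Omega\text{ (nonempty) open set with smooth boundary}\right\},$$ where $\mathcal{H}^{N-1}$ is the $(N-1)$-dimensional Hausdorff measure, $|E|$ is the Lebesgue measure, and $E\Subset\Omega$ means that $\overline{E}$ is a compact subset of $\Omega$. For an open set $E\subseteq\mathbb{R}^N$ and a compact set $\Sigma\subseteq E$, the $1$-capacity of $\Sigma$ relative to $E$ is $$\mathrm{cap}_1(\Sigma;E)=\inf_{\varphi\in C^\infty_0(E)}\left\{\int_E|\nabla\varphi|\,dx : \varphi\ge 1\text{ on }\Sigma\right\}.$$ For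 $0<\gamma<1$, a compact set $\Sigma\subseteq\overline{B_r(x_0)}$ is called $(1,\gamma)$-negligible if $\mathrm{cap}_1(\Sigma;B_{2r}(x_0))\le\gamma\,\mathrm{cap}_1(\overline{B_r(x_0)};B_{2r}(x_0))$. The capacitary inradius is $$R_{1,\gamma}(\Omega)=\sup\Big\{r>0 : \exists x_0\in\mathbb{R}^N\text{ such that }\overline{B_r(x_0)}\setminus\Omega\text{ is }(1,\gamma)\text{-negligible}\Big\}\in[0,+\infty].$$ Conventions: $1/(+\infty)=0$; for $\Omega=\emptyset$ one takes $\sup\emptyset=0$, $\inf\emptyset=+\infty$, $1/0=+\infty$. *)

theory Defs
  imports "HOL-Analysis.Analysis"
begin

section \<open>Smooth functions and gradients\<close>

text \<open>Continuous differentiability of order \<open>k\<close>; meaningful on open sets, since the derivatives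
  are taken in full neighbourhoods.\<close>

primrec Ck_on :: "nat \<Rightarrow> 'a set \<Rightarrow> ('a::euclidean_space \<Rightarrow> real) \<Rightarrow> bool" where
  "Ck_on 0 U f \<longleftrightarrow> continuous_on U f"
| "Ck_on (Suc k) U f \<longleftrightarrow>
     (\<forall>x\<in>U. f differentiable (at x)) \<and>
     (\<forall>v. Ck_on k U (\<lambda>x. frechet_derivative f (at x) v))"

definition smooth_on :: "'a::euclidean_space set \<Rightarrow> ('a \<Rightarrow> real) \<Rightarrow> bool" where
  "smooth_on U f \<longleftrightarrow> (\<forall>k. Ck_on k U f)"

definition grad :: "('a::euclidean_space \<Rightarrow> real) \<Rightarrow> 'a \<Rightarrow> 'a" where
  "grad f x = (\<Sum>b\<in>Basis. frechet_derivative f (at x) b *\<^sub>R b)"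

lemma GDERIV_grad:
  assumes "f differentiable (at x)"
  shows "GDERIV f x :> grad f x"
proof -
  define D where "D = frechet_derivative f (at x)"
  have D: "(f has_derivative D) (at x)"
    using assms unfolding D_def by (simp add: frechet_derivative_works)
  then interpret linear D
    by (rule has_derivative_linear)
  have "D h = h \<bullet> grad f x" for h
  proof -
    have "D h = D (\<Sum>b\<in>Basis. (h \<bullet> b) *\<^sub>R b)"
      by (simp add: euclidean_representation)
    also have "\<dots> = (\<Sum>b\<in>Basis. (h \<bullet> b) * D b)"
      by (simp add: sum scale)
    also have "\<dots> = h \<bullet> grad f x"
      by (simp add: grad_def D_def inner_sum_right mult.commute)
    finally show ?thesis .
  qed
  then have "D = (\<lambda>h. h \<bullet> grad f x)"
    by blast
  with D show ?thesis
    by (simp add: gderiv_def)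
qed

text \<open>Elements of \<open>C\<^sub>0\<^sup>\<infinity>(E)\<close> are represented by their extension by zero to the whole space.\<close>

definition smooth_compact_support :: "'a::euclidean_space set \<Rightarrow> ('a \<Rightarrow> real) set" where
  "smooth_compact_support E =
     {f. smooth_on UNIV f \<and> compact (closure {x. f x \<noteq> 0}) \<and> closure {x. f x \<noteq> 0} \<subseteq> E}"


section \<open>The Cheeger constant\<close>

text \<open>Near each boundary point, \<open>E\<close> is the sublevel set of a smooth function without critical
  points (equivalently, up to a rotation, one side of the graph of a smooth function).\<close>

definition smooth_boundary :: "'a::euclidean_space set \<Rightarrow> bool" where
  "smooth_boundary E \<longleftrightarrow>
     (\<forall>x\<in>frontier E. \<exists>U g. open U \<and> x \<in> U \<and> smooth_on U g \<and> (\<forall>y\<in>U. grad g y \<noteq> 0) \<and>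
        E \<inter> U = {y\<in>U. g y < 0} \<and> frontier E \<inter> U = {y\<in>U. g y = 0})"

text \<open>Hausdorff measure with the normalisation for which the \<open>k\<close>-dimensional measure agrees with
  \<open>k\<close>-dimensional area: a set \<open>C\<close> of a covering contributes the volume of a \<open>k\<close>-ball of the same
  diameter. Covering sets are required to be bounded because \<open>diameter\<close> is a junk value otherwise;
  the empty set contributes nothing, also when \<open>k = 0\<close>.\<close>

definition hausdorff_gauge :: "nat \<Rightarrow> 'a::metric_space set \<Rightarrow> ennreal" where
  "hausdorff_gauge k C =
     (if C = {} then 0 else ennreal (unit_ball_vol (real k) * (diameter C / 2) ^ k))"

definition hausdorff_content :: "nat \<Rightarrow> real \<Rightarrow> 'a::metric_space set \<Rightarrow> ennreal" where
  "hausdorff_content k \<delta> A =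
     (INF C\<in>{C :: nat \<Rightarrow> 'a set. A \<subseteq> (\<Union>i. C i) \<and> (\<forall>i. bounded (C i) \<and> diameter (C i) \<le> \<delta>)}.
        \<Sum>i. hausdorff_gauge k (C i))"

definition hausdorff_measure :: "nat \<Rightarrow> 'a::metric_space set \<Rightarrow> ennreal" where
  "hausdorff_measure k A = (SUP \<delta>\<in>{0<..}. hausdorff_content k \<delta> A)"

definition cheeger_constant :: "'a::euclidean_space set \<Rightarrow> ennreal" where
  "cheeger_constant \<Omega> =
     (INF E\<in>{E. open E \<and> E \<noteq> {} \<and> smooth_boundary E \<and> compact (closure E) \<and> closure E \<subseteq> \<Omega>}.
        hausdorff_measure (DIM('a) - 1) (frontier E) / emeasure lborel E)"


section \<open>Capacity and capacitary inradius\<close>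

definition cap1 :: "'a::euclidean_space set \<Rightarrow> 'a set \<Rightarrow> ennreal" where
  "cap1 \<Sigma> E =
     (INF \<phi>\<in>{\<phi>\<in>smooth_compact_support E. \<forall>x\<in>\<Sigma>. \<phi> x \<ge> 1}.
        \<integral>\<^sup>+x\<in>E. ennreal (norm (grad \<phi> x)) \<partial>lborel)"

definition negligible1 :: "real \<Rightarrow> 'a::euclidean_space \<Rightarrow> real \<Rightarrow> 'a set \<Rightarrow> bool" where
  "negligible1 \<gamma> x0 r \<Sigma> \<longleftrightarrow>
     compact \<Sigma> \<and> \<Sigma> \<subseteq> cball x0 r \<and>
     cap1 \<Sigma> (ball x0 (2 * r)) \<le> ennreal \<gamma> * cap1 (cball x0 r) (ball x0 (2 * r))"

definition capacitary_inradius :: "real \<Rightarrow> 'a::euclidean_space set \<Rightarrow> ennreal" where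
  "capacitary_inradius \<gamma> \<Omega> =
     (SUP r\<in>{r. r > 0 \<and> (\<exists>x0. negligible1 \<gamma> x0 r (cball x0 r - \<Omega>))}. ennreal r)"

end

theory Submission
  imports Defs
begin

text \<open>Everything is done with smooth functions; no \<open>BV\<close> theory, coarea formula or isoperimetric
  inequality is needed.

  Integrating \<open>\<phi>\<close> along outgoing rays gives \<open>\<integral>\<^bsub>B\<^sub>r\<^esub> \<bar>\<phi>\<bar> \<le> (r/N) \<integral> \<bar>\<nabla>\<phi>\<bar>\<close>, with a constant sharp enough
  that \<open>B\<^sub>r\<close> has capacity \<open>N \<omega>\<^sub>N r\<^sup>N\<^sup>-\<^sup>1\<close>, where \<open>\<omega>\<^sub>N\<close> is the volume of the unit ball.

  For the lower bound, let \<open>E\<close> be a competitor for \<open>h(\<Omega>)\<close> and \<open>w\<close> a smooth approximation of its indicator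
  function. If the perimeter of \<open>E\<close> is at most a small multiple of \<open>\<gamma> \<bar>E\<bar> / r\<close>, then on average over
  the centres \<open>p \<in> E\<close> both \<open>\<integral>\<^bsub>B\<^sub>2\<^sub>r(p)\<^esub> \<bar>\<nabla>w\<bar>\<close> and \<open>(1/r) \<integral>\<^bsub>B\<^sub>2\<^sub>r(p)\<^esub> (1 - w)\<close> are at most a small multiple
  of \<open>\<gamma> r\<^sup>N\<^sup>-\<^sup>1\<close>. For a good centre a cutoff of \<open>1 - w\<close> shows that the closed ball minus \<open>\<Omega>\<close> is negligible.

  For the upper bound, let \<open>\<phi>\<close> be almost optimal for the capacity of the closed ball minus \<open>\<Omega>\<close>. By the ray
  inequality the mean of \<open>\<bar>\<phi>\<bar>\<close> over the ball is below 1, so a cutoff \<open>w\<close> of \<open>1 - \<phi>\<close> exceeds some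
  \<open>\<tau> > 0\<close> on a fixed proportion of the ball. A level set of \<open>w\<close> of small area (Eilenberg's inequality),
  made regular by a small linear perturbation (Sard's theorem applied to \<open>\<nabla>w\<close>), bounds a competitor
  for \<open>h(\<Omega>)\<close>.\<close>

section \<open>Calculus of smooth functions\<close>

text \<open>The two capacity bounds for the ball must share their leading constant. Negligibility
  only gives a \<phi> with energy below \<gamma>' times the capacity of the ball, for some \<gamma>'
  < 1, and the mean of \<open>\<bar>\<phi>\<bar>\<close> comes out below \<gamma>' exactly because
  \<open>r / N\<close> times \<open>N \<omega> r^(N-1)\<close> is the volume of the ball. A loss in
  either constant would exclude values of \<gamma> near 1. The lower bound is robust instead: losses
  go into \<sigma>, and only linearity in \<gamma> has to be preserved. The boundary of a competitor
  for h must be smooth, so its level must avoid critical values. For a real function of N variables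
  Sard's theorem asks for N derivatives; for the map \<nabla>w between equal dimensions
  differentiability is enough. If -a is a regular value of that map, the critical points of
  \<open>w x + x \<bullet> a\<close> are isolated, so a compact set contains finitely many, and
  leaving out finitely many levels costs nothing when a level is chosen by averaging.\<close>

lemma Ck_on_cong:
  assumes "open U" "\<And>x. x \<in> U \<Longrightarrow> f x = g x" "Ck_on k U f"
  shows "Ck_on k U g"
  using assms(2,3)
proof (induction k arbitrary: f g)
  case 0
  then show ?case by (simp cong: continuous_on_cong)
next
  case (Suc k)
  have D: "(g has_derivative frechet_derivative f (at x)) (at x)" if "x \<in> U" for x
    using Suc.prems that assms(1)
    by (intro has_derivative_transform_within_open[of f _ x UNIV U g])
       (auto simp: frechet_derivative_works[symmetric])
  then have eq: "frechet_derivative f (at x) = frechet_derivative g (at x)" if "x \<in> U" for x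
    using frechet_derivative_at that by blast
  have "Ck_on k U (\<lambda>x. frechet_derivative g (at x) v)" for v
    by (rule Suc.IH[of "\<lambda>x. frechet_derivative f (at x) v"]) (use Suc.prems eq in auto)
  with D show ?case
    by (auto simp: differentiable_def)
qed

lemma Ck_on_SucI:
  assumes "open U" "\<And>x. x \<in> U \<Longrightarrow> (f has_derivative D x) (at x)"
    and "\<And>v. Ck_on k U (\<lambda>x. D x v)"
  shows "Ck_on (Suc k) U f"
proof -
  have "Ck_on k U (\<lambda>x. frechet_derivative f (at x) v)" for v
    by (rule Ck_on_cong[OF assms(1) _ assms(3)[of v]])
      (metis assms(2) frechet_derivative_at)
  then show ?thesis
    using assms(2) by (auto simp: differentiable_def)
qed

lemma Ck_on_Suc_imp: "Ck_on (Suc k) U f \<Longrightarrow> Ck_on k U f"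
proof (induction k arbitrary: f)
  case 0
  then show ?case
    by (auto intro!: continuous_at_imp_continuous_on differentiable_imp_continuous_within)
next
  case (Suc k)
  then show ?case by (metis Ck_on.simps(2))
qed

lemma Ck_on_subset: "Ck_on k U f \<Longrightarrow> V \<subseteq> U \<Longrightarrow> Ck_on k V f"
  by (induction k arbitrary: f) (auto intro: continuous_on_subset)

lemma Ck_on_Union:
  assumes "\<And>U. U \<in> \<U> \<Longrightarrow> open U \<and> Ck_on k U f"
  shows "Ck_on k (\<Union>\<U>) f"
  using assms
proof (induction k arbitrary: f)
  case 0
  then show ?case by (auto intro: continuous_on_open_Union)
qed auto

lemma Ck_on_const: "Ck_on k U (\<lambda>x. c)"
  by (induction k arbitrary: c) auto

lemma Ck_on_linear:
  assumes "open U" "bounded_linear f"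
  shows "Ck_on k U f"
proof (cases k)
  case 0
  with assms show ?thesis by (auto intro: linear_continuous_on)
next
  case (Suc n)
  with assms show ?thesis
    by (auto intro!: Ck_on_SucI[where D="\<lambda>_. f"] Ck_on_const bounded_linear_imp_has_derivative
        simp del: Ck_on.simps)
qed

lemma Ck_on_add:
  assumes "open U" "Ck_on k U f" "Ck_on k U g"
  shows "Ck_on k U (\<lambda>x. f x + g x)"
  using assms(2,3)
proof (induction k arbitrary: f g)
  case 0
  then show ?case by (auto intro: continuous_on_add)
next
  case (Suc k)
  then show ?case
    by (intro Ck_on_SucI[OF assms(1),
          where D="\<lambda>x v. frechet_derivative f (at x) v + frechet_derivative g (at x) v"])
       (auto intro!: has_derivative_add simp: frechet_derivative_works[symmetric])
qed

lemma Ck_on_mult: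
  assumes "open U" "Ck_on k U f" "Ck_on k U g"
  shows "Ck_on k U (\<lambda>x. f x * g x)"
  using assms(2,3)
proof (induction k arbitrary: f g)
  case 0
  then show ?case by (auto intro: continuous_on_mult)
next
  case (Suc k)
  note fk = Ck_on_Suc_imp[OF Suc.prems(1)] and gk = Ck_on_Suc_imp[OF Suc.prems(2)]
  show ?case
  proof (rule Ck_on_SucI[OF assms(1),
          where D="\<lambda>x v. f x * frechet_derivative g (at x) v + frechet_derivative f (at x) v * g x"])
    show "((\<lambda>x. f x * g x) has_derivative
      (\<lambda>v. f x * frechet_derivative g (at x) v + frechet_derivative f (at x) v * g x)) (at x)"
      if "x \<in> U" for x
      using Suc.prems that by (auto intro!: has_derivative_mult simp: frechet_derivative_works[symmetric])
    show "Ck_on k U (\<lambda>x. f x * frechet_derivative g (at x) v + frechet_derivative f (at x) v * g x)" for v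
      using Suc.prems fk gk by (intro Ck_on_add assms(1) Suc.IH) auto
  qed
qed

lemma Ck_on_compose:
  assumes "open U" "open V" "Ck_on k V h" "Ck_on k U f" "f ` U \<subseteq> V"
  shows "Ck_on k U (\<lambda>x. h (f x))"
  using assms(3,4)
proof (induction k arbitrary: h)
  case 0
  then show ?case
    using assms(5) continuous_on_compose2 by (simp) blast
next
  case (Suc k)
  note fk = Ck_on_Suc_imp[OF Suc.prems(2)]
  show ?case
  \<comment> \<open>\<open>h\<close> depends on one real variable, so its derivative is
    multiplication by the number \<open>frechet_derivative h (at (f x)) 1\<close>. In this form the
    chain rule is a product, and the induction hypothesis applies to its first factor.\<close>
  proof (rule Ck_on_SucI[OF assms(1),
          where D="\<lambda>x v. frechet_derivative h (at (f x)) 1 * frechet_derivative f (at x) v"])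
    show "((\<lambda>x. h (f x)) has_derivative
      (\<lambda>v. frechet_derivative h (at (f x)) 1 * frechet_derivative f (at x) v)) (at x)"
      if "x \<in> U" for x
    proof -
      have h: "(h has_derivative frechet_derivative h (at (f x))) (at (f x))"
        using Suc.prems that assms(5) by (auto simp: frechet_derivative_works[symmetric])
      have f: "(f has_derivative frechet_derivative f (at x)) (at x)"
        using Suc.prems that by (auto simp: frechet_derivative_works[symmetric])
      have "((\<lambda>x. h (f x)) has_derivative
         (\<lambda>v. frechet_derivative h (at (f x)) (frechet_derivative f (at x) v))) (at x)"
        using has_derivative_compose[of f "frechet_derivative f (at x)" x UNIV h, OF f h] .
      moreover have "frechet_derivative h (at (f x)) y = frechet_derivative h (at (f x)) 1 * y" for y
        using linear_scale[OF has_derivative_linear[OF h], of y 1] by (simp add: mult.commute)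
      then have "(\<lambda>v. frechet_derivative h (at (f x)) (frechet_derivative f (at x) v)) =
          (\<lambda>v. frechet_derivative h (at (f x)) 1 * frechet_derivative f (at x) v)"
        by blast
      ultimately show ?thesis by (rule has_derivative_eq_rhs)
    qed
    show "Ck_on k U (\<lambda>x. frechet_derivative h (at (f x)) 1 * frechet_derivative f (at x) v)" for v
    proof (rule Ck_on_mult[OF assms(1)])
      show "Ck_on k U (\<lambda>x. frechet_derivative h (at (f x)) 1)"
        using Suc.prems(1) fk by (intro Suc.IH[of "\<lambda>y. frechet_derivative h (at y) 1"]) auto
      show "Ck_on k U (\<lambda>x. frechet_derivative f (at x) v)"
        using Suc.prems(2) by auto
    qed
  qed
qed

lemma Ck_on_inverse: "Ck_on k {0<..} (inverse :: real \<Rightarrow> real)"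
proof -
  \<comment> \<open>All positive powers at once: each has a multiple of the next one as derivative,
    so the induction on \<open>k\<close> closes.\<close>
  have "Ck_on k {0<..} (\<lambda>x::real. inverse x ^ Suc m)" for m
  proof (induction k arbitrary: m)
    case 0
    then show ?case by (auto intro!: continuous_intros)
  next
    case (Suc k)
    show ?case
    proof (rule Ck_on_SucI[where D="\<lambda>x v. (- real (Suc m) * v) * inverse x ^ Suc (Suc m)"])
      show "((\<lambda>x. inverse x ^ Suc m) has_derivative (\<lambda>v. - real (Suc m) * v * inverse x ^ Suc (Suc m))) (at x)"
        if "x \<in> {0<..}" for x :: real
      proof -
        have "(inverse has_derivative (\<lambda>v. - (inverse x * v * inverse x))) (at x)"
          using that by (intro has_derivative_inverse') auto
        from has_derivative_power[OF this, of "Suc m"] show ?thesis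
          by (rule has_derivative_eq_rhs) (auto simp: fun_eq_iff algebra_simps)
      qed
      show "Ck_on k {0<..} (\<lambda>x::real. - real (Suc m) * v * inverse x ^ Suc (Suc m))" for v
        by (rule Ck_on_mult[OF open_greaterThan Ck_on_const Suc])
    qed auto
  qed
  from this[of 0] show ?thesis by simp
qed

lemma smooth_on_const: "smooth_on U (\<lambda>x. c)"
  by (simp add: smooth_on_def Ck_on_const)

lemma smooth_on_linear: "open U \<Longrightarrow> bounded_linear f \<Longrightarrow> smooth_on U f"
  by (simp add: smooth_on_def Ck_on_linear)

lemma smooth_on_add: "open U \<Longrightarrow> smooth_on U f \<Longrightarrow> smooth_on U g \<Longrightarrow> smooth_on U (\<lambda>x. f x + g x)"
  by (simp add: smooth_on_def Ck_on_add)

lemma smooth_on_mult: "open U \<Longrightarrow> smooth_on U f \<Longrightarrow> smooth_on U g \<Longrightarrow> smooth_on U (\<lambda>x. f x * g x)"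
  by (simp add: smooth_on_def Ck_on_mult)

lemma smooth_on_diff:
  assumes "open U" "smooth_on U f" "smooth_on U g"
  shows "smooth_on U (\<lambda>x. f x - g x)"
  using smooth_on_add[OF assms(1,2) smooth_on_mult[OF assms(1) smooth_on_const[of _ "-1"] assms(3)]]
  by simp

lemma smooth_on_sum:
  assumes "open U" "\<And>i. i \<in> I \<Longrightarrow> smooth_on U (f i)"
  shows "smooth_on U (\<lambda>x. \<Sum>i\<in>I. f i x)"
  using assms(2)
  by (induction I rule: infinite_finite_induct) (auto intro: smooth_on_const smooth_on_add assms(1))

lemma smooth_on_prod:
  assumes "open U" "\<And>i. i \<in> I \<Longrightarrow> smooth_on U (f i)"
  shows "smooth_on U (\<lambda>x. \<Prod>i\<in>I. f i x)"
  using assms(2)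
  by (induction I rule: infinite_finite_induct) (auto intro: smooth_on_const smooth_on_mult assms(1))

lemma smooth_on_compose:
  "open U \<Longrightarrow> open V \<Longrightarrow> smooth_on V h \<Longrightarrow> smooth_on U f \<Longrightarrow> f ` U \<subseteq> V \<Longrightarrow> smooth_on U (\<lambda>x. h (f x))"
  by (simp add: smooth_on_def Ck_on_compose)

lemma smooth_on_subset: "smooth_on U f \<Longrightarrow> V \<subseteq> U \<Longrightarrow> smooth_on V f"
  using Ck_on_subset unfolding smooth_on_def by blast

lemma smooth_on_cong:
  "open U \<Longrightarrow> (\<And>x. x \<in> U \<Longrightarrow> f x = g x) \<Longrightarrow> smooth_on U f \<Longrightarrow> smooth_on U g"
  using Ck_on_cong unfolding smooth_on_def by blast

lemma smooth_on_Union: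
  "(\<And>U. U \<in> \<U> \<Longrightarrow> open U \<and> smooth_on U f) \<Longrightarrow> smooth_on (\<Union>\<U>) f"
  using Ck_on_Union unfolding smooth_on_def by metis

lemma smooth_on_norm_sq: "smooth_on UNIV (\<lambda>x. (norm (x - p))\<^sup>2)"
proof -
  have "smooth_on UNIV (\<lambda>x. (x - p) \<bullet> b)" for b
    using smooth_on_diff[OF open_UNIV smooth_on_linear[OF open_UNIV bounded_linear_inner_left]
        smooth_on_const[of _ "p \<bullet> b"], of b]
    by (simp add: inner_diff_left)
  then have "smooth_on UNIV (\<lambda>x. \<Sum>b\<in>Basis. ((x - p) \<bullet> b) * ((x - p) \<bullet> b))"
    by (intro smooth_on_sum smooth_on_mult) auto
  then show ?thesis
    by (simp add: power2_norm_eq_inner euclidean_inner[of "_ - _" "_ - _"])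
qed

lemma smooth_on_differentiable: "smooth_on U f \<Longrightarrow> x \<in> U \<Longrightarrow> f differentiable (at x)"
  unfolding smooth_on_def by (metis Ck_on.simps(2))

lemma smooth_on_continuous: "smooth_on U f \<Longrightarrow> continuous_on U f"
  unfolding smooth_on_def by (metis Ck_on.simps(1))

section \<open>Gradient calculus\<close>

lemma has_derivative_grad:
  "f differentiable (at x) \<Longrightarrow> (f has_derivative (\<lambda>v. v \<bullet> grad f x)) (at x)"
  using GDERIV_grad[unfolded gderiv_def] .

lemma grad_eqI:
  assumes "(f has_derivative (\<lambda>v. v \<bullet> a)) (at x)"
  shows "grad f x = a"
proof -
  have "(\<lambda>v. v \<bullet> a) = frechet_derivative f (at x)"
    using assms by (rule frechet_derivative_at)
  then show ?thesis
    unfolding grad_def by (metis (no_types, lifting) euclidean_representation inner_commute sum.cong)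
qed

lemma grad_inner_Basis: "b \<in> Basis \<Longrightarrow> grad f x \<bullet> b = frechet_derivative f (at x) b"
  unfolding grad_def by (simp add: inner_sum_left inner_Basis if_distrib cong: if_cong)

lemma smooth_on_grad: "smooth_on U f \<Longrightarrow> b \<in> Basis \<Longrightarrow> smooth_on U (\<lambda>x. grad f x \<bullet> b)"
  unfolding smooth_on_def grad_inner_Basis by (metis Ck_on.simps(2))

lemma continuous_on_grad: "smooth_on U f \<Longrightarrow> continuous_on U (grad f)"
proof -
  assume "smooth_on U f"
  then have "continuous_on U (\<lambda>x. \<Sum>b\<in>Basis. (grad f x \<bullet> b) *\<^sub>R b)"
    by (auto intro!: continuous_intros smooth_on_continuous smooth_on_grad)
  then show ?thesis
    by (simp add: euclidean_representation)
qed

lemma grad_cong: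
  assumes "open U" "x \<in> U" "\<And>y. y \<in> U \<Longrightarrow> f y = g y"
  shows "grad f x = grad g x"
proof -
  have "(f has_derivative D) (at x) \<longleftrightarrow> (g has_derivative D) (at x)" for D
    using assms by (metis has_derivative_transform_within_open)
  then show ?thesis
    by (simp add: grad_def frechet_derivative_def)
qed

lemma grad_const [simp]: "grad (\<lambda>x. c) x = 0"
  by (rule grad_eqI) simp

lemma grad_add:
  "f differentiable (at x) \<Longrightarrow> g differentiable (at x) \<Longrightarrow> grad (\<lambda>x. f x + g x) x = grad f x + grad g x"
  by (rule grad_eqI) (auto intro!: derivative_eq_intros has_derivative_grad simp: inner_add_right)

lemma grad_diff:
  "f differentiable (at x) \<Longrightarrow> g differentiable (at x) \<Longrightarrow> grad (\<lambda>x. f x - g x) x = grad f x - grad g x"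
  by (rule grad_eqI) (auto intro!: derivative_eq_intros has_derivative_grad simp: inner_diff_right)

lemma grad_mult:
  "f differentiable (at x) \<Longrightarrow> g differentiable (at x) \<Longrightarrow>
    grad (\<lambda>x. f x * g x) x = f x *\<^sub>R grad g x + g x *\<^sub>R grad f x"
  by (rule grad_eqI) (auto intro!: derivative_eq_intros has_derivative_grad simp: inner_add_right)

lemma grad_inner_right: "grad (\<lambda>x. x \<bullet> a) x = a"
  by (rule grad_eqI) (auto intro!: derivative_eq_intros)

section \<open>Bump functions\<close>

text \<open>For \<open>m = 0\<close> this is the classical flat function. The powers of
  \<open>1 / x\<close> make the family closed under differentiation: the derivative of member
  \<open>m\<close> combines members \<open>m + 1\<close> and \<open>m + 2\<close>.\<close>

definition flat_exp :: "nat \<Rightarrow> real \<Rightarrow> real" where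
  "flat_exp m x = (if x > 0 then inverse x ^ m * exp (- inverse x) else 0)"

lemma flat_exp_nonneg: "flat_exp m x \<ge> 0"
  by (simp add: flat_exp_def)

lemma flat_exp_pos: "x > 0 \<Longrightarrow> flat_exp m x > 0"
  by (simp add: flat_exp_def)

lemma flat_exp_nonpos_arg: "x \<le> 0 \<Longrightarrow> flat_exp m x = 0"
  by (simp add: flat_exp_def)

text \<open>Quadratic decay makes the difference quotient at 0 tend to 0. With
  \<open>t = 1 / x\<close> and \<open>n = m + 2\<close> it is the \<open>n\<close>-th power of
  \<open>t / n \<le> exp (t / n)\<close>.\<close>

lemma flat_exp_le: "flat_exp m x \<le> real (m + 2) ^ (m + 2) * x\<^sup>2"
proof (cases "x > 0")
  case True
  define n where "n = m + 2"
  define t where "t = inverse x"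
  have t: "t > 0" and n: "real n > 0"
    using True by (auto simp: t_def n_def)
  have "t / n \<le> exp (t / n)"
    by (rule order_trans[OF _ exp_ge_add_one_self]) simp
  then have "(t / n) ^ n \<le> exp (t / n) ^ n"
    using t by (intro power_mono) auto
  also have "\<dots> = exp t"
    using n by (simp add: exp_of_nat_mult[symmetric])
  finally have "t ^ n \<le> real n ^ n * exp t"
    using n by (simp add: power_divide field_simps)
  then have "t ^ n * exp (- t) \<le> real n ^ n"
    by (simp add: exp_minus field_simps)
  then have "x\<^sup>2 * (t ^ n * exp (- t)) \<le> x\<^sup>2 * real n ^ n"
    by (intro mult_left_mono) auto
  moreover have "x\<^sup>2 * (t ^ n * exp (- t)) = t ^ m * exp (- t)"
    using True by (simp add: t_def n_def power_add field_simps power2_eq_square)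
  ultimately have "t ^ m * exp (- t) \<le> real n ^ n * x\<^sup>2"
    by (simp only: mult.commute)
  then show ?thesis
    using True by (simp only: flat_exp_def t_def n_def if_True)
qed (simp add: flat_exp_def)

lemma flat_exp_has_derivative:
  "(flat_exp m has_real_derivative (flat_exp (m + 2) x - real m * flat_exp (m + 1) x)) (at x)"
proof -
  consider "x > 0" | "x < 0" | "x = 0" by linarith
  then show ?thesis
  proof cases
    case 1
    have "((\<lambda>x. inverse x ^ m) has_real_derivative - real m * inverse x ^ (m + 1)) (at x)"
      using DERIV_power[OF DERIV_inverse[of x UNIV], of m] 1
      by (cases m) (simp_all add: numeral_2_eq_2 algebra_simps)
    moreover have "((\<lambda>x. exp (- inverse x)) has_real_derivative inverse x * inverse x * exp (- inverse x)) (at x)"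
      using 1 by (auto intro!: derivative_eq_intros)
    ultimately have "((\<lambda>x. inverse x ^ m * exp (- inverse x)) has_real_derivative
        - real m * inverse x ^ (m + 1) * exp (- inverse x) +
        inverse x * inverse x * exp (- inverse x) * inverse x ^ m) (at x)"
      by (rule DERIV_mult)
    then have "((\<lambda>x. inverse x ^ m * exp (- inverse x)) has_real_derivative
        (flat_exp (m + 2) x - real m * flat_exp (m + 1) x)) (at x)"
      by (rule DERIV_cong) (use 1 in \<open>simp add: flat_exp_def power_add mult_ac\<close>)
    moreover have "flat_exp m y = inverse y ^ m * exp (- inverse y)" if "y \<in> {0<..}" for y
      using that by (simp add: flat_exp_def)
    ultimately show ?thesis
      using 1 by (elim has_field_derivative_transform_within_open[where S="{0<..}"]) auto
  next
    case 2
    have "((\<lambda>x::real. 0) has_real_derivative 0) (at x)" by simp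
    then have "(flat_exp m has_real_derivative 0) (at x)"
      by (rule has_field_derivative_transform_within_open[where S="{..<0}"])
        (use 2 in \<open>auto simp: flat_exp_def\<close>)
    with 2 show ?thesis by (simp add: flat_exp_def)
  next
    case 3
    have "((\<lambda>h. flat_exp m h / h) \<longlongrightarrow> 0) (at 0)"
    proof (rule tendsto_0_le[where K="real (m + 2) ^ (m + 2)"])
      show "((\<lambda>h::real. h) \<longlongrightarrow> 0) (at 0)" by (rule tendsto_ident_at)
      show "\<forall>\<^sub>F h in at 0. norm (flat_exp m h / h) \<le> norm h * real (m + 2) ^ (m + 2)"
      proof (rule always_eventually, rule allI)
        fix h :: real
        show "norm (flat_exp m h / h) \<le> norm h * real (m + 2) ^ (m + 2)"
        proof (cases "h = 0")
          case False
          then show ?thesis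
            using flat_exp_le[of m h] flat_exp_nonneg[of m h]
            by (simp add: divide_le_eq power2_eq_square mult_ac abs_mult[symmetric])
        qed simp
      qed
    qed
    then show ?thesis
      using 3 by (simp add: DERIV_def flat_exp_def[of _ 0])
  qed
qed

lemma smooth_on_flat_exp: "smooth_on UNIV (flat_exp m)"
proof -
  have "Ck_on k UNIV (flat_exp m)" for k
  proof (induction k arbitrary: m)
    case 0
    then show ?case
      by (auto intro!: continuous_at_imp_continuous_on DERIV_isCont flat_exp_has_derivative)
  next
    case (Suc k)
    show ?case
    proof (rule Ck_on_SucI[where D="\<lambda>x v. (flat_exp (m + 2) x + (- real m) * flat_exp (m + 1) x) * v"])
      show "(flat_exp m has_derivative (\<lambda>v. (flat_exp (m + 2) x + - real m * flat_exp (m + 1) x) * v)) (at x)" for x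
        using flat_exp_has_derivative[of m x] by (simp add: has_field_derivative_def)
      show "Ck_on k UNIV (\<lambda>x. (flat_exp (m + 2) x + - real m * flat_exp (m + 1) x) * v)" for v
        by (intro Ck_on_mult Ck_on_add Ck_on_const Suc) auto
    qed auto
  qed
  then show ?thesis by (simp add: smooth_on_def)
qed

text \<open>The quotient \<open>u / (u + v)\<close> of two flat functions: \<open>u\<close> is
  positive left of \<open>b\<close>, \<open>v\<close> right of \<open>a\<close>, and since
  \<open>a < b\<close> the denominator never vanishes. The lower bound on \<open>F'\<close> yields
  the gradient bound of a cutoff, its sign the direction of the gradient.\<close>

lemma smooth_step:
  fixes a b :: real
  assumes "a < b"
  obtains F F' :: "real \<Rightarrow> real" and C where "C > 0" "smooth_on UNIV F"
    "\<And>s. (F has_real_derivative F' s) (at s)" "\<And>s. - C \<le> F' s" "\<And>s. F' s \<le> 0"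
    "\<And>s. s \<le> a \<Longrightarrow> F s = 1" "\<And>s. s \<ge> b \<Longrightarrow> F s = 0" "\<And>s. 0 \<le> F s" "\<And>s. F s \<le> 1"
    "\<And>s. s \<notin> {a<..<b} \<Longrightarrow> F' s = 0"
proof -
  define u where "u s = flat_exp 0 (b - s)" for s
  define v where "v s = flat_exp 0 (s - a)" for s
  define u' where "u' s = - flat_exp 2 (b - s)" for s
  define v' where "v' s = flat_exp 2 (s - a)" for s
  define F where "F s = u s * inverse (u s + v s)" for s
  define F' where "F' s = (u' s * v s - u s * v' s) / (u s + v s)\<^sup>2" for s
  have nn: "u s \<ge> 0" "v s \<ge> 0" "v' s \<ge> 0" "u' s \<le> 0" for s
    by (auto simp: u_def v_def v'_def u'_def flat_exp_nonneg)
  have pos: "u s + v s > 0" for s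
  proof (cases "s < b")
    case True
    then have "u s > 0" by (simp add: u_def flat_exp_pos)
    then show ?thesis using nn[of s] by linarith
  next
    case False
    then have "v s > 0" using assms by (simp add: v_def flat_exp_pos)
    then show ?thesis using nn[of s] by linarith
  qed
  have du: "(u has_real_derivative u' s) (at s)" for s
    unfolding u_def[abs_def] u'_def
    by (rule DERIV_cong[OF DERIV_chain2[OF flat_exp_has_derivative]])
      (auto intro!: derivative_eq_intros simp: numeral_2_eq_2)
  have dv: "(v has_real_derivative v' s) (at s)" for s
    unfolding v_def[abs_def] v'_def
    by (rule DERIV_cong[OF DERIV_chain2[OF flat_exp_has_derivative]])
      (auto intro!: derivative_eq_intros simp: numeral_2_eq_2)
  have dF: "(F has_real_derivative F' s) (at s)" for s
    unfolding F_def[abs_def] F'_def using pos[of s]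
    by (auto intro!: derivative_eq_intros du dv simp: field_simps power2_eq_square)
  have idsm: "smooth_on UNIV (\<lambda>s::real. s)"
    by (rule smooth_on_linear) (auto intro: bounded_linear_ident)
  have su: "smooth_on UNIV u"
    unfolding u_def[abs_def]
    by (rule smooth_on_compose[OF open_UNIV open_UNIV smooth_on_flat_exp])
      (auto intro!: smooth_on_diff smooth_on_const idsm)
  have sv: "smooth_on UNIV v"
    unfolding v_def[abs_def]
    by (rule smooth_on_compose[OF open_UNIV open_UNIV smooth_on_flat_exp])
      (auto intro!: smooth_on_diff smooth_on_const idsm)
  have "smooth_on UNIV (\<lambda>s. inverse (u s + v s))"
    using Ck_on_inverse pos
    by (intro smooth_on_compose[where h=inverse, OF open_UNIV open_greaterThan[of 0] _ smooth_on_add[OF open_UNIV su sv]])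
      (auto simp: smooth_on_def)
  then have sF: "smooth_on UNIV F"
    unfolding F_def[abs_def] by (rule smooth_on_mult[OF open_UNIV su])
  have "continuous_on UNIV F'"
  proof -
    have "continuous_on UNIV (flat_exp 2)"
      by (rule smooth_on_continuous[OF smooth_on_flat_exp])
    then have "continuous_on UNIV (\<lambda>s. flat_exp 2 (b - s))" "continuous_on UNIV (\<lambda>s. flat_exp 2 (s - a))"
      by (rule continuous_on_compose2; auto intro!: continuous_intros)+
    then show ?thesis
      using pos smooth_on_continuous[OF su] smooth_on_continuous[OF sv]
      unfolding F'_def[abs_def] u'_def[abs_def] v'_def[abs_def]
      by (intro continuous_intros) (auto simp: less_imp_neq[THEN not_sym])
  qed
  then have "bounded (F' ` {a..b})"
    by (intro compact_imp_bounded compact_continuous_image) (auto intro: continuous_on_subset)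
  then obtain C where C: "C > 0" "\<And>s. s \<in> {a..b} \<Longrightarrow> norm (F' s) \<le> C"
    unfolding bounded_pos by blast
  have 0: "F' s = 0" if "s \<notin> {a<..<b}" for s
    using that by (auto simp: F'_def u_def v_def u'_def v'_def flat_exp_nonpos_arg not_less)
  show ?thesis
  proof (rule that[of C F F'])
    show "- C \<le> F' s" for s
      using C(1) C(2)[of s] 0[of s] by (cases "s \<in> {a<..<b}") auto
    show "F' s \<le> 0" for s
      using nn[of s] unfolding F'_def by (intro divide_nonpos_nonneg) (auto simp: mult_nonpos_nonneg intro: order_trans[of _ 0])
    show "F s = 1" if "s \<le> a" for s
      using that pos[of s] by (auto simp: F_def v_def flat_exp_nonpos_arg)
    show "F s = 0" if "s \<ge> b" for s
      using that by (auto simp: F_def u_def flat_exp_nonpos_arg)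
    show "0 \<le> F s" for s
      using nn[of s] by (simp add: F_def)
    show "F s \<le> 1" for s
      using nn[of s] pos[of s] by (simp add: F_def field_simps)
  qed (use C(1) sF dF 0 in auto)
qed

text \<open>A step function of \<open>\<bar>x - p\<bar>\<^sup>2 / r\<^sup>2\<close>; the square
  keeps it smooth at the centre, and scaling makes \<open>C\<close> independent of \<open>p\<close>
  and \<open>r\<close>. The last clause says that the gradient points towards the centre, so that
  its norm integrates along a ray to the exact drop of \<eta>.\<close>

lemma bump_exists:
  fixes a b :: real
  assumes "0 < a" "a < b"
  obtains C where "C > 0" "\<And>(p::'a::euclidean_space) r. r > 0 \<Longrightarrow>
    \<exists>\<eta>. smooth_on UNIV \<eta> \<and> (\<forall>x. 0 \<le> \<eta> x \<and> \<eta> x \<le> 1) \<and>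
      (\<forall>x\<in>cball p (a * r). \<eta> x = 1) \<and> (\<forall>x. x \<notin> ball p (b * r) \<longrightarrow> \<eta> x = 0) \<and>
      (\<forall>x. norm (grad \<eta> x) \<le> C / r) \<and> (\<forall>x. x \<notin> ball p (b * r) - cball p (a * r) \<longrightarrow> grad \<eta> x = 0) \<and>
      (\<forall>x. grad \<eta> x \<bullet> (x - p) = - norm (grad \<eta> x) * norm (x - p))"
proof -
  have "a\<^sup>2 < b\<^sup>2" using assms by (intro power_strict_mono) auto
  then obtain F F' :: "real \<Rightarrow> real" and C where F: "C > 0" "smooth_on UNIV F"
    "\<And>s. (F has_real_derivative F' s) (at s)" "\<And>s. - C \<le> F' s" "\<And>s. F' s \<le> 0"
    "\<And>s. s \<le> a\<^sup>2 \<Longrightarrow> F s = 1" "\<And>s. s \<ge> b\<^sup>2 \<Longrightarrow> F s = 0" "\<And>s. 0 \<le> F s" "\<And>s. F s \<le> 1"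
    "\<And>s. s \<notin> {a\<^sup>2<..<b\<^sup>2} \<Longrightarrow> F' s = 0"
    by (rule smooth_step) (rule that, assumption+)
  show ?thesis
  \<comment> \<open>The gradient norm is
    \<open>2 \<bar>F'\<bar> \<bar>x - p\<bar> / r\<^sup>2\<close>, and
    \<open>\<bar>x - p\<bar>\<close> is below \<open>b * r\<close> where it does not vanish.\<close>
  proof (rule that[of "2 * C * b"])
    show "2 * C * b > 0" using F assms by auto
    fix p :: 'a and r :: real assume r: "r > 0"
    define q where "q x = (norm (x - p))\<^sup>2 / r\<^sup>2" for x
    define \<eta> where "\<eta> x = F (q x)" for x
    have q: "q x = (norm (x - p) / r)\<^sup>2" for x by (simp add: q_def power_divide)
    have sq: "smooth_on UNIV q"
      using smooth_on_mult[OF open_UNIV smooth_on_norm_sq smooth_on_const[of _ "inverse (r\<^sup>2)"], of p]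
      by (simp add: q_def[abs_def] divide_inverse)
    have s\<eta>: "smooth_on UNIV \<eta>"
      unfolding \<eta>_def[abs_def] by (rule smooth_on_compose[OF open_UNIV open_UNIV F(2) sq]) auto
    have q1: "q x \<le> a\<^sup>2" if "x \<in> cball p (a * r)" for x
      using that r assms unfolding q by (intro power_mono) (auto simp: dist_norm norm_minus_commute field_simps)
    have q2: "q x \<ge> b\<^sup>2" if "x \<notin> ball p (b * r)" for x
      using that r assms unfolding q by (intro power_mono) (auto simp: dist_norm norm_minus_commute field_simps)
    have g: "grad \<eta> x = (2 * F' (q x) / r\<^sup>2) *\<^sub>R (x - p)" for x
    proof (rule grad_eqI)
      have "(q has_derivative (\<lambda>v. (2 / r\<^sup>2) * (v \<bullet> (x - p)))) (at x)"
        unfolding q_def[abs_def] power2_norm_eq_inner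
        using r by (auto intro!: derivative_eq_intros simp: inner_commute field_simps)
      from has_derivative_compose[OF this F(3)[of "q x", unfolded has_field_derivative_def]]
      show "(\<eta> has_derivative (\<lambda>v. v \<bullet> (2 * F' (q x) / r\<^sup>2) *\<^sub>R (x - p))) (at x)"
        by (simp add: \<eta>_def[abs_def] mult_ac)
    qed
    have ng: "norm (grad \<eta> x) = - 2 * F' (q x) / r\<^sup>2 * norm (x - p)" for x
      using F(5)[of "q x"] r by (simp add: g)
    have g0: "grad \<eta> x = 0" if "x \<notin> ball p (b * r) - cball p (a * r)" for x
      using that q1[of x] q2[of x] F(10)[of "q x"] by (auto simp: g)
    have "norm (grad \<eta> x) \<le> 2 * C * b / r" for x
    proof (cases "x \<in> ball p (b * r)")
      case True
      then have "norm (x - p) \<le> b * r" by (auto simp: dist_norm norm_minus_commute)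
      moreover have "- 2 * F' (q x) / r\<^sup>2 \<le> 2 * C / r\<^sup>2"
        using F(4)[of "q x"] r by (intro divide_right_mono) auto
      ultimately have "- 2 * F' (q x) / r\<^sup>2 * norm (x - p) \<le> 2 * C / r\<^sup>2 * (b * r)"
        using F(1) r by (intro mult_mono) auto
      also have "\<dots> = 2 * C * b / r" using r by (simp add: power2_eq_square)
      finally show ?thesis by (simp add: ng)
    next
      case False
      then show ?thesis using g0[of x] F assms r by simp
    qed
    moreover have "grad \<eta> x \<bullet> (x - p) = - norm (grad \<eta> x) * norm (x - p)" for x
      by (simp add: ng) (simp add: g dot_square_norm power2_eq_square)
    ultimately show "\<exists>\<eta>. smooth_on UNIV \<eta> \<and> (\<forall>x. 0 \<le> \<eta> x \<and> \<eta> x \<le> 1) \<and>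
      (\<forall>x\<in>cball p (a * r). \<eta> x = 1) \<and> (\<forall>x. x \<notin> ball p (b * r) \<longrightarrow> \<eta> x = 0) \<and>
      (\<forall>x. norm (grad \<eta> x) \<le> 2 * C * b / r) \<and> (\<forall>x. x \<notin> ball p (b * r) - cball p (a * r) \<longrightarrow> grad \<eta> x = 0) \<and>
      (\<forall>x. grad \<eta> x \<bullet> (x - p) = - norm (grad \<eta> x) * norm (x - p))"
      using s\<eta> g0 q1 q2 F by (intro exI[of _ \<eta>]) (auto simp: \<eta>_def)
  qed
qed

section \<open>Integration along rays and the capacity of balls\<close>

lemma nn_integral_lborel_scale:
  fixes f :: "'a::euclidean_space \<Rightarrow> ennreal"
  assumes [measurable]: "f \<in> borel_measurable borel" and "s > 0"
  shows "(\<integral>\<^sup>+y. f y \<partial>lborel) = (\<integral>\<^sup>+x. ennreal (s ^ DIM('a)) * f (p + s *\<^sub>R (x - p)) \<partial>lborel)"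
proof -
  have "p + s *\<^sub>R (x - p) = (p - s *\<^sub>R p) + s *\<^sub>R x" for x
    by (simp add: algebra_simps)
  note eq = this
  show ?thesis
    unfolding eq using assms(2)
    by (subst lborel_affine[of s "p - s *\<^sub>R p"]) (simp_all add: nn_integral_density nn_integral_distr)
qed

lemma nn_integral_inverse_power:
  assumes "n \<ge> 1" "M > 0"
  shows "(\<integral>\<^sup>+s. ennreal (inverse s ^ Suc n) * indicator {M..} s \<partial>lborel) = ennreal (inverse (n * M ^ n))"
proof -
  have "(\<integral>\<^sup>+s. ennreal (inverse (max M s) ^ Suc n) * indicator {M..} s \<partial>lborel) = 0 - (- (inverse M ^ n / real n))"
  proof (rule nn_integral_FTC_atLeast)
    fix s assume s: "M \<le> s"
    obtain m where m: "n = Suc m" using assms(1) by (cases n) auto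
    have "((\<lambda>s. inverse s ^ n) has_real_derivative - (real n * inverse s ^ Suc n)) (at s)"
      using DERIV_power[OF DERIV_inverse[of s UNIV], of n] s assms(2)
      by (simp_all add: numeral_2_eq_2 algebra_simps m)
    from DERIV_cmult[OF this, of "- 1 / n"]
    show "((\<lambda>s. - (inverse s ^ n / real n)) has_real_derivative inverse (max M s) ^ Suc n) (at s)"
      using assms s by (simp add: max_def)
  next
    have "((\<lambda>s::real. inverse s ^ n) \<longlongrightarrow> 0 ^ n) at_top"
      by (intro tendsto_power tendsto_inverse_0_at_top filterlim_ident)
    then have "((\<lambda>s::real. inverse s ^ n) \<longlongrightarrow> 0) at_top"
      using assms by (simp add: power_0_left)
    from tendsto_mult_right[OF this, of "- 1 / n"]
    show "((\<lambda>s. - (inverse s ^ n / real n)) \<longlongrightarrow> 0) at_top" by simp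
  qed (use assms in auto)
  moreover have "(\<integral>\<^sup>+s. ennreal (inverse s ^ Suc n) * indicator {M..} s \<partial>lborel) =
      (\<integral>\<^sup>+s. ennreal (inverse (max M s) ^ Suc n) * indicator {M..} s \<partial>lborel)"
    by (intro nn_integral_cong) (auto simp: indicator_def max_def)
  ultimately show ?thesis
    using assms by (simp add: field_simps power_inverse)
qed

text \<open>After Fubini, substitute \<open>y = p + s *\<^sub>R (x - p)\<close> for fixed
  \<open>s\<close>: the Jacobian and \<open>norm (x - p) = norm (y - p) / s\<close> give
  \<open>s\<close> to the power \<open>-(N + 1)\<close>, and \<open>x\<close> lies in the ball iff
  \<open>s \<ge> norm (y - p) / r\<close>. The remaining integral over \<open>s\<close> is
  elementary. Being an identity, it serves both the lower and the upper bound for the capacity of a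
  ball.\<close>

lemma nn_integral_rays:
  fixes g :: "'a::euclidean_space \<Rightarrow> ennreal"
  assumes [measurable]: "g \<in> borel_measurable borel" and "r > 0"
  shows "(\<integral>\<^sup>+x\<in>cball p r. (\<integral>\<^sup>+s\<in>{1..}. g (p + s *\<^sub>R (x - p)) * ennreal (norm (x - p)) \<partial>lborel) \<partial>lborel) =
    (\<integral>\<^sup>+y. g y * ennreal (norm (y - p) / (DIM('a) * max 1 (norm (y - p) / r) ^ DIM('a))) \<partial>lborel)"
proof -
  let ?N = "DIM('a)"
  have N: "?N \<ge> 1" by (simp add: Suc_leI)
  have "(\<integral>\<^sup>+x\<in>cball p r. (\<integral>\<^sup>+s\<in>{1..}. g (p + s *\<^sub>R (x - p)) * ennreal (norm (x - p)) \<partial>lborel) \<partial>lborel) =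
    (\<integral>\<^sup>+x. (\<integral>\<^sup>+s. g (p + s *\<^sub>R (x - p)) * ennreal (norm (x - p)) * indicator {1..} s *
        indicator {x. norm (x - p) \<le> r} x \<partial>lborel) \<partial>lborel)"
    by (intro nn_integral_cong) (auto simp: indicator_def dist_norm norm_minus_commute)
  also have "\<dots> = (\<integral>\<^sup>+s. (\<integral>\<^sup>+x. g (p + s *\<^sub>R (x - p)) * ennreal (norm (x - p)) * indicator {1..} s *
        indicator {x. norm (x - p) \<le> r} x \<partial>lborel) \<partial>lborel)"
    by (rule lborel_pair.Fubini') measurable
  also have "\<dots> = (\<integral>\<^sup>+s. (\<integral>\<^sup>+y. g y * ennreal (norm (y - p) * inverse s ^ Suc ?N) * indicator {1..} s *
        indicator {y. norm (y - p) \<le> s * r} y \<partial>lborel) \<partial>lborel)"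
  proof (rule nn_integral_cong)
    fix s :: real
    show "(\<integral>\<^sup>+x. g (p + s *\<^sub>R (x - p)) * ennreal (norm (x - p)) * indicator {1..} s *
        indicator {x. norm (x - p) \<le> r} x \<partial>lborel) =
      (\<integral>\<^sup>+y. g y * ennreal (norm (y - p) * inverse s ^ Suc ?N) * indicator {1..} s *
        indicator {y. norm (y - p) \<le> s * r} y \<partial>lborel)"
    proof (cases "s \<ge> 1")
      case True
      then have "ennreal (norm (x - p)) = ennreal (s ^ ?N) * ennreal (s * norm (x - p) * inverse s ^ Suc ?N)" for x
        by (subst ennreal_mult[symmetric]) (auto simp: power_inverse field_simps)
      then show ?thesis
        using True
        by (subst (2) nn_integral_lborel_scale[of _ s p])
          (auto intro!: nn_integral_cong simp: indicator_def mult_ac)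
    qed simp
  qed
  also have "\<dots> = (\<integral>\<^sup>+y. (\<integral>\<^sup>+s. g y * ennreal (norm (y - p) * inverse s ^ Suc ?N) * indicator {1..} s *
        indicator {y. norm (y - p) \<le> s * r} y \<partial>lborel) \<partial>lborel)"
    by (rule lborel_pair.Fubini') (unfold indicator_def mem_Collect_eq, measurable)
  also have "\<dots> = (\<integral>\<^sup>+y. g y * ennreal (norm (y - p) / (?N * max 1 (norm (y - p) / r) ^ ?N)) \<partial>lborel)"
  proof (rule nn_integral_cong)
    fix y :: 'a
    let ?M = "max 1 (norm (y - p) / r)"
    have "(\<integral>\<^sup>+s. g y * ennreal (norm (y - p) * inverse s ^ Suc ?N) * indicator {1..} s *
        indicator {y. norm (y - p) \<le> s * r} y \<partial>lborel) =
      (\<integral>\<^sup>+s. (g y * ennreal (norm (y - p))) * (ennreal (inverse s ^ Suc ?N) * indicator {?M..} s) \<partial>lborel)"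
    proof (rule nn_integral_cong)
      fix s :: real
      have "s \<ge> ?M \<longleftrightarrow> s \<ge> 1 \<and> norm (y - p) \<le> s * r"
        using assms(2) by (simp add: field_simps)
      then show "g y * ennreal (norm (y - p) * inverse s ^ Suc ?N) * indicator {1..} s *
          indicator {y. norm (y - p) \<le> s * r} y =
        (g y * ennreal (norm (y - p))) * (ennreal (inverse s ^ Suc ?N) * indicator {?M..} s)"
        by (auto simp: indicator_def ennreal_mult mult.assoc simp del: power_Suc)
    qed
    also have "\<dots> = (g y * ennreal (norm (y - p))) * ennreal (inverse (?N * ?M ^ ?N))"
      using nn_integral_inverse_power[OF N, of ?M]
      by (subst nn_integral_cmult) (auto simp del: power_Suc)
    also have "\<dots> = g y * ennreal (norm (y - p) / (?N * ?M ^ ?N))"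
      by (simp add: mult.assoc ennreal_mult[symmetric] divide_inverse)
    finally show "(\<integral>\<^sup>+s. g y * ennreal (norm (y - p) * inverse s ^ Suc ?N) * indicator {1..} s *
        indicator {y. norm (y - p) \<le> s * r} y \<partial>lborel) = g y * ennreal (norm (y - p) / (?N * ?M ^ ?N))" .
  qed
  finally show ?thesis .
qed

lemma ray_has_derivative:
  assumes "smooth_on UNIV \<phi>"
  shows "((\<lambda>s. \<phi> (p + s *\<^sub>R v)) has_real_derivative (v \<bullet> grad \<phi> (p + s *\<^sub>R v))) (at s)"
proof -
  have "(\<phi> has_derivative (\<lambda>w. w \<bullet> grad \<phi> (p + s *\<^sub>R v))) (at (p + s *\<^sub>R v))"
    using assms by (auto intro!: has_derivative_grad smooth_on_differentiable)
  moreover have "((\<lambda>s. p + s *\<^sub>R v) has_derivative (\<lambda>t. t *\<^sub>R v)) (at s)"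
    by (auto intro!: derivative_eq_intros)
  ultimately have "((\<lambda>s. \<phi> (p + s *\<^sub>R v)) has_derivative (\<lambda>t. (t *\<^sub>R v) \<bullet> grad \<phi> (p + s *\<^sub>R v))) (at s)"
    by (rule has_derivative_compose[rotated])
  then show ?thesis
    by (rule has_derivative_imp_has_field_derivative) simp
qed

lemma diff_le_ray_integral:
  assumes "smooth_on UNIV \<phi>" "a \<le> b"
  shows "ennreal \<bar>\<phi> (p + b *\<^sub>R v) - \<phi> (p + a *\<^sub>R v)\<bar> \<le>
    (\<integral>\<^sup>+s\<in>{a..b}. ennreal (norm (grad \<phi> (p + s *\<^sub>R v)) * norm v) \<partial>lborel)"
proof -
  have "continuous_on {a..b} (\<lambda>s. grad \<phi> (p + s *\<^sub>R v))"
    by (rule continuous_on_compose2[OF continuous_on_grad[OF assms(1)]]) (auto intro!: continuous_intros)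
  then have "has_bochner_integral lborel (\<lambda>s. indicator {a..b} s *\<^sub>R (v \<bullet> grad \<phi> (p + s *\<^sub>R v)))
     (\<phi> (p + b *\<^sub>R v) - \<phi> (p + a *\<^sub>R v))"
    using ray_has_derivative[OF assms(1), THEN has_field_derivative_at_within] assms(2)
    by (intro has_bochner_integral_FTC_Icc)
      (simp_all add: has_real_derivative_iff_has_vector_derivative[symmetric] continuous_on_inner)
  then have "ennreal (norm (\<phi> (p + b *\<^sub>R v) - \<phi> (p + a *\<^sub>R v))) \<le>
      (\<integral>\<^sup>+s. norm (indicator {a..b} s *\<^sub>R (v \<bullet> grad \<phi> (p + s *\<^sub>R v))) \<partial>lborel)"
    by (rule has_bochner_integral_norm_bound)
  also have "\<dots> \<le> (\<integral>\<^sup>+s\<in>{a..b}. ennreal (norm (grad \<phi> (p + s *\<^sub>R v)) * norm v) \<partial>lborel)"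
    using Cauchy_Schwarz_ineq2[of v]
    unfolding mult.commute[of _ "norm v"]
    by (intro nn_integral_mono) (auto simp: indicator_def intro!: ennreal_leI)
  finally show ?thesis by simp
qed

lemma grad_measurable: "smooth_on UNIV \<phi> \<Longrightarrow> grad \<phi> \<in> borel_measurable borel"
  using continuous_on_grad by (rule borel_measurable_continuous_onI)

lemma grad_eq_0_outside_support:
  assumes "x \<notin> closure {x. \<phi> x \<noteq> 0}"
  shows "grad \<phi> x = 0"
proof -
  have "grad \<phi> x = grad (\<lambda>_. 0) x"
    using assms closure_subset[of "{x. \<phi> x \<noteq> 0}"]
    by (intro grad_cong[of "- closure {x. \<phi> x \<noteq> 0}"]) auto
  then show ?thesis by simp
qed

lemma nn_integral_grad_compact_support:
  assumes "\<phi> \<in> smooth_compact_support E"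
  shows "(\<integral>\<^sup>+x\<in>E. ennreal (norm (grad \<phi> x)) \<partial>lborel) = (\<integral>\<^sup>+x. ennreal (norm (grad \<phi> x)) \<partial>lborel)"
  using assms grad_eq_0_outside_support[of _ \<phi>]
  by (intro nn_integral_cong) (force simp: indicator_def smooth_compact_support_def)

text \<open>Integrating \<open>\<phi>\<close> over the ball along outgoing rays gives the gradient the weight
  \<open>\<bar>y - p\<bar> / (N max(1, \<bar>y - p\<bar>/r)\<^sup>N)\<close>, whose maximum \<open>r/N\<close> is attained on the sphere. So the constant is
  sharp: it yields the exact capacity of the ball.\<close>

lemma nn_integral_ball_le_grad:
  fixes \<phi> :: "'a::euclidean_space \<Rightarrow> real"
  assumes "smooth_on UNIV \<phi>" "compact (closure {x. \<phi> x \<noteq> 0})" "r > 0"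
  shows "(\<integral>\<^sup>+x\<in>cball p r. ennreal \<bar>\<phi> x\<bar> \<partial>lborel) \<le>
    ennreal (r / DIM('a)) * (\<integral>\<^sup>+x. ennreal (norm (grad \<phi> x)) \<partial>lborel)"
proof -
  note [measurable] = grad_measurable[OF assms(1)]
  let ?N = "DIM('a)"
  obtain B where B: "B > 0" "\<And>x. \<phi> x \<noteq> 0 \<Longrightarrow> norm (x - p) \<le> B"
  proof -
    have "bounded {x. \<phi> x \<noteq> 0}"
      by (rule bounded_subset[OF compact_imp_bounded[OF assms(2)] closure_subset])
    then have "bounded ((\<lambda>x. x - p) ` {x. \<phi> x \<noteq> 0})"
      by (rule bounded_translation_minus)
    then obtain B where "B > 0" "\<forall>y\<in>(\<lambda>x. x - p) ` {x. \<phi> x \<noteq> 0}. norm y \<le> B"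
      unfolding bounded_pos by blast
    then show ?thesis
      by (intro that[of B]) auto
  qed
  have ray: "ennreal \<bar>\<phi> x\<bar> \<le>
      (\<integral>\<^sup>+s\<in>{1..}. ennreal (norm (grad \<phi> (p + s *\<^sub>R (x - p)))) * ennreal (norm (x - p)) \<partial>lborel)"
    if "x \<noteq> p" for x
  proof -
    \<comment> \<open>At this parameter the ray has left the support of \<phi>; the factor 2 makes
      that strict, and \<open>max 1\<close> keeps \<open>{1..S}\<close> nonempty.\<close>
    define S where "S = max 1 (2 * B / norm (x - p))"
    have "B < S * norm (x - p)"
      using that B(1) by (auto simp: S_def max_def field_simps)
    then have "\<phi> (p + S *\<^sub>R (x - p)) = 0"
      using B(2)[of "p + S *\<^sub>R (x - p)"] by (fastforce simp: S_def)
    then have "ennreal \<bar>\<phi> x\<bar> \<le>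
        (\<integral>\<^sup>+s\<in>{1..S}. ennreal (norm (grad \<phi> (p + s *\<^sub>R (x - p))) * norm (x - p)) \<partial>lborel)"
      using diff_le_ray_integral[OF assms(1), of 1 S p "x - p"] by (simp add: S_def)
    also have "\<dots> \<le>
      (\<integral>\<^sup>+s\<in>{1..}. ennreal (norm (grad \<phi> (p + s *\<^sub>R (x - p)))) * ennreal (norm (x - p)) \<partial>lborel)"
      by (intro nn_integral_mono) (auto simp: indicator_def ennreal_mult)
    finally show ?thesis .
  qed
  have "(\<integral>\<^sup>+x\<in>cball p r. ennreal \<bar>\<phi> x\<bar> \<partial>lborel) \<le>
    (\<integral>\<^sup>+x\<in>cball p r. (\<integral>\<^sup>+s\<in>{1..}. ennreal (norm (grad \<phi> (p + s *\<^sub>R (x - p)))) *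
       ennreal (norm (x - p)) \<partial>lborel) \<partial>lborel)"
    \<comment> \<open>The centre itself has no outgoing ray, but it is a null set.\<close>
    by (intro nn_integral_mono_AE eventually_mono[OF AE_lborel_singleton[of p]] mult_right_mono ray) auto
  also have "\<dots> = (\<integral>\<^sup>+y. ennreal (norm (grad \<phi> y)) *
      ennreal (norm (y - p) / (?N * max 1 (norm (y - p) / r) ^ ?N)) \<partial>lborel)"
    using assms(3) by (subst nn_integral_rays) auto
  also have "\<dots> \<le> (\<integral>\<^sup>+y. ennreal (r / ?N) * ennreal (norm (grad \<phi> y)) \<partial>lborel)"
  proof (intro nn_integral_mono)
    fix y
    let ?M = "max 1 (norm (y - p) / r)"
    have "norm (y - p) \<le> r * ?M"
      using assms(3) by (auto simp: max_def field_simps)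
    also have "\<dots> \<le> r * ?M ^ ?N"
      using assms(3) by (intro mult_left_mono self_le_power) auto
    finally have "norm (y - p) / (?N * ?M ^ ?N) \<le> r / ?N"
      by (simp add: field_simps)
    then show "ennreal (norm (grad \<phi> y)) * ennreal (norm (y - p) / (?N * ?M ^ ?N)) \<le>
        ennreal (r / ?N) * ennreal (norm (grad \<phi> y))"
      by (subst mult.commute) (intro mult_right_mono ennreal_leI, auto)
  qed
  also have "\<dots> = ennreal (r / ?N) * (\<integral>\<^sup>+x. ennreal (norm (grad \<phi> x)) \<partial>lborel)"
    by (rule nn_integral_cmult) measurable
  finally show ?thesis .
qed

text \<open>A competitor is at least 1 on the ball, so the ray inequality bounds the volume by
  \<open>r / N\<close> times its energy.\<close>

lemma cap1_cball_ge:
  fixes p :: "'a::euclidean_space"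
  assumes "r > 0"
  shows "ennreal (DIM('a) * unit_ball_vol DIM('a) * r ^ (DIM('a) - 1)) \<le> cap1 (cball p r) (ball p (2 * r))"
  unfolding cap1_def
proof (rule INF_greatest)
  let ?N = "DIM('a)"
  fix \<phi> assume \<phi>: "\<phi> \<in> {\<phi> \<in> smooth_compact_support (ball p (2 * r)). \<forall>x\<in>cball p r. 1 \<le> \<phi> x}"
  let ?I = "\<integral>\<^sup>+x. ennreal (norm (grad \<phi> x)) \<partial>lborel"
  have N: "?N > 0" by simp
  have "ennreal (unit_ball_vol ?N * r ^ ?N) = (\<integral>\<^sup>+x. indicator (cball p r) x \<partial>lborel)"
    using assms by (simp add: emeasure_cball)
  also have "\<dots> \<le> (\<integral>\<^sup>+x\<in>cball p r. ennreal \<bar>\<phi> x\<bar> \<partial>lborel)"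
  proof (rule nn_integral_mono)
    fix x
    have "ennreal 1 \<le> ennreal \<bar>\<phi> x\<bar>" if "x \<in> cball p r"
      using \<phi> that by (intro ennreal_leI) force
    then show "indicator (cball p r) x \<le> ennreal \<bar>\<phi> x\<bar> * indicator (cball p r) x"
      by (simp add: indicator_def)
  qed
  also have "\<dots> \<le> ennreal (r / ?N) * ?I"
    using \<phi> assms by (intro nn_integral_ball_le_grad) (auto simp: smooth_compact_support_def)
  finally have "ennreal (?N / r) * ennreal (unit_ball_vol ?N * r ^ ?N) \<le> ennreal (?N / r) * (ennreal (r / ?N) * ?I)"
    by (rule mult_left_mono) simp
  also have "\<dots> = ?I"
    using assms N by (simp add: mult.assoc[symmetric] ennreal_mult[symmetric])
  also have "ennreal (?N / r) * ennreal (unit_ball_vol ?N * r ^ ?N) = ennreal (?N * unit_ball_vol ?N * r ^ (?N - 1))"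
    using assms N by (subst ennreal_mult[symmetric]) (auto simp: power_eq_if[of r ?N])
  also have "?I = (\<integral>\<^sup>+x\<in>ball p (2 * r). ennreal (norm (grad \<phi> x)) \<partial>lborel)"
    using \<phi> by (subst nn_integral_grad_compact_support) auto
  finally show "ennreal (?N * unit_ball_vol ?N * r ^ (?N - 1)) \<le> \<dots>" .
qed

text \<open>The competitor drops radially from 1 to 0 in the shell between radii \<open>r\<close>
  and \<open>(1 + e) * r\<close>. Along each ray its gradient norm integrates to
  \<open>\<eta> x \<le> 1\<close>, so \<open>nn_integral_rays\<close> bounds the weighted energy by
  the volume of the ball. On the shell the weight is at least \<open>r / (N * (1 + e) ^ N)\<close>;
  removing it costs the factor \<open>(1 + e) ^ N\<close>.\<close>

lemma cap1_cball_le: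
  fixes p :: "'a::euclidean_space"
  assumes "r > 0" "0 < e" "e < 1"
  shows "cap1 (cball p r) (ball p (2 * r)) \<le>
    ennreal ((1 + e) ^ DIM('a) * (DIM('a) * unit_ball_vol DIM('a) * r ^ (DIM('a) - 1)))"
proof -
  let ?N = "DIM('a)"
  have N: "?N > 0" by simp
  obtain C where "\<And>(p::'a) r. r > 0 \<Longrightarrow>
    \<exists>\<eta>. smooth_on UNIV \<eta> \<and> (\<forall>x. 0 \<le> \<eta> x \<and> \<eta> x \<le> 1) \<and>
      (\<forall>x\<in>cball p (1 * r). \<eta> x = 1) \<and> (\<forall>x. x \<notin> ball p ((1 + e) * r) \<longrightarrow> \<eta> x = 0) \<and>
      (\<forall>x. norm (grad \<eta> x) \<le> C / r) \<and> (\<forall>x. x \<notin> ball p ((1 + e) * r) - cball p (1 * r) \<longrightarrow> grad \<eta> x = 0) \<and>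
      (\<forall>x. grad \<eta> x \<bullet> (x - p) = - norm (grad \<eta> x) * norm (x - p))"
    by (rule bump_exists[of 1 "1 + e"]) (use assms in auto)
  from this[OF assms(1), of p] obtain \<eta> where \<eta>: "smooth_on UNIV \<eta>" "\<And>x. 0 \<le> \<eta> x" "\<And>x. \<eta> x \<le> 1"
    "\<And>x. x \<in> cball p r \<Longrightarrow> \<eta> x = 1" "\<And>x. x \<notin> ball p ((1 + e) * r) \<Longrightarrow> \<eta> x = 0"
    "\<And>x. x \<notin> ball p ((1 + e) * r) - cball p r \<Longrightarrow> grad \<eta> x = 0"
    "\<And>x. grad \<eta> x \<bullet> (x - p) = - norm (grad \<eta> x) * norm (x - p)"
    by auto
  note [measurable] = grad_measurable[OF \<eta>(1)]
  let ?I = "\<integral>\<^sup>+x. ennreal (norm (grad \<eta> x)) \<partial>lborel"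
  have "{x. \<eta> x \<noteq> 0} \<subseteq> cball p ((1 + e) * r)"
    using \<eta>(5) ball_subset_cball by blast
  then have sub: "closure {x. \<eta> x \<noteq> 0} \<subseteq> cball p ((1 + e) * r)"
    by (rule closure_minimal) auto
  have lt: "(1 + e) * r < 2 * r"
    using assms by simp
  have "closure {x. \<eta> x \<noteq> 0} \<subseteq> ball p (2 * r)"
    using sub le_less_trans[OF _ lt] by (force simp: subset_iff)
  moreover have "compact (closure {x. \<eta> x \<noteq> 0})"
    using bounded_subset[OF bounded_cball sub] by (simp add: compact_eq_bounded_closed)
  ultimately have mem: "\<eta> \<in> {\<phi> \<in> smooth_compact_support (ball p (2 * r)). \<forall>x\<in>cball p r. 1 \<le> \<phi> x}"
    using \<eta>(1,4) by (auto simp: smooth_compact_support_def)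
  have ray: "(\<integral>\<^sup>+s\<in>{1..}. ennreal (norm (grad \<eta> (p + s *\<^sub>R (x - p)))) * ennreal (norm (x - p)) \<partial>lborel) \<le> 1" for x
  proof (cases "x = p")
    case False
    have "(\<integral>\<^sup>+s\<in>{1..}. ennreal (norm (grad \<eta> (p + s *\<^sub>R (x - p))) * norm (x - p)) \<partial>lborel) =
        0 - (- \<eta> (p + 1 *\<^sub>R (x - p)))"
    proof (rule nn_integral_FTC_atLeast)
      fix s :: real assume s: "1 \<le> s"
      \<comment> \<open>The radial identity concerns the vector from \<open>p\<close> to the point
        on the ray, which is \<open>s\<close> times \<open>x - p\<close>; the factor
        \<open>s\<close> is cancelled next.\<close>
      have "s * (grad \<eta> (p + s *\<^sub>R (x - p)) \<bullet> (x - p)) = s * (- norm (grad \<eta> (p + s *\<^sub>R (x - p))) * norm (x - p))"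
        using \<eta>(7)[of "p + s *\<^sub>R (x - p)"] s by (simp add: mult_ac)
      then have "grad \<eta> (p + s *\<^sub>R (x - p)) \<bullet> (x - p) = - norm (grad \<eta> (p + s *\<^sub>R (x - p))) * norm (x - p)"
        unfolding mult_cancel_left using s by linarith
      then have "- ((x - p) \<bullet> grad \<eta> (p + s *\<^sub>R (x - p))) = norm (grad \<eta> (p + s *\<^sub>R (x - p))) * norm (x - p)"
        by (simp add: inner_commute)
      with DERIV_minus[OF ray_has_derivative[OF \<eta>(1), of p "x - p" s]]
      show "((\<lambda>s. - \<eta> (p + s *\<^sub>R (x - p))) has_real_derivative
         norm (grad \<eta> (p + s *\<^sub>R (x - p))) * norm (x - p)) (at s)" by simp
    next
      have "\<eta> (p + s *\<^sub>R (x - p)) = 0" if "s \<ge> 2 * r / norm (x - p)" for s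
      proof (rule \<eta>(5))
        have "2 * r \<le> s * norm (x - p)" using that False by (simp add: field_simps)
        also have "\<dots> \<le> norm (s *\<^sub>R (x - p))" by (simp add: mult_right_mono)
        finally show "p + s *\<^sub>R (x - p) \<notin> ball p ((1 + e) * r)"
          using less_le_trans[OF lt] by (auto simp: dist_norm not_less intro: less_imp_le)
      qed
      then have "eventually (\<lambda>s. - \<eta> (p + s *\<^sub>R (x - p)) = 0) at_top"
        by (intro eventually_mono[OF eventually_ge_at_top]) auto
      then show "((\<lambda>s. - \<eta> (p + s *\<^sub>R (x - p))) \<longlongrightarrow> 0) at_top"
        by (rule tendsto_eventually)
    qed auto
    then show ?thesis
      using \<eta>(3)[of x] by (simp add: ennreal_mult)
  qed simp
  have "?I \<le> (\<integral>\<^sup>+y. ennreal ((1 + e) ^ ?N * ?N / r) * (ennreal (norm (grad \<eta> y)) *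
      ennreal (norm (y - p) / (?N * max 1 (norm (y - p) / r) ^ ?N))) \<partial>lborel)"
  proof (intro nn_integral_mono)
    fix y
    show "ennreal (norm (grad \<eta> y)) \<le> ennreal ((1 + e) ^ ?N * ?N / r) * (ennreal (norm (grad \<eta> y)) *
      ennreal (norm (y - p) / (?N * max 1 (norm (y - p) / r) ^ ?N)))"
    proof (cases "y \<in> ball p ((1 + e) * r) - cball p r")
      case True
      then have y: "r < norm (y - p)" "norm (y - p) < (1 + e) * r"
        by (auto simp: dist_norm norm_minus_commute)
      define t where "t = norm (y - p) / r"
      have t: "1 < t" "t < 1 + e" "norm (y - p) = t * r"
        using y assms by (auto simp: t_def field_simps)
      have "1 * 1 \<le> ((1 + e) / t) ^ ?N * t"
        using t by (intro mult_mono one_le_power) auto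
      also have "\<dots> = (1 + e) ^ ?N * ?N / r * (norm (y - p) / (?N * max 1 t ^ ?N))"
        using t assms N by (simp add: field_simps power_divide)
      finally have "1 \<le> (1 + e) ^ ?N * ?N / r * (norm (y - p) / (?N * max 1 (norm (y - p) / r) ^ ?N))"
        by (simp add: t_def)
      then have "norm (grad \<eta> y) * 1 \<le> norm (grad \<eta> y) *
          ((1 + e) ^ ?N * ?N / r * (norm (y - p) / (?N * max 1 (norm (y - p) / r) ^ ?N)))"
        by (intro mult_left_mono) auto
      then have "ennreal (norm (grad \<eta> y)) \<le> ennreal (norm (grad \<eta> y) *
          ((1 + e) ^ ?N * ?N / r * (norm (y - p) / (?N * max 1 (norm (y - p) / r) ^ ?N))))"
        by (intro ennreal_leI) simp
      also have "\<dots> = ennreal ((1 + e) ^ ?N * ?N / r) * (ennreal (norm (grad \<eta> y)) *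
          ennreal (norm (y - p) / (?N * max 1 (norm (y - p) / r) ^ ?N)))"
      proof -
        have "ennreal (a * (b * c)) = ennreal b * (ennreal a * ennreal c)" if "a \<ge> 0" "b \<ge> 0" for a b c
          using that by (simp add: ennreal_mult' mult.left_commute)
        note * = this
        show ?thesis by (rule *) (use assms in auto)
      qed
      finally show ?thesis .
    qed (use \<eta>(6) in simp)
  qed
  also have "\<dots> = ennreal ((1 + e) ^ ?N * ?N / r) * (\<integral>\<^sup>+y. ennreal (norm (grad \<eta> y)) *
      ennreal (norm (y - p) / (?N * max 1 (norm (y - p) / r) ^ ?N)) \<partial>lborel)"
    by (rule nn_integral_cmult) measurable
  also have "\<dots> = ennreal ((1 + e) ^ ?N * ?N / r) *
     (\<integral>\<^sup>+x\<in>cball p r. (\<integral>\<^sup>+s\<in>{1..}. ennreal (norm (grad \<eta> (p + s *\<^sub>R (x - p)))) * ennreal (norm (x - p)) \<partial>lborel) \<partial>lborel)"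
    using assms by (subst nn_integral_rays) auto
  also have "\<dots> \<le> ennreal ((1 + e) ^ ?N * ?N / r) * (\<integral>\<^sup>+x\<in>cball p r. 1 \<partial>lborel)"
    by (intro mult_left_mono nn_integral_mono mult_right_mono ray) auto
  also have "(\<integral>\<^sup>+x\<in>cball p r. 1 \<partial>lborel) = ennreal (unit_ball_vol ?N * r ^ ?N)"
    using assms by (simp add: emeasure_cball)
  also have "ennreal ((1 + e) ^ ?N * ?N / r) * ennreal (unit_ball_vol ?N * r ^ ?N) =
      ennreal ((1 + e) ^ ?N * (?N * unit_ball_vol ?N * r ^ (?N - 1)))"
    using assms N by (subst ennreal_mult[symmetric]) (auto simp: power_eq_if[of r ?N])
  finally have "?I \<le> \<dots>" .
  moreover have "cap1 (cball p r) (ball p (2 * r)) \<le> (\<integral>\<^sup>+x\<in>ball p (2 * r). ennreal (norm (grad \<eta> x)) \<partial>lborel)"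
    unfolding cap1_def by (rule INF_lower[OF mem])
  ultimately show ?thesis
    using mem nn_integral_grad_compact_support[of \<eta> "ball p (2 * r)"] by auto
qed

section \<open>The lower bound\<close>

text \<open>Compactness needs open sets, so each covering set is put into a ball about one of its
  points, of radius slightly above its diameter. The gauge uses half the diameter, hence the factor
  \<open>2 ^ k\<close>.\<close>

lemma hausdorff_measure_finite_ball_cover:
  fixes A :: "'a::euclidean_space set"
  assumes "compact A" "k \<ge> 1" "hausdorff_measure k A < ennreal K" "\<delta> > 0"
  obtains I :: "nat set" and p :: "nat \<Rightarrow> 'a" and d :: "nat \<Rightarrow> real"
  where "finite I" "\<And>i. i \<in> I \<Longrightarrow> 0 < d i" "\<And>i. i \<in> I \<Longrightarrow> d i \<le> \<delta>"
    "A \<subseteq> (\<Union>i\<in>I. ball (p i) (d i))" "(\<Sum>i\<in>I. d i ^ k) \<le> 2 ^ k / unit_ball_vol k * K"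
proof -
  let ?u = "unit_ball_vol (real k)"
  have u: "?u > 0" by simp
  \<comment> \<open>At scale \<open>\<delta> / 2\<close> a radius can exceed the diameter and still
    stay below \<delta>.\<close>
  have "hausdorff_content k (\<delta> / 2) A \<le> hausdorff_measure k A"
    unfolding hausdorff_measure_def by (rule SUP_upper) (use assms in auto)
  with assms(3) have "hausdorff_content k (\<delta> / 2) A < ennreal K" by (rule le_less_trans[rotated])
  then obtain C :: "nat \<Rightarrow> 'a set" where C: "A \<subseteq> (\<Union>i. C i)" "\<And>i. bounded (C i)" "\<And>i. diameter (C i) \<le> \<delta> / 2"
    "(\<Sum>i. hausdorff_gauge k (C i)) < ennreal K"
    unfolding hausdorff_content_def INF_less_iff by auto
  define S where "S = enn2real (\<Sum>i. hausdorff_gauge k (C i))"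
  have S: "(\<Sum>i. hausdorff_gauge k (C i)) = ennreal S" "0 \<le> S"
    using C(4) by (auto simp: S_def ennreal_enn2real_if top_unique)
  with C(4) have SK: "S < K" by (simp add: ennreal_less_iff)
  \<comment> \<open>The gap between the gauge sum \<open>S\<close> and \<open>K\<close> is what the
    enlargement may spend. It is distributed geometrically over the balls.\<close>
  define \<tau> where "\<tau> = 2 ^ k / ?u * (K - S)"
  have \<tau>: "\<tau> > 0" using SK u by (simp add: \<tau>_def)
  have "\<exists>d. diameter (C i) < d \<and> d < \<delta> \<and> d ^ k < diameter (C i) ^ k + \<tau> * (1 / 2) ^ Suc i" for i
  proof -
    have "((\<lambda>x. x ^ k) \<longlongrightarrow> diameter (C i) ^ k) (at_right (diameter (C i)))"
      by (intro tendsto_intros)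
    then have "eventually (\<lambda>x. x ^ k < diameter (C i) ^ k + \<tau> * (1 / 2) ^ Suc i) (at_right (diameter (C i)))"
      by (rule order_tendstoD(2)) (use \<tau> in simp)
    moreover have "eventually (\<lambda>x. x < \<delta>) (at_right (diameter (C i)))"
      by (rule order_tendstoD(2)[OF tendsto_ident_at]) (use C(3)[of i] assms(4) in linarith)
    moreover have "eventually (\<lambda>x. diameter (C i) < x) (at_right (diameter (C i)))"
      by (rule eventually_at_right_less)
    ultimately have "eventually (\<lambda>d. diameter (C i) < d \<and> d < \<delta> \<and>
        d ^ k < diameter (C i) ^ k + \<tau> * (1 / 2) ^ Suc i) (at_right (diameter (C i)))"
      by eventually_elim auto
    then show ?thesis
      using eventually_happens trivial_limit_at_right_real by blast
  qed
  then obtain d where d: "\<And>i. diameter (C i) < d i" "\<And>i. d i < \<delta>"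
    "\<And>i. d i ^ k < diameter (C i) ^ k + \<tau> * (1 / 2) ^ Suc i" by metis
  define p where "p i = (SOME x. x \<in> C i)" for i
  define J where "J = {i. C i \<noteq> {}}"
  have sub: "C i \<subseteq> ball (p i) (d i)" for i
  proof
    fix x assume x: "x \<in> C i"
    then have "p i \<in> C i" unfolding p_def by (rule someI)
    then have "dist (p i) x \<le> diameter (C i)"
      using x C(2) by (intro diameter_bounded_bound) auto
    then show "x \<in> ball (p i) (d i)" using d(1)[of i] by simp
  qed
  have "A \<subseteq> (\<Union>i\<in>J. ball (p i) (d i))"
    using C(1) sub unfolding J_def by fastforce
  then obtain I where I: "I \<subseteq> J" "finite I" "A \<subseteq> (\<Union>i\<in>I. ball (p i) (d i))"
    by (rule compactE_image[OF assms(1) open_ball])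
  have dpos: "0 < d i" for i
    using d(1)[of i] diameter_ge_0[OF C(2)[of i]] by linarith
  have "(\<Sum>i\<in>I. ennreal (?u * (diameter (C i) / 2) ^ k)) = (\<Sum>i\<in>I. hausdorff_gauge k (C i))"
    using I(1) by (intro sum.cong) (auto simp: hausdorff_gauge_def J_def)
  also have "\<dots> \<le> ennreal S"
    unfolding S(1)[symmetric] by (rule sum_le_suminf) (use I in auto)
  finally have "(\<Sum>i\<in>I. ?u * (diameter (C i) / 2) ^ k) \<le> S"
    using S(2) u diameter_ge_0[OF C(2)] by (simp add: sum_ennreal)
  then have "?u / 2 ^ k * (\<Sum>i\<in>I. diameter (C i) ^ k) \<le> S"
    by (simp add: sum_distrib_left power_divide)
  then have 1: "(\<Sum>i\<in>I. diameter (C i) ^ k) \<le> 2 ^ k / ?u * S"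
    using u by (simp add: field_simps)
  have "(\<Sum>i\<in>I. (1 / 2 :: real) ^ Suc i) \<le> (\<Sum>i. (1 / 2) ^ Suc i)"
    using I power_half_series by (intro sum_le_suminf) (auto simp: sums_iff)
  also have "\<dots> = 1" using power_half_series by (simp add: sums_iff)
  finally have 2: "(\<Sum>i\<in>I. \<tau> * (1 / 2) ^ Suc i) \<le> \<tau>"
    using \<tau> by (simp add: sum_distrib_left[symmetric] del: power_Suc)
  have "(\<Sum>i\<in>I. d i ^ k) \<le> (\<Sum>i\<in>I. diameter (C i) ^ k + \<tau> * (1 / 2) ^ Suc i)"
    using d(3) by (intro sum_mono less_imp_le) auto
  also have "\<dots> \<le> 2 ^ k / ?u * S + \<tau>"
    using 1 2 by (simp add: sum.distrib)
  also have "\<dots> = 2 ^ k / ?u * K"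
    unfolding \<tau>_def distrib_left[symmetric] by simp
  finally show ?thesis
    using I d(2) dpos by (intro that[of I d p]) (auto intro: less_imp_le)
qed

text \<open>In each term of the product rule the factors that are not differentiated lie between 0
  and 1.\<close>

lemma norm_grad_prod_le:
  assumes "finite I" "\<And>i. i \<in> I \<Longrightarrow> smooth_on UNIV (\<eta> i)" "\<And>i x. i \<in> I \<Longrightarrow> 0 \<le> \<eta> i x \<and> \<eta> i x \<le> 1"
  shows "norm (grad (\<lambda>x. \<Prod>i\<in>I. 1 - \<eta> i x) x) \<le> (\<Sum>i\<in>I. norm (grad (\<eta> i) x))"
  using assms
proof (induction I)
  case (insert j I)
  let ?P = "\<lambda>x. \<Prod>i\<in>I. 1 - \<eta> i x"
  have sj: "smooth_on UNIV (\<lambda>x. 1 - \<eta> j x)" "smooth_on UNIV (\<eta> j)"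
    using insert.prems by (auto intro!: smooth_on_diff smooth_on_const)
  have sP: "smooth_on UNIV ?P"
    using insert.prems by (intro smooth_on_prod smooth_on_diff smooth_on_const) auto
  have P: "0 \<le> ?P x" "?P x \<le> 1"
    using insert.prems by (auto intro!: prod_nonneg prod_le_1)
  have "grad (\<lambda>x. (1 - \<eta> j x) * ?P x) x = (1 - \<eta> j x) *\<^sub>R grad ?P x - ?P x *\<^sub>R grad (\<eta> j) x"
    using smooth_on_differentiable[OF sj(1)] smooth_on_differentiable[OF sj(2)] smooth_on_differentiable[OF sP]
    by (simp add: grad_mult grad_diff)
  also have "norm \<dots> \<le> norm ((1 - \<eta> j x) *\<^sub>R grad ?P x) + norm (?P x *\<^sub>R grad (\<eta> j) x)"
    by (rule norm_triangle_ineq4)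
  also have "\<dots> \<le> 1 * norm (grad ?P x) + 1 * norm (grad (\<eta> j) x)"
    using P insert.prems(2)[of j x] unfolding norm_scaleR by (intro add_mono mult_right_mono) auto
  finally show ?case
    using insert by fastforce
qed simp

text \<open>A finite cover of the boundary by small balls replaces mollification: multiplying the indicator of
  \<open>E\<close> by cutoffs that vanish on the balls makes it smooth, at the cost \<open>\<Sum> d\<^sub>i\<^sup>N\<^sup>-\<^sup>1\<close> in total variation.\<close>

lemma smooth_approx_indicator:
  assumes "DIM('a::euclidean_space) \<ge> 2"
  obtains C where "C > 0" "\<And>(E::'a set) K m. open E \<Longrightarrow> bounded E \<Longrightarrow>
    hausdorff_measure (DIM('a) - 1) (frontier E) < ennreal K \<Longrightarrow> m > 0 \<Longrightarrow>
    \<exists>w. smooth_on UNIV w \<and> (\<forall>x. 0 \<le> w x \<and> w x \<le> 1) \<and> (\<forall>x. x \<notin> E \<longrightarrow> w x = 0) \<and>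
      (\<integral>\<^sup>+x. ennreal (norm (grad w x)) \<partial>lborel) \<le> ennreal (C * K) \<and>
      emeasure lborel (E - {x. w x = 1}) \<le> ennreal m"
proof -
  let ?N = "DIM('a)" and ?k = "DIM('a) - 1"
  let ?\<omega> = "unit_ball_vol (real ?N)"
  define c where "c = 2 ^ ?k / unit_ball_vol (real ?k)"
  have c: "c > 0" by (simp add: c_def)
  obtain B where B: "B > 0" "\<And>(p::'a) r. r > 0 \<Longrightarrow>
    \<exists>\<eta>. smooth_on UNIV \<eta> \<and> (\<forall>x. 0 \<le> \<eta> x \<and> \<eta> x \<le> 1) \<and>
      (\<forall>x\<in>cball p (1 * r). \<eta> x = 1) \<and> (\<forall>x. x \<notin> ball p (2 * r) \<longrightarrow> \<eta> x = 0) \<and>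
      (\<forall>x. norm (grad \<eta> x) \<le> B / r) \<and> (\<forall>x. x \<notin> ball p (2 * r) - cball p (1 * r) \<longrightarrow> grad \<eta> x = 0) \<and>
      (\<forall>x. grad \<eta> x \<bullet> (x - p) = - norm (grad \<eta> x) * norm (x - p))"
    by (rule bump_exists[of 1 2]) auto
  show ?thesis
  \<comment> \<open>A ball of radius \<open>d\<close> contributes at most \<open>B / d\<close> times
    the volume of its double, that is \<open>B * ?\<omega> * 2 ^ ?N * d ^ ?k\<close>, and the sum of
    the \<open>d i ^ ?k\<close> is at most \<open>c * K\<close>.\<close>
  proof (rule that[of "B * ?\<omega> * 2 ^ ?N * c"])
    show "B * ?\<omega> * 2 ^ ?N * c > 0" using B c by simp
  next
    fix E :: "'a set" and K m :: real
    assume E: "open E" "bounded E" and H: "hausdorff_measure ?k (frontier E) < ennreal K" and m: "m > 0"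
    have K: "K > 0"
      using H by (metis ennreal_neg not_le not_less_zero order_less_imp_le)
    \<comment> \<open>Radii below \<delta> make the total volume of the doubled balls at most
      \<open>m\<close>: one factor of \<open>d i ^ ?N\<close> is bounded by \<delta>, the others by
      \<open>c * K\<close> after summation.\<close>
    define \<delta> where "\<delta> = m / (?\<omega> * 2 ^ ?N * (c * K))"
    have \<delta>: "\<delta> > 0" using m c K by (simp add: \<delta>_def)
    obtain I :: "nat set" and p d where I: "finite I" "\<And>i. i \<in> I \<Longrightarrow> 0 < d i" "\<And>i. i \<in> I \<Longrightarrow> d i \<le> \<delta>"
      "frontier E \<subseteq> (\<Union>i\<in>I. ball (p i) (d i))" "(\<Sum>i\<in>I. d i ^ ?k) \<le> c * K"
      using assms E H \<delta> unfolding c_def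
      by (elim hausdorff_measure_finite_ball_cover[rotated 2]) (auto simp: compact_frontier_bounded)
    have "\<forall>i\<in>I. \<exists>\<eta>. smooth_on UNIV \<eta> \<and> (\<forall>x. 0 \<le> \<eta> x \<and> \<eta> x \<le> 1) \<and>
      (\<forall>x\<in>cball (p i) (d i). \<eta> x = 1) \<and> (\<forall>x. x \<notin> ball (p i) (2 * d i) \<longrightarrow> \<eta> x = 0) \<and>
      (\<forall>x. norm (grad \<eta> x) \<le> B / d i) \<and> (\<forall>x. x \<notin> ball (p i) (2 * d i) \<longrightarrow> grad \<eta> x = 0)"
    proof
      fix i assume "i \<in> I"
      from B(2)[OF I(2)[OF this], of "p i"] show "\<exists>\<eta>. smooth_on UNIV \<eta> \<and> (\<forall>x. 0 \<le> \<eta> x \<and> \<eta> x \<le> 1) \<and>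
      (\<forall>x\<in>cball (p i) (d i). \<eta> x = 1) \<and> (\<forall>x. x \<notin> ball (p i) (2 * d i) \<longrightarrow> \<eta> x = 0) \<and>
      (\<forall>x. norm (grad \<eta> x) \<le> B / d i) \<and> (\<forall>x. x \<notin> ball (p i) (2 * d i) \<longrightarrow> grad \<eta> x = 0)"
        by (elim exE) (rule exI, auto)
    qed
    from bchoice[OF this] obtain \<eta> where \<eta>: "\<And>i. i \<in> I \<Longrightarrow> smooth_on UNIV (\<eta> i)"
      "\<And>i x. i \<in> I \<Longrightarrow> 0 \<le> \<eta> i x \<and> \<eta> i x \<le> 1"
      "\<And>i x. i \<in> I \<Longrightarrow> x \<in> cball (p i) (d i) \<Longrightarrow> \<eta> i x = 1"
      "\<And>i x. i \<in> I \<Longrightarrow> x \<notin> ball (p i) (2 * d i) \<Longrightarrow> \<eta> i x = 0"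
      "\<And>i x. i \<in> I \<Longrightarrow> norm (grad (\<eta> i) x) \<le> B / d i"
      "\<And>i x. i \<in> I \<Longrightarrow> x \<notin> ball (p i) (2 * d i) \<Longrightarrow> grad (\<eta> i) x = 0" by blast
    define P where "P x = (\<Prod>i\<in>I. 1 - \<eta> i x)" for x
    define w where "w x = (if x \<in> E then P x else 0)" for x
    \<comment> \<open>Smoothness of \<open>w\<close> is glued from two open sets: it equals
      \<open>P\<close> on \<open>E\<close> and 0 on \<open>V\<close>. They cover the space because
      the balls cover the frontier.\<close>
    define V where "V = (\<Union>i\<in>I. ball (p i) (d i)) \<union> - closure E"
    have sP: "smooth_on UNIV P"
      unfolding P_def[abs_def] using \<eta>(1) by (intro smooth_on_prod smooth_on_diff smooth_on_const) auto
    have P0: "P x = 0" if "x \<in> ball (p i) (d i)" "i \<in> I" for x i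
      unfolding P_def using that \<eta>(3)[of i x] I(1) by (intro prod_zero) auto
    have P01: "0 \<le> P x" "P x \<le> 1" for x
      unfolding P_def using \<eta>(2) by (auto intro!: prod_nonneg prod_le_1)
    have oV: "open V" unfolding V_def by (intro open_Un open_UN) auto
    have wV: "w x = 0" if "x \<in> V" for x
      using that P0 closure_subset[of E] unfolding V_def w_def by auto
    have EV: "E \<union> V = UNIV"
      using I(4) interior_open[OF E(1)] unfolding V_def frontier_def by auto
    have sw: "smooth_on UNIV w"
    proof -
      have "smooth_on E w"
        by (rule smooth_on_cong[OF E(1) _ smooth_on_subset[OF sP]]) (auto simp: w_def)
      moreover have "smooth_on V w"
        by (rule smooth_on_cong[OF oV _ smooth_on_const[of _ 0]]) (auto simp: wV)
      ultimately have "smooth_on (\<Union>{E, V}) w"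
        using E oV by (intro smooth_on_Union) auto
      then show ?thesis using EV by simp
    qed
    have gw: "norm (grad w x) \<le> (\<Sum>i\<in>I. norm (grad (\<eta> i) x))" for x
    proof (cases "x \<in> E")
      case True
      then have "grad w x = grad P x"
        by (intro grad_cong[OF E(1)]) (auto simp: w_def)
      then show ?thesis
        unfolding P_def[abs_def] using norm_grad_prod_le[OF I(1) \<eta>(1,2)] by simp
    next
      case False
      then have "grad w x = grad (\<lambda>_. 0) x"
        using EV by (intro grad_cong[OF oV]) (auto simp: wV)
      then show ?thesis by (simp add: sum_nonneg)
    qed
    have pw: "d i ^ ?N = d i * d i ^ ?k" for i
      by (simp add: power_eq_if)
    have "(\<integral>\<^sup>+x. ennreal (norm (grad w x)) \<partial>lborel) \<le>
        (\<integral>\<^sup>+x. (\<Sum>i\<in>I. ennreal (B / d i) * indicator (ball (p i) (2 * d i)) x) \<partial>lborel)"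
    proof (rule nn_integral_mono)
      fix x
      have "ennreal (norm (grad w x)) \<le> ennreal (\<Sum>i\<in>I. norm (grad (\<eta> i) x))"
        by (intro ennreal_leI gw)
      also have "\<dots> = (\<Sum>i\<in>I. ennreal (norm (grad (\<eta> i) x)))"
        by (simp add: sum_ennreal)
      also have "\<dots> \<le> (\<Sum>i\<in>I. ennreal (B / d i) * indicator (ball (p i) (2 * d i)) x)"
        using \<eta>(5,6) by (intro sum_mono) (auto simp: indicator_def intro!: ennreal_leI)
      finally show "ennreal (norm (grad w x)) \<le> \<dots>" .
    qed
    also have "\<dots> = (\<Sum>i\<in>I. ennreal (B / d i) * emeasure lborel (ball (p i) (2 * d i)))"
      by (subst nn_integral_sum)
        (auto simp: nn_integral_cmult_indicator intro!: borel_measurable_times_ennreal borel_measurable_indicator)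
    also have "\<dots> = (\<Sum>i\<in>I. ennreal (B * ?\<omega> * 2 ^ ?N * d i ^ ?k))"
    proof (rule sum.cong)
      fix i assume i: "i \<in> I"
      then show "ennreal (B / d i) * emeasure lborel (ball (p i) (2 * d i)) = ennreal (B * ?\<omega> * 2 ^ ?N * d i ^ ?k)"
        using I(2)[OF i] B(1) by (simp add: emeasure_ball ennreal_mult[symmetric] power_mult_distrib pw)
    qed simp
    also have "\<dots> = ennreal (B * ?\<omega> * 2 ^ ?N * (\<Sum>i\<in>I. d i ^ ?k))"
      using I(2) B(1) by (subst sum_ennreal) (auto simp: sum_distrib_left less_imp_le)
    also have "\<dots> \<le> ennreal (B * ?\<omega> * 2 ^ ?N * (c * K))"
      using I(5) B(1) by (intro ennreal_leI mult_left_mono) auto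
    finally have int: "(\<integral>\<^sup>+x. ennreal (norm (grad w x)) \<partial>lborel) \<le> ennreal (B * ?\<omega> * 2 ^ ?N * c * K)"
      by (simp add: mult.assoc)
    have "E - {x. w x = 1} \<subseteq> (\<Union>i\<in>I. ball (p i) (2 * d i))"
    proof (rule subsetI, rule ccontr)
      fix x assume x: "x \<in> E - {x. w x = 1}" "x \<notin> (\<Union>i\<in>I. ball (p i) (2 * d i))"
      then have "P x = 1"
        unfolding P_def using \<eta>(4) by (intro prod.neutral) auto
      with x(1) show False by (auto simp: w_def)
    qed
    then have "emeasure lborel (E - {x. w x = 1}) \<le> emeasure lborel (\<Union>i\<in>I. ball (p i) (2 * d i))"
      by (rule emeasure_mono) auto
    also have "\<dots> \<le> (\<Sum>i\<in>I. emeasure lborel (ball (p i) (2 * d i)))"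
      using I(1) by (intro emeasure_subadditive_finite) auto
    also have "\<dots> \<le> (\<Sum>i\<in>I. ennreal (?\<omega> * 2 ^ ?N * \<delta> * d i ^ ?k))"
    proof (rule sum_mono)
      fix i assume i: "i \<in> I"
      have "?\<omega> * (2 * d i) ^ ?N = ?\<omega> * 2 ^ ?N * d i ^ ?k * d i"
        by (simp add: power_mult_distrib pw)
      also have "\<dots> \<le> ?\<omega> * 2 ^ ?N * d i ^ ?k * \<delta>"
        using I(2,3)[OF i] by (intro mult_left_mono) auto
      finally show "emeasure lborel (ball (p i) (2 * d i)) \<le> ennreal (?\<omega> * 2 ^ ?N * \<delta> * d i ^ ?k)"
        using I(2)[OF i] by (simp add: emeasure_ball mult_ac ennreal_leI)
    qed
    also have "\<dots> = ennreal (?\<omega> * 2 ^ ?N * \<delta> * (\<Sum>i\<in>I. d i ^ ?k))"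
      using I(2) \<delta> by (subst sum_ennreal) (auto simp: sum_distrib_left less_imp_le)
    also have "\<dots> \<le> ennreal (?\<omega> * 2 ^ ?N * \<delta> * (c * K))"
      using I(5) \<delta> by (intro ennreal_leI mult_left_mono) auto
    also have "?\<omega> * 2 ^ ?N * \<delta> * (c * K) = m"
      using c K less_imp_neq[OF unit_ball_vol_pos[of "real ?N"]] by (simp add: \<delta>_def)
    finally have "emeasure lborel (E - {x. w x = 1}) \<le> ennreal m" .
    with sw int P01 show "\<exists>w. smooth_on UNIV w \<and> (\<forall>x. 0 \<le> w x \<and> w x \<le> 1) \<and> (\<forall>x. x \<notin> E \<longrightarrow> w x = 0) \<and>
      (\<integral>\<^sup>+x. ennreal (norm (grad w x)) \<partial>lborel) \<le> ennreal (B * ?\<omega> * 2 ^ ?N * c * K) \<and>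
      emeasure lborel (E - {x. w x = 1}) \<le> ennreal m"
      by (intro exI[of _ w]) (auto simp: w_def)
  qed
qed


section \<open>Averaging over ball centres\<close>

lemma nn_integral_lborel_translate:
  fixes f :: "'a::euclidean_space \<Rightarrow> ennreal"
  assumes [measurable]: "f \<in> borel_measurable borel"
  shows "(\<integral>\<^sup>+x. f (x + c) \<partial>lborel) = (\<integral>\<^sup>+x. f x \<partial>lborel)"
  by (subst (2) lborel_distr_plus[of c, symmetric]) (simp add: nn_integral_distr add.commute)

text \<open>Averaging over the centres \<open>x\<close> with \<open>w x = 1\<close>: there \<open>1 - w (x + z) = w x - w (x + z)\<close> is bounded
  by the gradient along the segment, so both terms average to a multiple of the total variation.\<close>

lemma good_ball_exists:
  fixes w :: "'a::euclidean_space \<Rightarrow> real"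
  assumes w: "smooth_on UNIV w" "\<And>x. 0 \<le> w x" "\<And>x. w x \<le> 1" and r: "r > 0"
    and M: "3 * emeasure lborel (ball (0::'a) (2 * r)) * (\<integral>\<^sup>+x. ennreal (norm (grad w x)) \<partial>lborel)
      < M * emeasure lborel {x. w x = 1}"
  shows "\<exists>p. (\<integral>\<^sup>+x\<in>ball p (2 * r). (ennreal (norm (grad w x)) + ennreal ((1 - w x) / r)) \<partial>lborel) \<le> M"
proof (rule ccontr)
  let ?g = "\<lambda>x. ennreal (norm (grad w x))" and ?F = "{x. w x = 1}" and ?B = "ball (0::'a) (2 * r)"
  note [measurable] = grad_measurable[OF w(1)]
  have wm[measurable]: "w \<in> borel_measurable borel"
    using smooth_on_continuous[OF w(1)] by (rule borel_measurable_continuous_onI)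
  have [measurable]: "ball p s \<in> sets borel" for p :: 'a and s by simp
  have Fm[measurable]: "?F \<in> sets borel" by measurable
  assume "\<not> ?thesis"
  then have less: "M \<le> (\<integral>\<^sup>+x\<in>ball p (2 * r). (?g x + ennreal ((1 - w x) / r)) \<partial>lborel)" for p
    by (meson less_imp_le not_le)
  have shift: "(\<integral>\<^sup>+x\<in>ball p (2 * r). (?g x + ennreal ((1 - w x) / r)) \<partial>lborel) =
      (\<integral>\<^sup>+z\<in>?B. (?g (z + p) + ennreal ((1 - w (z + p)) / r)) \<partial>lborel)" for p
  proof -
    have "(\<integral>\<^sup>+x\<in>ball p (2 * r). (?g x + ennreal ((1 - w x) / r)) \<partial>lborel) =
        (\<integral>\<^sup>+z. (?g (z + p) + ennreal ((1 - w (z + p)) / r)) * indicator (ball p (2 * r)) (z + p) \<partial>lborel)"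
      by (rule nn_integral_lborel_translate[symmetric]) measurable
    also have "\<dots> = (\<integral>\<^sup>+z\<in>?B. (?g (z + p) + ennreal ((1 - w (z + p)) / r)) \<partial>lborel)"
      by (intro nn_integral_cong) (auto simp: indicator_def dist_norm)
    finally show ?thesis .
  qed
  \<comment> \<open>The factor 2 is the bound for \<open>norm z / r\<close>.\<close>
  have seg: "ennreal ((1 - w (z + p)) / r) \<le> 2 * (\<integral>\<^sup>+s\<in>{0..1}. ?g (p + s *\<^sub>R z) \<partial>lborel)"
    if "w p = 1" "z \<in> ?B" for p z
  proof -
    have z: "norm z / r \<le> 2" using that(2) r by (simp add: field_simps)
    have "ennreal (1 - w (z + p)) \<le> (\<integral>\<^sup>+s\<in>{0..1}. ennreal (norm (grad w (p + s *\<^sub>R z)) * norm z) \<partial>lborel)"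
      using diff_le_ray_integral[OF w(1), of 0 1 p z] that(1) w(3)[of "z + p"] by (simp add: add.commute)
    also have "\<dots> = (\<integral>\<^sup>+s. ennreal (norm z) * (?g (p + s *\<^sub>R z) * indicator {0..1} s) \<partial>lborel)"
      by (intro nn_integral_cong) (auto simp: indicator_def ennreal_mult mult.commute)
    also have "\<dots> = ennreal (norm z) * (\<integral>\<^sup>+s\<in>{0..1}. ?g (p + s *\<^sub>R z) \<partial>lborel)"
      by (rule nn_integral_cmult) measurable
    finally have "ennreal (1 / r) * ennreal (1 - w (z + p)) \<le>
        ennreal (1 / r) * (ennreal (norm z) * (\<integral>\<^sup>+s\<in>{0..1}. ?g (p + s *\<^sub>R z) \<partial>lborel))"
      by (rule mult_left_mono) simp
    also have "\<dots> = ennreal (norm z / r) * (\<integral>\<^sup>+s\<in>{0..1}. ?g (p + s *\<^sub>R z) \<partial>lborel)"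
      using r by (simp add: mult.assoc[symmetric] ennreal_mult[symmetric])
    also have "\<dots> \<le> ennreal 2 * (\<integral>\<^sup>+s\<in>{0..1}. ?g (p + s *\<^sub>R z) \<partial>lborel)"
      by (intro mult_right_mono ennreal_leI z) simp
    also have "ennreal (1 / r) * ennreal (1 - w (z + p)) = ennreal ((1 - w (z + p)) / r)"
      using r w(3)[of "z + p"] by (simp add: ennreal_mult[symmetric])
    finally show ?thesis by simp
  qed
  have "M * emeasure lborel ?F = (\<integral>\<^sup>+p. M * indicator ?F p \<partial>lborel)"
    by (simp add: nn_integral_cmult_indicator)
  \<comment> \<open>\<open>seg\<close> holds for centres in \<open>?F\<close> only; once it has been
    applied, the integral is extended to all \<open>p\<close>, where translation invariance is
    available.\<close>
  also have "\<dots> \<le> (\<integral>\<^sup>+p. (\<integral>\<^sup>+z. (?g (z + p) + 2 * (\<integral>\<^sup>+s\<in>{0..1}. ?g (p + s *\<^sub>R z) \<partial>lborel)) * indicator ?B z \<partial>lborel) \<partial>lborel)"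
  proof (rule nn_integral_mono)
    fix p
    show "M * indicator ?F p \<le> (\<integral>\<^sup>+z. (?g (z + p) + 2 * (\<integral>\<^sup>+s\<in>{0..1}. ?g (p + s *\<^sub>R z) \<partial>lborel)) * indicator ?B z \<partial>lborel)"
    proof (cases "w p = 1")
      case True
      have "M \<le> (\<integral>\<^sup>+z\<in>?B. (?g (z + p) + ennreal ((1 - w (z + p)) / r)) \<partial>lborel)"
        using less[of p] unfolding shift .
      also have "\<dots> \<le> (\<integral>\<^sup>+z\<in>?B. (?g (z + p) + 2 * (\<integral>\<^sup>+s\<in>{0..1}. ?g (p + s *\<^sub>R z) \<partial>lborel)) \<partial>lborel)"
        using seg[OF True] by (intro nn_integral_mono) (auto simp: indicator_def intro!: add_left_mono)
      finally show ?thesis using True by simp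
    qed simp
  qed
  also have "\<dots> = (\<integral>\<^sup>+z. (\<integral>\<^sup>+p. (?g (z + p) + 2 * (\<integral>\<^sup>+s\<in>{0..1}. ?g (p + s *\<^sub>R z) \<partial>lborel)) * indicator ?B z \<partial>lborel) \<partial>lborel)"
    by (rule lborel_pair.Fubini') measurable
  \<comment> \<open>For each \<open>z\<close>, the gradient term gives the total variation once, and
    the segment term gives it twice, since every point of the segment is a translate of
    \<open>p\<close>.\<close>
  also have "\<dots> = (\<integral>\<^sup>+z. (3 * (\<integral>\<^sup>+x. ?g x \<partial>lborel)) * indicator ?B z \<partial>lborel)"
  proof (rule nn_integral_cong)
    fix z :: 'a
    have "(\<integral>\<^sup>+p. (\<integral>\<^sup>+s\<in>{0..1}. ?g (p + s *\<^sub>R z) \<partial>lborel) \<partial>lborel) =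
        (\<integral>\<^sup>+s. (\<integral>\<^sup>+p. ?g (p + s *\<^sub>R z) * indicator {0..1} s \<partial>lborel) \<partial>lborel)"
      by (rule lborel_pair.Fubini') measurable
    also have "\<dots> = (\<integral>\<^sup>+s. (\<integral>\<^sup>+x. ?g x \<partial>lborel) * indicator {0..1::real} s \<partial>lborel)"
    proof (rule nn_integral_cong)
      fix s :: real
      show "(\<integral>\<^sup>+p. ?g (p + s *\<^sub>R z) * indicator {0..1} s \<partial>lborel) = (\<integral>\<^sup>+x. ?g x \<partial>lborel) * indicator {0..1} s"
        by (subst nn_integral_multc) (simp_all add: nn_integral_lborel_translate[of ?g])
    qed
    also have "\<dots> = (\<integral>\<^sup>+x. ?g x \<partial>lborel)"
      by (simp add: nn_integral_cmult_indicator)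
    finally have seg_int: "(\<integral>\<^sup>+p. (\<integral>\<^sup>+s\<in>{0..1}. ?g (p + s *\<^sub>R z) \<partial>lborel) \<partial>lborel) = (\<integral>\<^sup>+x. ?g x \<partial>lborel)" .
    have "(\<integral>\<^sup>+p. (?g (z + p) + 2 * (\<integral>\<^sup>+s\<in>{0..1}. ?g (p + s *\<^sub>R z) \<partial>lborel)) * indicator ?B z \<partial>lborel) =
       ((\<integral>\<^sup>+p. ?g (z + p) \<partial>lborel) + 2 * (\<integral>\<^sup>+p. (\<integral>\<^sup>+s\<in>{0..1}. ?g (p + s *\<^sub>R z) \<partial>lborel) \<partial>lborel)) * indicator ?B z"
      by (subst nn_integral_multc, measurable, subst nn_integral_add, measurable, subst nn_integral_cmult, measurable)
    also have "(\<integral>\<^sup>+p. ?g (z + p) \<partial>lborel) = (\<integral>\<^sup>+x. ?g x \<partial>lborel)"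
      by (subst add.commute) (rule nn_integral_lborel_translate, measurable)
    also have "(\<integral>\<^sup>+x. ?g x \<partial>lborel) + 2 * (\<integral>\<^sup>+p. (\<integral>\<^sup>+s\<in>{0..1}. ?g (p + s *\<^sub>R z) \<partial>lborel) \<partial>lborel) = 3 * (\<integral>\<^sup>+x. ?g x \<partial>lborel)"
      unfolding seg_int using distrib_right[of 1 2 "\<integral>\<^sup>+x. ?g x \<partial>lborel"] by simp
    finally show "(\<integral>\<^sup>+p. (?g (z + p) + 2 * (\<integral>\<^sup>+s\<in>{0..1}. ?g (p + s *\<^sub>R z) \<partial>lborel)) * indicator ?B z \<partial>lborel) =
      (3 * (\<integral>\<^sup>+x. ?g x \<partial>lborel)) * indicator ?B z" .
  qed
  also have "\<dots> = 3 * emeasure lborel ?B * (\<integral>\<^sup>+x. ?g x \<partial>lborel)"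
    by (subst nn_integral_cmult_indicator) (auto simp: mult_ac)
  finally show False using M by simp
qed

text \<open>A cutoff times \<open>1 - w\<close> is a competitor for the ball minus \<Omega>, because
  \<open>w\<close> vanishes outside \<open>E\<close> and hence outside \<Omega>. The integral in
  \<open>good_ball_exists\<close> controls its energy, which is compared with
  \<open>cap1_cball_ge\<close>. All estimates are linear in \<gamma>, so \<sigma> can be fixed
  before it.\<close>

lemma negligible1_if_small_perimeter:
  assumes N2: "DIM('a::euclidean_space) \<ge> 2"
  obtains \<sigma> :: real where "\<sigma> > 0"
    "\<And>\<gamma> (E::'a set) \<Omega> r. 0 < \<gamma> \<Longrightarrow> open E \<Longrightarrow> E \<noteq> {} \<Longrightarrow> bounded E \<Longrightarrow> E \<subseteq> \<Omega> \<Longrightarrow> open \<Omega> \<Longrightarrow> r > 0 \<Longrightarrow>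
      hausdorff_measure (DIM('a) - 1) (frontier E) < ennreal (\<sigma> * \<gamma> / r) * emeasure lborel E \<Longrightarrow>
      \<exists>p. negligible1 \<gamma> p r (cball p r - \<Omega>)"
proof -
  let ?N = "DIM('a)" and ?k = "DIM('a) - 1"
  let ?\<omega> = "unit_ball_vol (real ?N)"
  have N: "real ?N > 0" by simp
  obtain C where C: "C > 0" "\<And>(E::'a set) K m. open E \<Longrightarrow> bounded E \<Longrightarrow>
    hausdorff_measure (DIM('a) - 1) (frontier E) < ennreal K \<Longrightarrow> m > 0 \<Longrightarrow>
    \<exists>w. smooth_on UNIV w \<and> (\<forall>x. 0 \<le> w x \<and> w x \<le> 1) \<and> (\<forall>x. x \<notin> E \<longrightarrow> w x = 0) \<and>
      (\<integral>\<^sup>+x. ennreal (norm (grad w x)) \<partial>lborel) \<le> ennreal (C * K) \<and>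
      emeasure lborel (E - {x. w x = 1}) \<le> ennreal m"
    by (rule smooth_approx_indicator[OF N2]) (rule that, assumption+)
  obtain B0 where B0: "B0 > 0" "\<And>(p::'a) r. r > 0 \<Longrightarrow>
    \<exists>\<eta>. smooth_on UNIV \<eta> \<and> (\<forall>x. 0 \<le> \<eta> x \<and> \<eta> x \<le> 1) \<and>
      (\<forall>x\<in>cball p (1 * r). \<eta> x = 1) \<and> (\<forall>x. x \<notin> ball p (3 / 2 * r) \<longrightarrow> \<eta> x = 0) \<and>
      (\<forall>x. norm (grad \<eta> x) \<le> B0 / r) \<and> (\<forall>x. x \<notin> ball p (3 / 2 * r) - cball p (1 * r) \<longrightarrow> grad \<eta> x = 0) \<and>
      (\<forall>x. grad \<eta> x \<bullet> (x - p) = - norm (grad \<eta> x) * norm (x - p))"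
    by (rule bump_exists[of 1 "3 / 2"]) auto
  \<comment> \<open>One factor then serves both terms of the product rule: \<open>\<eta>\<close>
    times the gradient of \<open>w\<close>, and \<open>1 - w\<close> times the gradient of
    \<eta>.\<close>
  define B where "B = max 1 B0"
  have B: "B \<ge> 1" "B \<ge> B0" "B > 0" by (auto simp: B_def)
  \<comment> \<open>Calibrated so that the left side of the hypothesis of
    \<open>good_ball_exists\<close> is at most \<open>M * (e / 4)\<close>, strictly below
    \<open>M * (e / 2)\<close>.\<close>
  define \<sigma> where "\<sigma> = ?N / (12 * 2 ^ ?N * C * B)"
  show ?thesis
  proof (rule that[of \<sigma>])
    show "\<sigma> > 0" using C(1) B N by (simp add: \<sigma>_def)
    fix \<gamma> r :: real and E \<Omega> :: "'a set"
    assume \<gamma>: "0 < \<gamma>" and E: "open E" "E \<noteq> {}" "bounded E" "E \<subseteq> \<Omega>" and \<Omega>: "open \<Omega>" and r: "r > 0"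
      and H: "hausdorff_measure ?k (frontier E) < ennreal (\<sigma> * \<gamma> / r) * emeasure lborel E"
    define e where "e = measure lborel E"
    have "emeasure lborel E < \<infinity>" using E(3) by (rule emeasure_bounded_finite)
    then have e: "emeasure lborel E = ennreal e" "e \<ge> 0"
      unfolding e_def by (auto simp: emeasure_eq_ennreal_measure less_top)
    have epos: "e > 0"
      using H e by (cases "e = 0") auto
    define K where "K = \<sigma> * \<gamma> / r * e"
    have K: "K > 0" using \<open>\<sigma> > 0\<close> \<gamma> r epos by (simp add: K_def)
    have "hausdorff_measure ?k (frontier E) < ennreal K"
      using H e K \<open>\<sigma> > 0\<close> \<gamma> r unfolding K_def by (subst ennreal_mult) auto
    \<comment> \<open>With error \<open>e / 2\<close>, at least half of \<open>E\<close> remains as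
      admissible centres with \<open>w x = 1\<close>.\<close>
    from C(2)[OF E(1,3) this, of "e / 2"] epos obtain w where w: "smooth_on UNIV w"
      "\<And>x. 0 \<le> w x" "\<And>x. w x \<le> 1" "\<And>x. x \<notin> E \<Longrightarrow> w x = 0"
      "(\<integral>\<^sup>+x. ennreal (norm (grad w x)) \<partial>lborel) \<le> ennreal (C * K)"
      "emeasure lborel (E - {x. w x = 1}) \<le> ennreal (e / 2)" by auto
    note [measurable] = grad_measurable[OF w(1)]
    have wm[measurable]: "w \<in> borel_measurable borel"
      using smooth_on_continuous[OF w(1)] by (rule borel_measurable_continuous_onI)
    have [measurable]: "ball p s \<in> sets borel" for p :: 'a and s by simp
    have F: "ennreal (e / 2) \<le> emeasure lborel {x. w x = 1}"
    proof -
      have [measurable]: "E \<in> sets borel" using E(1) by simp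
      have "ennreal e \<le> emeasure lborel ({x. w x = 1} \<union> (E - {x. w x = 1}))"
        unfolding e(1)[symmetric] by (intro emeasure_mono) auto
      also have "\<dots> \<le> emeasure lborel {x. w x = 1} + emeasure lborel (E - {x. w x = 1})"
        by (intro emeasure_subadditive) auto
      also have "\<dots> \<le> emeasure lborel {x. w x = 1} + ennreal (e / 2)"
        by (intro add_left_mono w)
      finally have "ennreal (e / 2) + ennreal (e / 2) \<le> ennreal (e / 2) + emeasure lborel {x. w x = 1}"
        using e(2) by (simp add: ennreal_plus[symmetric] add.commute del: ennreal_plus)
      then show ?thesis by (subst (asm) ennreal_add_left_cancel_le) auto
    qed
    \<comment> \<open>\<open>B * M\<close> is \<gamma> times the lower bound for the capacity of the
      ball.\<close>
    define M where "M = \<gamma> * (?N * ?\<omega> * r ^ ?k) / B"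
    have M: "M > 0" using \<gamma> N r B by (simp add: M_def)
    have rk: "r ^ ?N = r * r ^ ?k" by (simp add: power_eq_if)
    have "3 * (?\<omega> * (2 * r) ^ ?N) * (C * K) = M * (e / 4)"
      using r B C N by (simp add: K_def M_def \<sigma>_def power_mult_distrib rk field_simps)
    also have "\<dots> < M * (e / 2)"
      using M epos by simp
    finally have *: "3 * (?\<omega> * (2 * r) ^ ?N) * (C * K) < M * (e / 2)" .
    have "3 * emeasure lborel (ball (0::'a) (2 * r)) * (\<integral>\<^sup>+x. ennreal (norm (grad w x)) \<partial>lborel) \<le>
      3 * ennreal (?\<omega> * (2 * r) ^ ?N) * ennreal (C * K)"
      using w(5) r by (intro mult_mono) (auto simp: emeasure_ball)
    also have "\<dots> = ennreal (3 * (?\<omega> * (2 * r) ^ ?N) * (C * K))"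
      using C(1) K r by (simp add: ennreal_mult)
    also have "\<dots> < ennreal (M * (e / 2))"
      using * M epos by (intro ennreal_lessI) auto
    also have "\<dots> = ennreal M * ennreal (e / 2)"
      using M epos by (intro ennreal_mult) auto
    also have "\<dots> \<le> ennreal M * emeasure lborel {x. w x = 1}"
      by (intro mult_left_mono F) simp
    finally obtain p where p: "(\<integral>\<^sup>+x\<in>ball p (2 * r). (ennreal (norm (grad w x)) + ennreal ((1 - w x) / r)) \<partial>lborel) \<le> ennreal M"
      using good_ball_exists[OF w(1-3) r] by blast
    from B0(2)[OF r, of p] obtain \<eta> where \<eta>: "smooth_on UNIV \<eta>" "\<And>x. 0 \<le> \<eta> x" "\<And>x. \<eta> x \<le> 1"
      "\<And>x. x \<in> cball p r \<Longrightarrow> \<eta> x = 1" "\<And>x. x \<notin> ball p (3 / 2 * r) \<Longrightarrow> \<eta> x = 0"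
      "\<And>x. norm (grad \<eta> x) \<le> B0 / r" by (elim exE) auto
    define \<phi> where "\<phi> x = \<eta> x * (1 - w x)" for x
    have s1: "smooth_on UNIV (\<lambda>x. 1 - w x)" by (intro smooth_on_diff smooth_on_const w) simp
    then have s\<phi>: "smooth_on UNIV \<phi>" unfolding \<phi>_def[abs_def] by (intro smooth_on_mult \<eta>) auto
    have g\<phi>: "ennreal (norm (grad \<phi> x)) \<le> ennreal B * (ennreal (norm (grad w x)) + ennreal ((1 - w x) / r))" for x
    proof -
      have "grad \<phi> x = (1 - w x) *\<^sub>R grad \<eta> x - \<eta> x *\<^sub>R grad w x"
        unfolding \<phi>_def[abs_def]
        using smooth_on_differentiable[OF s1] smooth_on_differentiable[OF \<eta>(1)] smooth_on_differentiable[OF w(1)]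
        by (simp add: grad_mult grad_diff)
      then have "norm (grad \<phi> x) \<le> norm ((1 - w x) *\<^sub>R grad \<eta> x) + norm (\<eta> x *\<^sub>R grad w x)"
        using norm_triangle_ineq4 by metis
      also have "\<dots> \<le> (1 - w x) * (B / r) + B * norm (grad w x)"
        using \<eta>(2,3)[of x] \<eta>(6)[of x] w(3)[of x] B r divide_right_mono[OF B(2), of r]
        unfolding norm_scaleR by (intro add_mono mult_mono) auto
      also have "\<dots> = B * (norm (grad w x) + (1 - w x) / r)"
        using r by (simp add: field_simps)
      finally have "ennreal (norm (grad \<phi> x)) \<le> ennreal (B * (norm (grad w x) + (1 - w x) / r))"
        by (rule ennreal_leI)
      then show ?thesis
        using B r w(3)[of x] by (simp add: ennreal_mult' ennreal_plus)
    qed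
    have "{x. \<phi> x \<noteq> 0} \<subseteq> cball p (3 / 2 * r)"
      using \<eta>(5) by (auto simp: \<phi>_def not_less intro: less_imp_le) (meson less_imp_le not_le)
    then have sub: "closure {x. \<phi> x \<noteq> 0} \<subseteq> cball p (3 / 2 * r)"
      by (rule closure_minimal) simp
    have "compact (closure {x. \<phi> x \<noteq> 0})"
      using bounded_subset[OF bounded_cball sub] by (simp add: compact_eq_bounded_closed)
    moreover have "cball p (3 / 2 * r) \<subseteq> ball p (2 * r)"
      using r by auto
    moreover have w\<Omega>: "w x = 0" if "x \<notin> \<Omega>" for x
      using that E(4) w(4) by blast
    ultimately have mem: "\<phi> \<in> {\<phi> \<in> smooth_compact_support (ball p (2 * r)). \<forall>x\<in>cball p r - \<Omega>. 1 \<le> \<phi> x}"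
      using sub s\<phi> w\<Omega> \<eta>(4) by (auto simp: smooth_compact_support_def \<phi>_def)
    have "cap1 (cball p r - \<Omega>) (ball p (2 * r)) \<le> (\<integral>\<^sup>+x\<in>ball p (2 * r). ennreal (norm (grad \<phi> x)) \<partial>lborel)"
      unfolding cap1_def by (rule INF_lower[OF mem])
    also have "\<dots> \<le> (\<integral>\<^sup>+x. ennreal B * ((ennreal (norm (grad w x)) + ennreal ((1 - w x) / r)) * indicator (ball p (2 * r)) x) \<partial>lborel)"
      using g\<phi> by (intro nn_integral_mono) (auto simp: indicator_def)
    also have "\<dots> = ennreal B * (\<integral>\<^sup>+x\<in>ball p (2 * r). (ennreal (norm (grad w x)) + ennreal ((1 - w x) / r)) \<partial>lborel)"
      by (rule nn_integral_cmult) measurable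
    also have "\<dots> \<le> ennreal B * ennreal M"
      by (intro mult_left_mono p) simp
    also have "\<dots> = ennreal \<gamma> * ennreal (?N * ?\<omega> * r ^ ?k)"
      using B \<gamma> M r by (simp add: ennreal_mult[symmetric] M_def)
    also have "\<dots> \<le> ennreal \<gamma> * cap1 (cball p r) (ball p (2 * r))"
      by (intro mult_left_mono cap1_cball_ge r) simp
    finally show "\<exists>p. negligible1 \<gamma> p r (cball p r - \<Omega>)"
      unfolding negligible1_def using \<Omega> by (intro exI[of _ p]) (auto intro: compact_diff)
  qed
qed

section \<open>Level sets of smooth functions\<close>

lemma hausdorff_content_antimono:
  "\<delta> \<le> \<delta>' \<Longrightarrow> hausdorff_content k \<delta>' A \<le> hausdorff_content k \<delta> A"
  unfolding hausdorff_content_def by (rule INF_superset_mono) (auto intro: order_trans)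

lemma hausdorff_content_mono:
  "A \<subseteq> B \<Longrightarrow> hausdorff_content k \<delta> A \<le> hausdorff_content k \<delta> B"
  unfolding hausdorff_content_def by (rule INF_superset_mono) auto

lemma hausdorff_measure_mono: "A \<subseteq> B \<Longrightarrow> hausdorff_measure k A \<le> hausdorff_measure k B"
  unfolding hausdorff_measure_def by (intro SUP_mono) (auto intro: hausdorff_content_mono)

lemma grad_lipschitz_cball:
  assumes "smooth_on UNIV u" "\<And>y. y \<in> cball p s \<Longrightarrow> norm (grad u y) \<le> B" "x \<in> cball p s"
  shows "\<bar>u x - u p\<bar> \<le> B * s"
proof -
  have "s \<ge> 0" using assms(3) zero_le_dist[of p x] by (simp del: zero_le_dist)
  have "B \<ge> 0" by (rule order_trans[OF norm_ge_zero assms(2)[OF assms(3)]])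
  have "norm (u x - u p) \<le> B * norm (x - p)"
  proof (rule differentiable_bound[OF convex_cball[of p s]])
    fix y assume y: "y \<in> cball p s"
    show "(u has_derivative (\<lambda>v. v \<bullet> grad u y)) (at y within cball p s)"
      using smooth_on_differentiable[OF assms(1), of y] by (simp add: has_derivative_at_withinI has_derivative_grad)
    have "norm (v \<bullet> grad u y) \<le> B * norm v" for v
      using Cauchy_Schwarz_ineq2[of v "grad u y"] mult_left_mono[OF assms(2)[OF y] norm_ge_zero[of v]]
      by (simp add: mult.commute)
    then show "onorm (\<lambda>v. v \<bullet> grad u y) \<le> B" by (rule onorm_le)
  qed (use assms(3) \<open>s \<ge> 0\<close> in auto)
  also have "\<dots> \<le> B * s"
    using assms(3) \<open>B \<ge> 0\<close> by (intro mult_left_mono) (auto simp: dist_norm norm_minus_commute)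
  finally show ?thesis by simp
qed

lemma hausdorff_content_finite_cballs:
  assumes "finite P" "A \<subseteq> (\<Union>p\<in>P. cball p s)" "0 \<le> s" "2 * s \<le> \<delta>"
  shows "hausdorff_content k \<delta> (A :: 'a::euclidean_space set) \<le> of_nat (card P) * ennreal (unit_ball_vol k * s ^ k)"
proof -
  obtain e where e: "bij_betw e {0..<card P} P"
    using ex_bij_betw_nat_finite[OF assms(1)] by blast
  \<comment> \<open>The finite cover is padded to a sequence by empty sets, whose gauge is 0 even
    for \<open>k = 0\<close>.\<close>
  define C where "C i = (if i < card P then cball (e i) s else {})" for i
  have "A \<subseteq> (\<Union>i. C i)"
  proof
    fix x assume "x \<in> A"
    then obtain p where p: "p \<in> P" "x \<in> cball p s" using assms(2) by blast
    then obtain i where "i < card P" "e i = p"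
      using e by (metis atLeastLessThan_iff bij_betw_imp_surj_on imageE)
    then show "x \<in> (\<Union>i. C i)" using p(2) by (auto simp: C_def)
  qed
  moreover have "bounded (C i) \<and> diameter (C i) \<le> \<delta>" for i
    using assms(3,4) by (simp add: C_def)
  ultimately have "hausdorff_content k \<delta> A \<le> (\<Sum>i. hausdorff_gauge k (C i))"
    unfolding hausdorff_content_def by (intro INF_lower) auto
  also have "\<dots> = (\<Sum>i\<in>{0..<card P}. hausdorff_gauge k (C i))"
    by (rule suminf_finite) (auto simp: C_def hausdorff_gauge_def)
  also have "\<dots> = (\<Sum>i\<in>{0..<card P}. ennreal (unit_ball_vol k * s ^ k))"
    using assms(3) by (intro sum.cong) (auto simp: C_def hausdorff_gauge_def)
  finally show ?thesis by simp
qed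

text \<open>Eilenberg's inequality at one scale: Vitali's lemma gives disjoint balls of radius \<open>d\<close> whose fivefold
  enlargements cover; a level set only needs the balls whose image under \<open>u\<close> contains the level.\<close>

lemma level_set_content_at_scale:
  fixes u :: "'a::euclidean_space \<Rightarrow> real"
  defines "k \<equiv> DIM('a) - 1"
  assumes u: "smooth_on UNIV u" and "\<epsilon> > 0" "\<delta> > 0"
  obtains f :: "real \<Rightarrow> ennreal" where "f \<in> borel_measurable borel"
    "\<And>t. hausdorff_content k \<delta> {x \<in> cball 0 R. u x = t} \<le> f t"
    "(\<integral>\<^sup>+t. f t \<partial>lborel) \<le> ennreal (10 * 5 ^ k * unit_ball_vol k / unit_ball_vol DIM('a)) *
      (\<integral>\<^sup>+x\<in>cball 0 (R + 1). ennreal (norm (grad u x) + 2 * \<epsilon>) \<partial>lborel)"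
proof -
  let ?N = "DIM('a)"
  let ?\<omega> = "unit_ball_vol (real ?N)" and ?g = "\<lambda>x. norm (grad u x)"
  define c where "c = 10 * 5 ^ k * unit_ball_vol (real k) / ?\<omega>"
  have Nk: "?N = Suc k" by (simp add: k_def)
  have \<omega>: "?\<omega> > 0" by simp
  have c: "c > 0" by (simp add: c_def)
  have gm[measurable]: "grad u \<in> borel_measurable borel" using u by (rule grad_measurable)
  let ?W = "cball (0::'a) R" and ?W1 = "cball (0::'a) (R + 1)"
  have "uniformly_continuous_on ?W1 ?g"
    using continuous_on_grad[OF u]
    by (intro compact_uniformly_continuous continuous_on_norm) (auto intro: continuous_on_subset)
  then obtain d0 where d0: "d0 > 0" "\<And>x y. x \<in> ?W1 \<Longrightarrow> y \<in> ?W1 \<Longrightarrow> dist y x < d0 \<Longrightarrow> \<bar>?g y - ?g x\<bar> < \<epsilon>"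
    using assms(3) unfolding uniformly_continuous_on_def dist_real_def by blast
  \<comment> \<open>The fivefold balls must stay within radius \<open>R + 1\<close>, have diameter
    at most \<delta>, and be so small that the gradient norm varies by at most \<epsilon> from its
    value at the centre.\<close>
  define d where "d = min (1 / 5) (min (d0 / 10) (\<delta> / 10))"
  have d: "d > 0" "5 * d \<le> 1" "5 * d < d0" "2 * (5 * d) \<le> \<delta>"
    using d0(1) assms(4) by (auto simp: d_def min_def)
  have "?W \<subseteq> (\<Union>p\<in>?W. ball p d)" using d(1) centre_in_ball by blast
  then obtain K where K: "K \<subseteq> ?W" "finite K" "?W \<subseteq> (\<Union>p\<in>K. ball p d)"
    by (rule compactE_image[OF compact_cball open_ball])
  have "(\<Union>p\<in>K. ball p d) \<subseteq> (\<Union>p\<in>K. cball p d)" by (intro UN_mono ball_subset_cball) simp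
  with K(3) have "?W \<subseteq> (\<Union>p\<in>K. cball p d)" by (rule order_trans)
  then obtain P where P: "P \<subseteq> K" "pairwise (\<lambda>i j. disjnt (cball i d) (cball j d)) P"
    "?W \<subseteq> (\<Union>p\<in>P. cball p (5 * d))"
    using d(1) by (elim Vitali_covering_lemma_cballs[where a="\<lambda>x. x" and r="\<lambda>_. d" and B=d]) auto
  have fP: "finite P" using P(1) K(2) finite_subset by blast
  have PW: "cball p (5 * d) \<subseteq> ?W1" if "p \<in> P" for p
  proof
    fix x assume "x \<in> cball p (5 * d)"
    then show "x \<in> ?W1"
      using that P(1) K(1) d(2) dist_triangle[of 0 x p] by force
  qed
  have osc: "\<bar>?g y - ?g p\<bar> \<le> \<epsilon>" if "p \<in> P" "y \<in> cball p (5 * d)" for p y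
  proof -
    have "p \<in> cball p (5 * d)" using d(1) by simp
    moreover have "dist y p < d0" using that(2) d(3) by (simp add: dist_commute)
    ultimately show ?thesis
      using d0(2)[of p y] PW[OF that(1)] that(2) by (intro less_imp_le) blast
  qed
  \<comment> \<open>By the mean value inequality \<open>u\<close> deviates from \<open>u p\<close>
    by at most \<open>h p\<close> on the fivefold ball.\<close>
  define h where "h p = 5 * d * (?g p + \<epsilon>)" for p
  have h: "h p \<ge> 0" for p using d(1) assms(3) by (simp add: h_def)
  define A where "A = unit_ball_vol (real k) * (5 * d) ^ k"
  have A: "A \<ge> 0" using d(1) by (simp add: A_def)
  \<comment> \<open>Each fivefold ball pays its gauge \<open>A\<close> at every level it can meet,
    so its share of the integral of \<open>f\<close> is \<open>A\<close> times the interval length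
    \<open>2 * h p\<close>.\<close>
  define f :: "real \<Rightarrow> ennreal" where "f t = (\<Sum>p\<in>P. ennreal A * indicator {u p - h p .. u p + h p} t)" for t
  show ?thesis
  proof (rule that[of f])
    show "f \<in> borel_measurable borel" unfolding f_def[abs_def] by measurable
    fix t
    let ?Q = "{p \<in> P. t \<in> {u p - h p .. u p + h p}}"
    have "{x \<in> ?W. u x = t} \<subseteq> (\<Union>p\<in>?Q. cball p (5 * d))"
    proof
      fix x assume x: "x \<in> {x \<in> ?W. u x = t}"
      then obtain p where p: "p \<in> P" "x \<in> cball p (5 * d)" using P(3) by blast
      have "\<bar>u x - u p\<bar> \<le> (?g p + \<epsilon>) * (5 * d)"
      proof (rule grad_lipschitz_cball[OF u _ p(2)])
        fix y assume "y \<in> cball p (5 * d)"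
        from osc[OF p(1) this] show "?g y \<le> ?g p + \<epsilon>" by linarith
      qed
      then have "\<bar>u x - u p\<bar> \<le> h p" by (simp add: h_def mult.commute)
      then have "t \<in> {u p - h p .. u p + h p}" using x by (simp add: abs_le_iff)
      with p show "x \<in> (\<Union>p\<in>?Q. cball p (5 * d))" by blast
    qed
    then have "hausdorff_content k \<delta> {x \<in> ?W. u x = t} \<le> of_nat (card ?Q) * ennreal A"
      unfolding A_def using fP d by (intro hausdorff_content_finite_cballs) auto
    also have "\<dots> = (\<Sum>p\<in>?Q. ennreal A)" by simp
    also have "\<dots> = f t"
      unfolding f_def sum.inter_filter[OF fP] by (intro sum.cong) (auto simp: indicator_def)
    finally show "hausdorff_content k \<delta> {x \<in> ?W. u x = t} \<le> f t" .
  next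
    let ?G = "\<lambda>x. ennreal (?g x + 2 * \<epsilon>)"
    let ?D = "density lborel ?G"
    have Gm[measurable]: "?G \<in> borel_measurable lborel" by measurable
    have D: "emeasure ?D (cball p s) = (\<integral>\<^sup>+x\<in>cball p s. ?G x \<partial>lborel)" for p s
      by (rule emeasure_density) auto
    have "(\<integral>\<^sup>+t. f t \<partial>lborel) = (\<Sum>p\<in>P. ennreal A * ennreal (2 * h p))"
      unfolding f_def using h by (subst nn_integral_sum)
        (auto simp: nn_integral_cmult_indicator intro!: borel_measurable_times_ennreal borel_measurable_indicator)
    also have "\<dots> \<le> (\<Sum>p\<in>P. ennreal c * emeasure ?D (cball p d))"
    proof (rule sum_mono)
      fix p assume p: "p \<in> P"
      have "ennreal A * ennreal (2 * h p) = ennreal (A * (2 * h p))"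
        using A h by (simp add: ennreal_mult)
      \<comment> \<open>The share becomes a multiple of the volume of the small ball of radius
        \<open>d\<close>. These balls are disjoint, so the sum is an integral. The second \<epsilon>
        in \<open>?G\<close> pays for replacing \<open>?g p\<close> by \<open>?g x\<close>.\<close>
      also have "A * (2 * h p) = c * ((?g p + \<epsilon>) * (?\<omega> * d ^ ?N))"
        using less_imp_neq[OF \<omega>] unfolding c_def A_def h_def Nk by (simp add: power_mult_distrib)
      also have "ennreal \<dots> = ennreal c * (ennreal (?g p + \<epsilon>) * emeasure lborel (cball p d))"
        using c d(1) assms(3) by (simp add: ennreal_mult emeasure_cball)
      also have "ennreal (?g p + \<epsilon>) * emeasure lborel (cball p d) = (\<integral>\<^sup>+x. ennreal (?g p + \<epsilon>) * indicator (cball p d) x \<partial>lborel)"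
        by (simp add: nn_integral_cmult_indicator)
      also have "\<dots> \<le> (\<integral>\<^sup>+x\<in>cball p d. ?G x \<partial>lborel)"
      proof (rule nn_integral_mono)
        fix x
        have "?g p + \<epsilon> \<le> ?g x + 2 * \<epsilon>" if "x \<in> cball p d"
          using osc[OF p, of x] that d(1) by (force simp: abs_le_iff)
        then show "ennreal (?g p + \<epsilon>) * indicator (cball p d) x \<le> ?G x * indicator (cball p d) x"
          by (auto simp: indicator_def intro: ennreal_leI)
      qed
      finally show "ennreal A * ennreal (2 * h p) \<le> ennreal c * emeasure ?D (cball p d)"
        unfolding D by (simp add: mult_left_mono)
    qed
    also have "\<dots> = ennreal c * (\<Sum>p\<in>P. emeasure ?D (cball p d))"
      by (simp add: sum_distrib_left)
    also have "(\<Sum>p\<in>P. emeasure ?D (cball p d)) = emeasure ?D (\<Union>p\<in>P. cball p d)"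
      using P(2) fP by (intro sum_emeasure) (auto simp: disjoint_family_on_def pairwise_def disjnt_def)
    also have "\<dots> \<le> emeasure ?D ?W1"
      using PW d(1) by (intro emeasure_mono) force+
    finally show "(\<integral>\<^sup>+t. f t \<partial>lborel) \<le> ennreal (10 * 5 ^ k * unit_ball_vol k / ?\<omega>) * (\<integral>\<^sup>+x\<in>?W1. ?G x \<partial>lborel)"
      unfolding D by (simp add: c_def mult_left_mono)
  qed
qed

text \<open>Fatou's lemma passes to scale 0 and gives Eilenberg's inequality with an upper estimate
  in place of the measure of a level set. Were all admissible levels to exceed \<open>M\<close>, the
  integral would be at least \<open>M * (b - a)\<close>. A finite set \<open>Z\<close> is null and
  can be avoided.\<close>

lemma level_set_of_small_measure:
  obtains c :: real where "c > 0"
    "\<And>(u::'a::euclidean_space \<Rightarrow> real) R a b Z M. smooth_on UNIV u \<Longrightarrow> a < b \<Longrightarrow> finite Z \<Longrightarrow> M \<ge> 0 \<Longrightarrow>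
      ennreal c * (\<integral>\<^sup>+x\<in>cball 0 (R + 1). ennreal (norm (grad u x)) \<partial>lborel) < ennreal (M * (b - a)) \<Longrightarrow>
      \<exists>t\<in>{a<..<b} - Z. hausdorff_measure (DIM('a) - 1) {x \<in> cball 0 R. u x = t} \<le> ennreal M"
proof (rule that[of "10 * 5 ^ (DIM('a) - 1) * unit_ball_vol (real (DIM('a) - 1)) / unit_ball_vol (real DIM('a))"])
  let ?k = "DIM('a) - 1"
  let ?c = "10 * 5 ^ ?k * unit_ball_vol (real ?k) / unit_ball_vol (real DIM('a))"
  show c: "?c > 0" by simp
  fix u :: "'a \<Rightarrow> real" and R a b M :: real and Z :: "real set"
  let ?W1 = "cball (0::'a) (R + 1)"
  let ?I = "\<integral>\<^sup>+x\<in>?W1. ennreal (norm (grad u x)) \<partial>lborel"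
  assume u: "smooth_on UNIV u" and ab: "a < b" "finite Z" "M \<ge> 0" and less: "ennreal ?c * ?I < ennreal (M * (b - a))"
  have gm[measurable]: "grad u \<in> borel_measurable borel" using u by (rule grad_measurable)
  have "\<forall>n. \<exists>f. f \<in> borel_measurable borel \<and>
    (\<forall>t. hausdorff_content ?k (inverse (real (Suc n))) {x \<in> cball 0 R. u x = t} \<le> f t) \<and>
    (\<integral>\<^sup>+t. f t \<partial>lborel) \<le> ennreal ?c * (\<integral>\<^sup>+x\<in>?W1. ennreal (norm (grad u x) + 2 * inverse (real (Suc n))) \<partial>lborel)"
  proof
    fix n
    have pos: "inverse (real (Suc n)) > 0" by simp
    show "\<exists>f. f \<in> borel_measurable borel \<and>
      (\<forall>t. hausdorff_content ?k (inverse (real (Suc n))) {x \<in> cball 0 R. u x = t} \<le> f t) \<and>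
      (\<integral>\<^sup>+t. f t \<partial>lborel) \<le> ennreal ?c * (\<integral>\<^sup>+x\<in>?W1. ennreal (norm (grad u x) + 2 * inverse (real (Suc n))) \<partial>lborel)"
      by (rule level_set_content_at_scale[OF u pos pos, of R]) blast
  qed
  from choice[OF this] obtain f where f: "\<And>n. f n \<in> borel_measurable borel"
    "\<And>n t. hausdorff_content ?k (inverse (real (Suc n))) {x \<in> cball 0 R. u x = t} \<le> f n t"
    "\<And>n. (\<integral>\<^sup>+t. f n t \<partial>lborel) \<le> ennreal ?c * (\<integral>\<^sup>+x\<in>?W1. ennreal (norm (grad u x) + 2 * inverse (real (Suc n))) \<partial>lborel)"
    by blast
  note f(1)[measurable]
  have [measurable]: "?W1 \<in> sets borel" by simp
  \<comment> \<open>A Borel majorant of the Hausdorff measure of the level sets; the integration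
    over levels is carried out on \<open>L\<close>.\<close>
  define L where "L t = liminf (\<lambda>n. f n t)" for t
  have Lm[measurable]: "L \<in> borel_measurable borel" unfolding L_def[abs_def] by measurable
  have "?I \<noteq> top"
  proof
    assume "?I = top"
    moreover have "ennreal x * top = top" if "x > 0" for x
      using that by (simp add: ennreal_mult_top)
    ultimately have "ennreal ?c * ?I = top" using c by (simp only:)
    with less show False by (simp only: ennreal_less_top not_less_iff_gr_or_eq) auto
  qed
  then obtain i where i: "?I = ennreal i" "i \<ge> 0" by (cases ?I) auto
  define v where "v = measure lborel ?W1"
  have v: "emeasure lborel ?W1 = ennreal v" "v \<ge> 0"
    using emeasure_lborel_cbox_finite emeasure_bounded_finite[of ?W1]
    by (auto simp: v_def emeasure_eq_ennreal_measure less_top)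
  have int: "(\<integral>\<^sup>+t. f n t \<partial>lborel) \<le> ennreal (?c * (i + 2 * inverse (real (Suc n)) * v))" for n
  proof -
    have "(\<integral>\<^sup>+x\<in>?W1. ennreal (norm (grad u x) + 2 * inverse (real (Suc n))) \<partial>lborel) =
      (\<integral>\<^sup>+x. ennreal (norm (grad u x)) * indicator ?W1 x + ennreal (2 * inverse (real (Suc n))) * indicator ?W1 x \<partial>lborel)"
      by (intro nn_integral_cong) (auto simp: indicator_def)
    also have "\<dots> = ?I + ennreal (2 * inverse (real (Suc n))) * emeasure lborel ?W1"
      by (subst nn_integral_add)
        (auto simp: nn_integral_cmult_indicator intro!: borel_measurable_times_ennreal borel_measurable_indicator)
    also have "\<dots> = ennreal (i + 2 * inverse (real (Suc n)) * v)"
      using i v by (simp add: ennreal_mult ennreal_plus)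
    finally show ?thesis
      using f(3)[of n] unfolding ennreal_mult'[OF less_imp_le[OF c]] by (simp only:)
  qed
  have "(\<lambda>n. inverse (real (Suc n))) \<longlonglongrightarrow> 0"
    by (rule LIMSEQ_inverse_real_of_nat)
  then have "(\<lambda>n. ennreal (?c * (i + 2 * inverse (real (Suc n)) * v))) \<longlonglongrightarrow> ennreal (?c * (i + 2 * 0 * v))"
    by (intro tendsto_ennrealI tendsto_intros)
  then have lim: "liminf (\<lambda>n. ennreal (?c * (i + 2 * inverse (real (Suc n)) * v))) = ennreal (?c * i)"
    by (intro lim_imp_Liminf) auto
  have "(\<integral>\<^sup>+t. L t \<partial>lborel) \<le> liminf (\<lambda>n. \<integral>\<^sup>+t. f n t \<partial>lborel)"
    unfolding L_def by (rule nn_integral_liminf) measurable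
  also have "\<dots> \<le> ennreal (?c * i)"
    unfolding lim[symmetric] by (rule Liminf_mono) (use int in auto)
  also have "\<dots> = ennreal ?c * ?I"
    unfolding i(1) by (rule ennreal_mult'[OF less_imp_le[OF c]])
  finally have L: "(\<integral>\<^sup>+t. L t \<partial>lborel) < ennreal (M * (b - a))" using less by (rule le_less_trans)
  have HL: "hausdorff_measure ?k {x \<in> cball 0 R. u x = t} \<le> L t" for t
    unfolding hausdorff_measure_def
  proof (rule SUP_least)
    fix \<delta> :: real assume "\<delta> \<in> {0<..}"
    then obtain n0 where n0: "inverse (real (Suc n0)) < \<delta>"
      using reals_Archimedean by auto
    have "hausdorff_content ?k \<delta> {x \<in> cball 0 R. u x = t} \<le> f n t" if "n \<ge> n0" for n
    proof -
      have le: "inverse (real (Suc n)) \<le> inverse (real (Suc n0))" using that by (simp add: field_simps)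
      have "hausdorff_content ?k \<delta> {x \<in> cball 0 R. u x = t} \<le>
          hausdorff_content ?k (inverse (real (Suc n))) {x \<in> cball 0 R. u x = t}"
        by (rule hausdorff_content_antimono[OF order_trans[OF le less_imp_le[OF n0]]])
      also note f(2)
      finally show ?thesis .
    qed
    then show "hausdorff_content ?k \<delta> {x \<in> cball 0 R. u x = t} \<le> L t"
      unfolding L_def by (intro Liminf_bounded) (auto simp: eventually_sequentially)
  qed
  show "\<exists>t\<in>{a<..<b} - Z. hausdorff_measure ?k {x \<in> cball 0 R. u x = t} \<le> ennreal M"
  proof (rule ccontr)
    assume "\<not> ?thesis"
    then have big: "ennreal M \<le> L t" if "t \<in> {a<..<b} - Z" for t
      using that HL[of t] by (meson less_imp_le not_le order_trans)
    have "Z \<in> null_sets lborel" using ab(2) by (rule finite_imp_null_set_lborel)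
    then have "emeasure lborel ({a<..<b} - Z) = ennreal (b - a)"
      using ab(1) by (subst emeasure_Diff_null_set) auto
    then have "ennreal (M * (b - a)) = ennreal M * emeasure lborel ({a<..<b} - Z)"
      using ab by (simp add: ennreal_mult)
    also have "\<dots> = (\<integral>\<^sup>+t. ennreal M * indicator ({a<..<b} - Z) t \<partial>lborel)"
      using \<open>Z \<in> null_sets lborel\<close> by (intro nn_integral_cmult_indicator[symmetric]) auto
    also have "\<dots> \<le> (\<integral>\<^sup>+t. L t \<partial>lborel)"
      using big by (intro nn_integral_mono) (auto simp: indicator_def)
    finally show False using L by simp
  qed
qed

section \<open>Regular values after a linear perturbation\<close>

text \<open>The library proves Sard's theorem only for index types of class \<^class>\<open>wellorder\<close>; this well-ordered
  copy of an arbitrary finite index type transports it.\<close>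

typedef ('n::finite) ordered_copy = "{..<CARD('n)}"
  by (rule exI[of _ 0]) (simp add: card_gt_0_iff)

instance ordered_copy :: (finite) finite
proof
  have "range (Rep_ordered_copy :: 'a ordered_copy \<Rightarrow> nat) \<subseteq> {..<CARD('a)}"
    using Rep_ordered_copy[where 'n='a] by blast
  then have "finite (range (Rep_ordered_copy :: 'a ordered_copy \<Rightarrow> nat))"
    using finite_subset by blast
  then show "finite (UNIV :: 'a ordered_copy set)"
    by (rule finite_imageD) (simp add: inj_def Rep_ordered_copy_inject)
qed

instantiation ordered_copy :: (finite) wellorder
begin

definition "x \<le> y \<longleftrightarrow> Rep_ordered_copy x \<le> Rep_ordered_copy y"
definition "x < y \<longleftrightarrow> Rep_ordered_copy x < Rep_ordered_copy y"

instance
proof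
  fix P :: "'a ordered_copy \<Rightarrow> bool" and a
  assume *: "\<And>x. (\<And>y. y < x \<Longrightarrow> P y) \<Longrightarrow> P x"
  show "P a"
    by (induction a rule: measure_induct_rule[of Rep_ordered_copy]) (auto intro: * simp: less_ordered_copy_def)
qed (auto simp: less_eq_ordered_copy_def less_ordered_copy_def Rep_ordered_copy_inject)

end

lemma card_ordered_copy: "CARD('n::finite ordered_copy) = CARD('n)"
  using type_definition.card[OF type_definition_ordered_copy] by simp

text \<open>Sard's theorem in equal dimensions. \<open>\<Phi>\<close> and \<open>\<Psi>\<close>
  merely relabel coordinates, so conjugating by them keeps track of non-injective derivatives, and
  the linear map \<open>\<Phi>\<close> sends negligible sets to negligible sets.\<close>

lemma negligible_critical_values:
  fixes G :: "real ^ 'n \<Rightarrow> real ^ 'n"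
  assumes G: "\<And>x. (G has_derivative G' x) (at x)"
  shows "negligible (G ` {x. \<not> inj (G' x)})"
proof -
  obtain e :: "'n ordered_copy \<Rightarrow> 'n" where e: "bij e"
    using finite_same_card_bij[of "UNIV :: 'n ordered_copy set" "UNIV :: 'n set"] card_ordered_copy[where 'n='n]
    by auto
  define \<Phi> :: "real ^ 'n ordered_copy \<Rightarrow> real ^ 'n" where "\<Phi> y = (\<chi> i. y $ inv e i)" for y
  define \<Psi> :: "real ^ 'n \<Rightarrow> real ^ 'n ordered_copy" where "\<Psi> x = (\<chi> j. x $ e j)" for x
  have inv: "\<Phi> (\<Psi> x) = x" "\<Psi> (\<Phi> y) = y" for x y
    using e by (auto simp: \<Phi>_def \<Psi>_def vec_eq_iff bij_is_surj surj_f_inv_f bij_is_inj inv_f_f)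
  have lin: "linear \<Phi>" "linear \<Psi>"
    by (auto simp: \<Phi>_def \<Psi>_def linear_iff vec_eq_iff)
  then have bl: "bounded_linear \<Phi>" "bounded_linear \<Psi>"
    by (auto simp: linear_conv_bounded_linear)
  define f where "f y = \<Psi> (G (\<Phi> y))" for y
  define f' where "f' y v = \<Psi> (G' (\<Phi> y) (\<Phi> v))" for y v
  have df: "(f has_derivative f' y) (at y)" for y
  proof -
    have "((\<lambda>y. G (\<Phi> y)) has_derivative (\<lambda>v. G' (\<Phi> y) (\<Phi> v))) (at y)"
      by (rule has_derivative_compose[OF bounded_linear_imp_has_derivative[OF bl(1)] G])
    then show ?thesis
      unfolding f_def[abs_def] f'_def[abs_def] by (rule bounded_linear.has_derivative[OF bl(2)])
  qed
  let ?S = "{y. \<not> inj (f' y)}"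
  have "negligible (f ` ?S)"
  proof (rule baby_Sard)
    fix y assume "y \<in> ?S"
    show "(f has_derivative f' y) (at y within ?S)"
      using df by (rule has_derivative_at_withinI)
    have "linear (f' y)" using df has_derivative_linear by blast
    then have "(*v) (matrix (f' y)) = f' y" by (auto simp: matrix_works)
    with \<open>y \<in> ?S\<close> show "rank (matrix (f' y)) < CARD('n ordered_copy)"
      by (simp add: less_rank_noninjective)
  qed simp
  then have "negligible (\<Phi> ` (f ` ?S))"
    by (rule negligible_differentiable_image_negligible[rotated])
      (use lin card_ordered_copy[where 'n='n] in \<open>auto simp: linear_imp_differentiable_on\<close>)
  moreover have "G ` {x. \<not> inj (G' x)} \<subseteq> \<Phi> ` (f ` ?S)"
  proof
    fix z assume "z \<in> G ` {x. \<not> inj (G' x)}"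
    then obtain x where x: "\<not> inj (G' x)" "z = G x" by auto
    have "inj (G' x)" if "inj (f' (\<Psi> x))"
    proof (rule injI)
      fix a b assume "G' x a = G' x b"
      then have "f' (\<Psi> x) (\<Psi> a) = f' (\<Psi> x) (\<Psi> b)" by (simp add: f'_def inv)
      with that have "\<Psi> a = \<Psi> b" by (simp add: inj_eq)
      then show "a = b" by (metis inv(1))
    qed
    moreover have "z = \<Phi> (f (\<Psi> x))" by (simp add: f_def inv x(2))
    ultimately show "z \<in> \<Phi> ` (f ` ?S)" using x(1) by blast
  qed
  ultimately show ?thesis by (rule negligible_subset)
qed

text \<open>An injective derivative is bounded below by \<open>B * norm v\<close>, while near a
  preimage the linearisation error is at most half of that; so preimages are isolated. Infinitely
  many of them in a compact set would accumulate at another preimage.\<close>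

lemma finite_preimage_regular_value:
  fixes G :: "'a::euclidean_space \<Rightarrow> 'a"
  assumes G: "\<And>x. (G has_derivative G' x) (at x)" and "compact W"
    and inj: "\<And>x. G x = c \<Longrightarrow> inj (G' x)"
  shows "finite {x \<in> W. G x = c}"
proof (rule ccontr)
  let ?T = "{x \<in> W. G x = c}"
  assume "infinite ?T"
  have "continuous_on UNIV G"
    by (intro continuous_at_imp_continuous_on ballI has_derivative_continuous[OF G])
  then have "closed {x. G x = c}"
    by (intro closed_Collect_eq continuous_on_const)
  then have "compact (W \<inter> {x. G x = c})" using assms(2) by (rule compact_Int_closed[rotated])
  moreover have "W \<inter> {x. G x = c} = ?T" by auto
  ultimately have "compact ?T" by simp
  with \<open>infinite ?T\<close> obtain x0 where x0: "x0 \<in> ?T" "x0 islimpt ?T"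
    unfolding compact_eq_Bolzano_Weierstrass by blast
  have lin: "linear (G' x0)" using G has_derivative_linear by blast
  from linear_inj_bounded_below_pos[OF lin inj] x0(1) obtain B where B: "B > 0" "\<And>v. B * norm v \<le> norm (G' x0 v)"
    by auto
  from G[of x0, unfolded has_derivative_at_alt] B(1) obtain d where d: "d > 0"
    "\<And>y. norm (y - x0) < d \<Longrightarrow> norm (G y - G x0 - G' x0 (y - x0)) \<le> B / 2 * norm (y - x0)"
    using half_gt_zero[OF B(1)] by blast
  from x0(2)[unfolded islimpt_approachable] d(1) obtain y where y: "y \<in> ?T" "y \<noteq> x0" "dist y x0 < d"
    by blast
  then have "norm (G' x0 (y - x0)) \<le> B / 2 * norm (y - x0)"
    using d(2)[of y] x0(1) by (simp add: dist_norm)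
  with B(2)[of "y - x0"] have "B * norm (y - x0) \<le> B / 2 * norm (y - x0)" by linarith
  with y(2) B(1) show False by simp
qed

section \<open>Perturbed critical points and superlevel sets with smooth boundary\<close>

lemma grad_has_derivative:
  assumes "smooth_on UNIV w"
  shows "(grad w has_derivative frechet_derivative (grad w) (at x)) (at x)"
proof -
  have "grad w differentiable (at x)"
    unfolding differentiable_componentwise_within[of "grad w" x UNIV]
    using smooth_on_differentiable[OF smooth_on_grad[OF assms]] by auto
  then show ?thesis by (simp add: frechet_derivative_works)
qed

text \<open>The critical points of \<open>w x + x \<bullet> a\<close> solve
  \<open>grad w x = - a\<close>. A ball is not negligible, so it contains a value \<open>- a\<close>
  that is not critical for the map \<open>grad w\<close>.\<close>

lemma finite_critical_points_perturbation:
  fixes w :: "real ^ 'n \<Rightarrow> real"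
  assumes w: "smooth_on UNIV w" and "e > 0" "compact W"
  obtains a where "norm a < e" "finite {x \<in> W. grad w x + a = 0}"
proof -
  let ?G' = "\<lambda>x. frechet_derivative (grad w) (at x)"
  note G = grad_has_derivative[OF w]
  have neg: "negligible (grad w ` {x. \<not> inj (?G' x)})" by (rule negligible_critical_values[OF G])
  have "\<not> ball 0 e \<subseteq> grad w ` {x. \<not> inj (?G' x)}"
  proof
    assume "ball 0 e \<subseteq> grad w ` {x. \<not> inj (?G' x)}"
    with neg have "negligible (ball (0::real ^ 'n) e)" by (rule negligible_subset)
    then show False using \<open>e > 0\<close> open_not_negligible[of "ball (0::real ^ 'n) e"] by simp
  qed
  then obtain b where "b \<in> ball 0 e" and b: "b \<notin> grad w ` {x. \<not> inj (?G' x)}" by blast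
  then have "norm b < e" by simp
  have "finite {x \<in> W. grad w x = b}"
    by (rule finite_preimage_regular_value[OF G assms(3)]) (use b in blast)
  moreover have "{x \<in> W. grad w x + - b = 0} = {x \<in> W. grad w x = b}" by auto
  ultimately show ?thesis using \<open>norm b < e\<close> by (intro that[of "- b"]) auto
qed

text \<open>Since the closure stays inside the open set \<open>B\<close>, the frontier of
  \<open>B\<close> contributes no boundary points, and \<open>t - u\<close> is a defining function
  away from the critical points.\<close>

lemma smooth_boundary_superlevel:
  assumes u: "smooth_on UNIV u" and B: "open B"
    and sub: "closure {x \<in> B. u x > t} \<subseteq> B" and reg: "\<And>x. x \<in> B \<Longrightarrow> u x = t \<Longrightarrow> grad u x \<noteq> 0"
  shows "open {x \<in> B. u x > t}" "frontier {x \<in> B. u x > t} \<subseteq> {x \<in> B. u x = t}"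
    "smooth_boundary {x \<in> B. u x > t}"
proof -
  let ?E = "{x \<in> B. u x > t}"
  have cont: "continuous_on UNIV u" using u by (rule smooth_on_continuous)
  have "open {x. t < u x}" using cont by (intro open_Collect_less continuous_on_const)
  moreover have "?E = B \<inter> {x. t < u x}" by auto
  ultimately show oE: "open ?E" using B by auto
  have "closed {x. t \<le> u x}" using cont by (intro closed_Collect_le continuous_on_const)
  then have clE: "closure ?E \<subseteq> {x. t \<le> u x}" by (rule closure_minimal[rotated]) auto
  show front: "frontier ?E \<subseteq> {x \<in> B. u x = t}"
  proof
    fix x assume "x \<in> frontier ?E"
    then have x: "x \<in> closure ?E" "x \<notin> ?E" using oE by (auto simp: frontier_def interior_open)
    then have "x \<in> B" "t \<le> u x" using sub clE by auto
    with x(2) show "x \<in> {x \<in> B. u x = t}" by auto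
  qed
  show "smooth_boundary ?E"
    unfolding smooth_boundary_def
  proof
    fix x assume x: "x \<in> frontier ?E"
    define U where "U = B \<inter> {y. grad u y \<noteq> 0}"
    define g where "g y = t - u y" for y
    have "open {y. grad u y \<noteq> 0}"
      using continuous_on_grad[OF u] by (intro open_Collect_neq continuous_on_const)
    then have oU: "open U" using B unfolding U_def by (rule open_Int[rotated])
    have xU: "x \<in> U" using front x reg unfolding U_def by auto
    have sg: "smooth_on U g"
      unfolding g_def[abs_def]
      by (rule smooth_on_subset[OF smooth_on_diff[OF open_UNIV smooth_on_const u]]) simp
    have gg: "grad g y = - grad u y" for y
      unfolding g_def[abs_def] using smooth_on_differentiable[OF u, of y] by (simp add: grad_diff)
    \<comment> \<open>This gives the other half of the frontier identity: a point of the level set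
      away from the closure would be a local maximum of \<open>u\<close>, hence critical.\<close>
    have in_closure: "y \<in> closure ?E" if "y \<in> U" "u y = t" for y
    proof (rule ccontr)
      assume "y \<notin> closure ?E"
      define V where "V = B \<inter> - closure ?E"
      have V: "open V" "y \<in> V" using B that(1) \<open>y \<notin> closure ?E\<close> by (auto simp: V_def U_def)
      have "u z \<le> u y" if "z \<in> V" for z
        using that closure_subset[of ?E] \<open>u y = t\<close> unfolding V_def by force
      then have "(\<lambda>v. v \<bullet> grad u y) = (\<lambda>v. 0)"
        using V has_derivative_grad[OF smooth_on_differentiable[OF u UNIV_I]]
        by (intro differential_zero_maxmin[of y V u]) auto
      then have "grad u y \<bullet> grad u y = 0" by meson
      with that(1) show False by (simp add: U_def)
    qed
    have "frontier ?E \<inter> U = {y \<in> U. g y = 0}"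
    proof
      show "frontier ?E \<inter> U \<subseteq> {y \<in> U. g y = 0}" using front by (auto simp: g_def)
      show "{y \<in> U. g y = 0} \<subseteq> frontier ?E \<inter> U"
        using in_closure oE by (auto simp: g_def frontier_def interior_open)
    qed
    moreover have "?E \<inter> U = {y \<in> U. g y < 0}" by (auto simp: g_def U_def)
    moreover have "\<forall>y\<in>U. grad g y \<noteq> 0" by (auto simp: gg U_def)
    ultimately show "\<exists>U g. open U \<and> x \<in> U \<and> smooth_on U g \<and> (\<forall>y\<in>U. grad g y \<noteq> 0) \<and>
        ?E \<inter> U = {y\<in>U. g y < 0} \<and> frontier ?E \<inter> U = {y\<in>U. g y = 0}"
      using oU xU sg by blast
  qed
qed

text \<open>The set is a superlevel set of a slightly tilted \<open>w\<close>, at a level that is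
  both regular and of small area. The strict bound by \<open>I\<close> leaves room for the gradient
  of the tilt.\<close>

lemma smooth_superlevel_set_exists:
  obtains c :: real where "c > 0"
    "\<And>(w::real ^ 'n \<Rightarrow> real) \<tau> I \<Omega>. smooth_on UNIV w \<Longrightarrow> \<tau> > 0 \<Longrightarrow>
      (\<integral>\<^sup>+x. ennreal (norm (grad w x)) \<partial>lborel) < ennreal I \<Longrightarrow>
      (\<And>s. s > 0 \<Longrightarrow> compact {x. s \<le> w x} \<and> {x. s \<le> w x} \<subseteq> \<Omega>) \<Longrightarrow>
      \<exists>E. open E \<and> smooth_boundary E \<and> compact (closure E) \<and> closure E \<subseteq> \<Omega> \<and> {x. \<tau> < w x} \<subseteq> E \<and>
        hausdorff_measure (CARD('n) - 1) (frontier E) \<le> ennreal (c * I / \<tau>)"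
proof -
  obtain c :: real where c: "c > 0"
    "\<And>(u::real ^ 'n \<Rightarrow> real) R a b Z M. smooth_on UNIV u \<Longrightarrow> a < b \<Longrightarrow> finite Z \<Longrightarrow> M \<ge> 0 \<Longrightarrow>
      ennreal c * (\<integral>\<^sup>+x\<in>cball 0 (R + 1). ennreal (norm (grad u x)) \<partial>lborel) < ennreal (M * (b - a)) \<Longrightarrow>
      \<exists>t\<in>{a<..<b} - Z. hausdorff_measure (DIM(real ^ 'n) - 1) {x \<in> cball 0 R. u x = t} \<le> ennreal M"
    by (rule level_set_of_small_measure) (rule that, assumption+)
  show ?thesis
  \<comment> \<open>The level is sought between \<open>\<tau> / 2\<close> and
    \<open>3 * \<tau> / 4\<close>, an interval of length \<open>\<tau> / 4\<close>; hence the factor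
    4.\<close>
  proof (rule that[of "4 * c"])
    show "4 * c > 0" using c(1) by simp
    fix w :: "real ^ 'n \<Rightarrow> real" and \<tau> I :: real and \<Omega>
    assume w: "smooth_on UNIV w" and \<tau>: "\<tau> > 0"
      and I: "(\<integral>\<^sup>+x. ennreal (norm (grad w x)) \<partial>lborel) < ennreal I"
      and lev: "\<And>s. s > 0 \<Longrightarrow> compact {x. s \<le> w x} \<and> {x. s \<le> w x} \<subseteq> \<Omega>"
    note [measurable] = grad_measurable[OF w]
    obtain i where i: "(\<integral>\<^sup>+x. ennreal (norm (grad w x)) \<partial>lborel) = ennreal i" "i \<ge> 0"
      using I by (cases "\<integral>\<^sup>+x. ennreal (norm (grad w x)) \<partial>lborel") auto
    have iI: "i < I" using I i by (simp add: ennreal_less_iff)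
    let ?K = "{x. \<tau> / 4 \<le> w x}"
    have K: "compact ?K" "?K \<subseteq> \<Omega>" using lev[of "\<tau> / 4"] \<tau> by auto
    from bounded_subset_ballD[OF compact_imp_bounded[OF K(1)], of 0]
    obtain R where R: "R > 0" "?K \<subseteq> ball 0 R" by auto
    let ?W1 = "cball (0::real ^ 'n) (R + 1)"
    define v where "v = measure lborel ?W1"
    have v: "emeasure lborel ?W1 = ennreal v" "v \<ge> 0"
      using emeasure_bounded_finite[of ?W1] by (auto simp: v_def emeasure_eq_ennreal_measure less_top)
    \<comment> \<open>The first bound keeps \<open>u\<close> within \<open>\<tau> / 8\<close> of
      \<open>w\<close> on the ball, the second keeps the gradient integral below \<open>I\<close>.
      The summand 1 guards against division by 0.\<close>
    define e where "e = min (\<tau> / (8 * R)) ((I - i) / (v + 1))"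
    have e: "e > 0" "e * R \<le> \<tau> / 8" "e * v < I - i"
    proof -
      show "e > 0" using \<tau> R iI v by (simp add: e_def)
      have "e * R \<le> \<tau> / (8 * R) * R" using R by (intro mult_right_mono) (auto simp: e_def)
      then show "e * R \<le> \<tau> / 8" using R by simp
      have "e * v < e * (v + 1)" using \<open>e > 0\<close> by simp
      also have "\<dots> \<le> (I - i) / (v + 1) * (v + 1)" using v by (intro mult_right_mono) (auto simp: e_def)
      also have "\<dots> = I - i" using v by simp
      finally show "e * v < I - i" .
    qed
    obtain a where a: "norm a < e" "finite {x \<in> cball 0 R. grad w x + a = 0}"
      by (rule finite_critical_points_perturbation[OF w e(1) compact_cball])
    define u where "u x = w x + x \<bullet> a" for x
    have slin: "smooth_on UNIV (\<lambda>x. x \<bullet> a)"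
      by (rule smooth_on_linear) (auto intro: bounded_linear_inner_left)
    have u: "smooth_on UNIV u"
      unfolding u_def[abs_def] by (rule smooth_on_add[OF open_UNIV w slin])
    have gu: "grad u x = grad w x + a" for x
      unfolding u_def[abs_def]
      using smooth_on_differentiable[OF w, of x] smooth_on_differentiable[OF slin, of x]
      by (simp add: grad_add grad_inner_right)
    have uw: "\<bar>u x - w x\<bar> \<le> \<tau> / 8" if "norm x \<le> R" for x
    proof -
      have "\<bar>x \<bullet> a\<bar> \<le> norm x * norm a" by (rule Cauchy_Schwarz_ineq2)
      also have "\<dots> \<le> R * e" using that a(1) R(1) by (intro mult_mono) auto
      finally show ?thesis using e(2) by (simp add: u_def mult.commute)
    qed
    have "(\<integral>\<^sup>+x\<in>?W1. ennreal (norm (grad u x)) \<partial>lborel) \<le>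
      (\<integral>\<^sup>+x. ennreal (norm (grad w x)) + ennreal e * indicator ?W1 x \<partial>lborel)"
    proof (rule nn_integral_mono)
      fix x
      have "norm (grad u x) \<le> norm (grad w x) + e"
        unfolding gu using norm_triangle_ineq[of "grad w x" a] a(1) by linarith
      then have "ennreal (norm (grad u x)) \<le> ennreal (norm (grad w x)) + ennreal e"
        using e(1) by (simp add: ennreal_plus[symmetric] ennreal_leI del: ennreal_plus)
      then show "ennreal (norm (grad u x)) * indicator ?W1 x \<le> ennreal (norm (grad w x)) + ennreal e * indicator ?W1 x"
        by (simp add: indicator_def)
    qed
    also have "\<dots> = ennreal i + ennreal e * emeasure lborel ?W1"
      unfolding i(1)[symmetric]
      by (subst nn_integral_add)
        (auto simp: nn_integral_cmult_indicator intro!: borel_measurable_times_ennreal borel_measurable_indicator)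
    also have "\<dots> = ennreal (i + e * v)"
      using i v e by (simp add: ennreal_mult ennreal_plus)
    also have "\<dots> < ennreal I"
      using e(3) iI i(2) by (intro ennreal_lessI) auto
    finally have *: "(\<integral>\<^sup>+x\<in>?W1. ennreal (norm (grad u x)) \<partial>lborel) < ennreal I" .
    define M where "M = 4 * c * I / \<tau>"
    have M: "M \<ge> 0" using c(1) iI i(2) \<tau> by (simp add: M_def)
    have "ennreal c * (\<integral>\<^sup>+x\<in>?W1. ennreal (norm (grad u x)) \<partial>lborel) < ennreal c * ennreal I"
      using * c(1) by (intro ennreal_mult_strict_left_mono) auto
    also have "\<dots> = ennreal (c * I)"
      using c(1) by (intro ennreal_mult'[symmetric]) simp
    also have "c * I = M * (3 * \<tau> / 4 - \<tau> / 2)"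
      using \<tau> by (simp add: M_def field_simps)
    finally have less: "ennreal c * (\<integral>\<^sup>+x\<in>?W1. ennreal (norm (grad u x)) \<partial>lborel) <
        ennreal (M * (3 * \<tau> / 4 - \<tau> / 2))" .
    have ab: "\<tau> / 2 < 3 * \<tau> / 4" using \<tau> by simp
    \<comment> \<open>The excluded set \<open>Z\<close> consists of the critical values of
      \<open>u\<close> on the ball, finite because the critical points there are.\<close>
    from c(2)[OF u ab finite_imageI[OF a(2), of u] M less]
    obtain t where t: "\<tau> / 2 < t" "t < 3 * \<tau> / 4" "t \<notin> u ` {x \<in> cball 0 R. grad w x + a = 0}"
      and Ht: "hausdorff_measure (CARD('n) - 1) {x \<in> cball 0 R. u x = t} \<le> ennreal M"
      unfolding Bex_def Diff_iff greaterThanLessThan_iff by (auto simp only: DIM_cart DIM_real mult_1_right)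
    \<comment> \<open>Up to the error \<open>\<tau> / 8\<close>, \<open>w x > \<tau>\<close> forces
      \<open>u x > t\<close>, and \<open>u x \<ge> t\<close> forces
      \<open>w x \<ge> \<tau> / 4\<close>. The latter set lies in the open ball, so the closure of
      \<open>?E\<close> does not reach the sphere.\<close>
    let ?E = "{x \<in> ball 0 R. u x > t}"
    have "closed {x. t \<le> u x}"
      using smooth_on_continuous[OF u] by (intro closed_Collect_le continuous_on_const)
    then have "closed (cball 0 R \<inter> {x. t \<le> u x})" by (rule closed_Int[OF closed_cball])
    then have "closure ?E \<subseteq> cball 0 R \<inter> {x. t \<le> u x}"
      by (rule closure_minimal[rotated]) auto
    moreover have "cball 0 R \<inter> {x. t \<le> u x} \<subseteq> ?K"
    proof
      fix x assume "x \<in> cball 0 R \<inter> {x. t \<le> u x}"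
      then have "norm x \<le> R" "t \<le> u x" by auto
      with abs_le_D1[OF uw[of x]] t(1) \<tau> show "x \<in> ?K" by simp
    qed
    ultimately have clK: "closure ?E \<subseteq> ?K" by (rule order_trans)
    have cl: "compact (closure ?E)" "closure ?E \<subseteq> \<Omega>" "closure ?E \<subseteq> ball 0 R"
    proof -
      show "closure ?E \<subseteq> \<Omega>" "closure ?E \<subseteq> ball 0 R" using clK K(2) R(2) by auto
      show "compact (closure ?E)"
        using compact_Int_closed[OF K(1) closed_closure[of ?E]] clK by (simp add: Int_absorb1)
    qed
    have reg: "grad u x \<noteq> 0" if "x \<in> ball 0 R" "u x = t" for x
      using that t(3) unfolding gu by force
    note E = smooth_boundary_superlevel[OF u open_ball cl(3) reg]
    have "hausdorff_measure (CARD('n) - 1) (frontier ?E) \<le>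
        hausdorff_measure (CARD('n) - 1) {x \<in> cball 0 R. u x = t}"
      by (rule hausdorff_measure_mono) (use E(2) in force)
    also note Ht
    finally have H: "hausdorff_measure (CARD('n) - 1) (frontier ?E) \<le> ennreal (4 * c * I / \<tau>)"
      by (simp only: M_def)
    have "{x. \<tau> < w x} \<subseteq> ?E"
    proof
      fix x assume x: "x \<in> {x. \<tau> < w x}"
      then have "x \<in> ball 0 R" using R(2) \<tau> by force
      moreover have "u x > t" using abs_le_D2[OF uw[of x]] x t(2) \<tau> calculation by simp
      ultimately show "x \<in> ?E" by simp
    qed
    with E cl H show "\<exists>E. open E \<and> smooth_boundary E \<and> compact (closure E) \<and> closure E \<subseteq> \<Omega> \<and> {x. \<tau> < w x} \<subseteq> E \<and>
        hausdorff_measure (CARD('n) - 1) (frontier E) \<le> ennreal (4 * c * I / \<tau>)"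
      by blast
  qed
qed

section \<open>The upper bound\<close>

text \<open>The conventions \<open>1 / 0 = top\<close> and \<open>1 / top = 0\<close> make division
  antitone in the divisor on all of \<open>ennreal\<close>, so comparisons with
  \<open>1 / capacitary_inradius\<close> hold for inradius 0 and \<infinity> as well.\<close>

lemma ennreal_divide_mono:
  assumes "a \<le> b" "d \<le> (c::ennreal)"
  shows "a / c \<le> b / d"
proof -
  have "inverse c \<le> inverse d"
  proof (cases "d = 0 \<or> c = top")
    case False
    with assms(2) have "d \<noteq> top" by (auto simp: top_unique)
    with False obtain x y where "c = ennreal x" "d = ennreal y" "x > 0" "y > 0"
      using assms(2) by (cases c; cases d) (auto simp: less_le)
    with assms(2) show ?thesis by (simp add: inverse_ennreal ennreal_leI)
  qed auto
  with assms(1) show ?thesis unfolding divide_ennreal_def by (rule mult_mono) auto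
qed

text \<open>An almost optimal \<phi> is at least 1 on the ball outside \<Omega>, so the positive
  superlevel sets of a cutoff of \<open>1 - \<phi>\<close> lie compactly in \<Omega>. Its gradient
  integral is of order \<open>r ^ (N - 1)\<close>, and a superlevel set fills a fixed fraction of
  the ball; the quotient is of order \<open>1 / r\<close>.\<close>

lemma cheeger_constant_le_if_negligible:
  assumes N2: "CARD('n) \<ge> 2" and \<gamma>: "0 < \<gamma>" "\<gamma> < 1"
  obtains C :: real where "C > 0"
    "\<And>(\<Omega>::(real ^ 'n) set) p r. open \<Omega> \<Longrightarrow> r > 0 \<Longrightarrow> negligible1 \<gamma> p r (cball p r - \<Omega>) \<Longrightarrow>
      cheeger_constant \<Omega> \<le> ennreal (C / r)"
proof -
  let ?N = "CARD('n)" and ?k = "CARD('n) - 1"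
  let ?\<omega> = "unit_ball_vol (real ?N)"
  have \<omega>: "?\<omega> > 0" by simp
  obtain c0 :: real where c0: "c0 > 0"
    "\<And>(w::real ^ 'n \<Rightarrow> real) \<tau> I \<Omega>. smooth_on UNIV w \<Longrightarrow> \<tau> > 0 \<Longrightarrow>
      (\<integral>\<^sup>+x. ennreal (norm (grad w x)) \<partial>lborel) < ennreal I \<Longrightarrow>
      (\<And>s. s > 0 \<Longrightarrow> compact {x. s \<le> w x} \<and> {x. s \<le> w x} \<subseteq> \<Omega>) \<Longrightarrow>
      \<exists>E. open E \<and> smooth_boundary E \<and> compact (closure E) \<and> closure E \<subseteq> \<Omega> \<and> {x. \<tau> < w x} \<subseteq> E \<and>
        hausdorff_measure (CARD('n) - 1) (frontier E) \<le> ennreal (c0 * I / \<tau>)"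
    by (rule smooth_superlevel_set_exists[where 'n='n]) blast
  \<comment> \<open>The room between \<gamma> and \<open>\<gamma>'\<close> absorbs the factor
    \<open>(1 + \<epsilon>) ^ ?N\<close> of \<open>cap1_cball_le\<close>.\<close>
  define \<gamma>' where "\<gamma>' = (1 + \<gamma>) / 2"
  have \<gamma>': "\<gamma> < \<gamma>'" "0 < \<gamma>'" "\<gamma>' < 1" using \<gamma> by (auto simp: \<gamma>'_def)
  \<comment> \<open>By Chebyshev's inequality \<phi> reaches \<open>1 - \<tau>\<close> on at most
    the fraction \<open>\<gamma>' / (1 - \<tau>)\<close> of the ball. This is below 1, and
    \<open>\<theta>\<close> is the fraction that remains.\<close>
  define \<tau> where "\<tau> = (1 - \<gamma>') / 2"
  have \<tau>: "\<tau> > 0" "1 - \<tau> > 0" using \<gamma>' by (auto simp: \<tau>_def)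
  define \<theta> where "\<theta> = (1 - \<gamma>') / (1 + \<gamma>')"
  have \<theta>: "\<theta> > 0" "\<theta> < 1" using \<gamma>' by (auto simp: \<theta>_def field_simps)
  have \<theta>': "\<gamma>' / (1 - \<tau>) = 1 - \<theta>" using \<gamma>' by (simp add: \<theta>_def \<tau>_def field_simps)
  obtain \<epsilon> :: real where \<epsilon>: "0 < \<epsilon>" "\<epsilon> < 1" "\<gamma> * (1 + \<epsilon>) ^ ?N < \<gamma>'"
  proof -
    have "((\<lambda>x. \<gamma> * (1 + x) ^ ?N) \<longlongrightarrow> \<gamma> * (1 + 0) ^ ?N) (at_right 0)"
      by (intro tendsto_intros)
    then have "eventually (\<lambda>x. \<gamma> * (1 + x) ^ ?N < \<gamma>') (at_right 0)"
      by (rule order_tendstoD(2)) (use \<gamma>' in simp)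
    moreover have "eventually (\<lambda>x::real. x < 1) (at_right 0)"
      by (rule order_tendstoD(2)[OF tendsto_ident_at]) simp
    moreover have "eventually (\<lambda>x::real. 0 < x) (at_right 0)"
      by (rule eventually_at_right_less)
    ultimately have "eventually (\<lambda>x. 0 < x \<and> x < 1 \<and> \<gamma> * (1 + x) ^ ?N < \<gamma>') (at_right 0)"
      by eventually_elim auto
    then show ?thesis
      using eventually_happens trivial_limit_at_right_real that by blast
  qed
  \<comment> \<open>The cutoff has to equal 1 on more than the fraction
    \<open>1 - \<theta> / 2\<close> of the volume; removing the bad fraction
    \<open>1 - \<theta>\<close> then still leaves \<open>\<theta> / 2\<close>.\<close>
  obtain \<rho> :: real where \<rho>: "0 < \<rho>" "\<rho> < 1" "1 - \<theta> / 2 < \<rho> ^ ?N"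
  proof -
    have "((\<lambda>x::real. x ^ ?N) \<longlongrightarrow> 1 ^ ?N) (at_left 1)"
      by (intro tendsto_intros)
    then have "eventually (\<lambda>x. 1 - \<theta> / 2 < x ^ ?N) (at_left (1::real))"
      by (rule order_tendstoD(1)) (use \<theta> in simp)
    moreover have "eventually (\<lambda>x::real. 0 < x) (at_left 1)"
      by (rule order_tendstoD(1)[OF tendsto_ident_at]) simp
    moreover have "eventually (\<lambda>x::real. x < 1) (at_left 1)"
      by (simp add: eventually_at_filter)
    ultimately have "eventually (\<lambda>x::real. 0 < x \<and> x < 1 \<and> 1 - \<theta> / 2 < x ^ ?N) (at_left 1)"
      by eventually_elim auto
    then show ?thesis
      using eventually_happens trivial_limit_at_left_real that by blast
  qed
  obtain B where B: "B > 0" "\<And>(p::real ^ 'n) r. r > 0 \<Longrightarrow>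
    \<exists>\<eta>. smooth_on UNIV \<eta> \<and> (\<forall>x. 0 \<le> \<eta> x \<and> \<eta> x \<le> 1) \<and>
      (\<forall>x\<in>cball p (\<rho> * r). \<eta> x = 1) \<and> (\<forall>x. x \<notin> ball p (1 * r) \<longrightarrow> \<eta> x = 0) \<and>
      (\<forall>x. norm (grad \<eta> x) \<le> B / r) \<and> (\<forall>x. x \<notin> ball p (1 * r) - cball p (\<rho> * r) \<longrightarrow> grad \<eta> x = 0) \<and>
      (\<forall>x. grad \<eta> x \<bullet> (x - p) = - norm (grad \<eta> x) * norm (x - p))"
    by (rule bump_exists[OF \<rho>(1,2)]) (rule that, assumption+)
  \<comment> \<open>The gradient of \<phi> contributes \<open>?N * ?\<omega>\<close>, and that of
    the cutoff at most \<open>B / r\<close> times two ball volumes; both carry the factor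
    \<open>r ^ ?k\<close>.\<close>
  define D where "D = (?N + 2 * B) * ?\<omega>"
  have D: "D > 0" using B(1) \<omega> unfolding D_def by (intro mult_pos_pos add_nonneg_pos) auto
  define C where "C = c0 * D / (\<tau> * (\<theta> / 2 * ?\<omega>))"
  show ?thesis
  proof (rule that[of C])
    show "C > 0" using c0(1) D \<tau>(1) \<theta>(1) \<omega> unfolding C_def by (intro divide_pos_pos mult_pos_pos) auto
    fix \<Omega> :: "(real ^ 'n) set" and p r
    assume \<Omega>: "open \<Omega>" and r: "r > 0" and neg: "negligible1 \<gamma> p r (cball p r - \<Omega>)"
    have rk: "r ^ ?N = r * r ^ ?k" using N2 by (simp add: power_eq_if)
    define A where "A = ?N * ?\<omega> * r ^ ?k"
    have A: "A > 0" using \<omega> r N2 unfolding A_def by (intro mult_pos_pos) auto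
    define V where "V = ?\<omega> * r ^ ?N"
    have V: "V > 0" using \<omega> r by (simp add: V_def)
    \<comment> \<open>Here sharpness enters: the ray constant times the capacity is exactly the
      volume, so energy below \<open>\<gamma>' * A\<close> gives \<open>\<bar>\<phi>\<bar>\<close> a
      mean of at most \<open>\<gamma>'\<close>.\<close>
    have AV: "r / ?N * A = V" using r N2 by (simp add: A_def V_def rk)
    have "cap1 (cball p r - \<Omega>) (ball p (2 * r)) \<le> ennreal \<gamma> * cap1 (cball p r) (ball p (2 * r))"
      using neg by (simp add: negligible1_def)
    also have "\<dots> \<le> ennreal \<gamma> * ennreal ((1 + \<epsilon>) ^ ?N * A)"
      using cap1_cball_le[OF r \<epsilon>(1,2), of p] by (intro mult_left_mono) (simp_all add: A_def)
    also have "\<dots> = ennreal (\<gamma> * (1 + \<epsilon>) ^ ?N * A)"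
      using \<gamma> by (simp add: ennreal_mult'[symmetric] mult.assoc)
    also have "\<dots> < ennreal (\<gamma>' * A)"
      using \<epsilon>(3) A \<gamma>' by (intro ennreal_lessI mult_strict_right_mono) auto
    finally obtain \<phi> where \<phi>: "\<phi> \<in> smooth_compact_support (ball p (2 * r))" "\<And>x. x \<in> cball p r - \<Omega> \<Longrightarrow> 1 \<le> \<phi> x"
      and "(\<integral>\<^sup>+x\<in>ball p (2 * r). ennreal (norm (grad \<phi> x)) \<partial>lborel) < ennreal (\<gamma>' * A)"
      unfolding cap1_def INF_less_iff by blast
    then have g\<phi>: "(\<integral>\<^sup>+x. ennreal (norm (grad \<phi> x)) \<partial>lborel) < ennreal (\<gamma>' * A)"
      by (simp add: nn_integral_grad_compact_support)
    have s\<phi>: "smooth_on UNIV \<phi>" "compact (closure {x. \<phi> x \<noteq> 0})"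
      using \<phi>(1) by (auto simp: smooth_compact_support_def)
    note [measurable] = grad_measurable[OF s\<phi>(1)]
    have \<phi>m[measurable]: "\<phi> \<in> borel_measurable borel"
      using smooth_on_continuous[OF s\<phi>(1)] by (rule borel_measurable_continuous_onI)
    have bm[measurable]: "cball p s \<in> sets borel" for s by simp
    have J: "(\<integral>\<^sup>+x\<in>cball p r. ennreal \<bar>\<phi> x\<bar> \<partial>lborel) \<le> ennreal (\<gamma>' * V)"
    proof -
      have "(\<integral>\<^sup>+x\<in>cball p r. ennreal \<bar>\<phi> x\<bar> \<partial>lborel) \<le>
          ennreal (r / ?N) * (\<integral>\<^sup>+x. ennreal (norm (grad \<phi> x)) \<partial>lborel)"
        using nn_integral_ball_le_grad[OF s\<phi> r, of p] by simp
      also have "\<dots> \<le> ennreal (r / ?N) * ennreal (\<gamma>' * A)"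
        by (intro mult_left_mono less_imp_le[OF g\<phi>]) simp
      also have "\<dots> = ennreal (r / ?N * (\<gamma>' * A))"
        using r by (intro ennreal_mult'[symmetric]) simp
      also have "r / ?N * (\<gamma>' * A) = \<gamma>' * V" using AV by (simp add: mult.left_commute)
      finally show ?thesis .
    qed
    from B(2)[OF r, of p] obtain \<eta> where \<eta>: "smooth_on UNIV \<eta>" "\<And>x. 0 \<le> \<eta> x" "\<And>x. \<eta> x \<le> 1"
      "\<And>x. x \<in> cball p (\<rho> * r) \<Longrightarrow> \<eta> x = 1" "\<And>x. x \<notin> ball p r \<Longrightarrow> \<eta> x = 0"
      "\<And>x. norm (grad \<eta> x) \<le> B / r" "\<And>x. x \<notin> ball p r \<Longrightarrow> grad \<eta> x = 0" by (elim exE) auto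
    define w where "w x = \<eta> x * (1 - \<phi> x)" for x
    have s1: "smooth_on UNIV (\<lambda>x. 1 - \<phi> x)" by (intro smooth_on_diff smooth_on_const s\<phi>) simp
    have w: "smooth_on UNIV w" unfolding w_def[abs_def] by (rule smooth_on_mult[OF open_UNIV \<eta>(1) s1])
    have lev: "compact {x. s \<le> w x} \<and> {x. s \<le> w x} \<subseteq> \<Omega>" if "s > 0" for s
    proof
      have sub: "{x. s \<le> w x} \<subseteq> cball p r"
      proof
        fix x assume "x \<in> {x. s \<le> w x}"
        then have "\<eta> x \<noteq> 0" using that by (auto simp: w_def)
        then have "x \<in> ball p r" using \<eta>(5) by blast
        then show "x \<in> cball p r" by simp
      qed
      have "closed {x. s \<le> w x}"
        using smooth_on_continuous[OF w] by (intro closed_Collect_le continuous_on_const)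
      then show "compact {x. s \<le> w x}"
        using bounded_subset[OF bounded_cball sub] by (simp add: compact_eq_bounded_closed)
      show "{x. s \<le> w x} \<subseteq> \<Omega>"
      proof (rule subsetI, rule ccontr)
        fix x assume x: "x \<in> {x. s \<le> w x}" "x \<notin> \<Omega>"
        then have "\<phi> x \<ge> 1" using sub \<phi>(2) by auto
        then have "w x \<le> 0" using \<eta>(2)[of x] by (simp add: w_def mult_nonneg_nonpos)
        with x that show False by simp
      qed
    qed
    have "(\<integral>\<^sup>+x. ennreal (norm (grad w x)) \<partial>lborel) \<le>
      (\<integral>\<^sup>+x. ennreal (norm (grad \<phi> x)) + ennreal (B / r) * (indicator (cball p r) x + ennreal \<bar>\<phi> x\<bar> * indicator (cball p r) x) \<partial>lborel)"
    proof (rule nn_integral_mono)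
      fix x
      have "grad w x = (1 - \<phi> x) *\<^sub>R grad \<eta> x - \<eta> x *\<^sub>R grad \<phi> x"
        unfolding w_def[abs_def]
        using smooth_on_differentiable[OF s1, of x] smooth_on_differentiable[OF \<eta>(1), of x] smooth_on_differentiable[OF s\<phi>(1), of x]
        by (simp add: grad_mult grad_diff)
      then have "norm (grad w x) \<le> norm ((1 - \<phi> x) *\<^sub>R grad \<eta> x) + norm (\<eta> x *\<^sub>R grad \<phi> x)"
        using norm_triangle_ineq4 by metis
      also have "norm (\<eta> x *\<^sub>R grad \<phi> x) \<le> norm (grad \<phi> x)"
        using \<eta>(2,3)[of x] by (simp add: mult_left_le_one_le)
      finally have 1: "norm (grad w x) \<le> \<bar>1 - \<phi> x\<bar> * norm (grad \<eta> x) + norm (grad \<phi> x)" by simp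
      show "ennreal (norm (grad w x)) \<le> ennreal (norm (grad \<phi> x)) +
          ennreal (B / r) * (indicator (cball p r) x + ennreal \<bar>\<phi> x\<bar> * indicator (cball p r) x)"
      proof (cases "x \<in> ball p r")
        case True
        have "\<bar>1 - \<phi> x\<bar> * norm (grad \<eta> x) \<le> (1 + \<bar>\<phi> x\<bar>) * (B / r)"
          using \<eta>(6)[of x] by (intro mult_mono) auto
        then have "ennreal (norm (grad w x)) \<le> ennreal (norm (grad \<phi> x) + B / r * (1 + \<bar>\<phi> x\<bar>))"
          using 1 by (intro ennreal_leI) (simp add: mult.commute)
        also have "\<dots> = ennreal (norm (grad \<phi> x)) + ennreal (B / r * (1 + \<bar>\<phi> x\<bar>))"
          using B(1) r by (intro ennreal_plus) auto
        also have "ennreal (B / r * (1 + \<bar>\<phi> x\<bar>)) = ennreal (B / r) * ennreal (1 + \<bar>\<phi> x\<bar>)"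
          using B(1) r by (intro ennreal_mult') simp
        finally show ?thesis using True by simp
      next
        case False
        then show ?thesis using 1 \<eta>(7)[of x] by (simp add: add_increasing2 ennreal_leI)
      qed
    qed
    also have "\<dots> = (\<integral>\<^sup>+x. ennreal (norm (grad \<phi> x)) \<partial>lborel) +
        ennreal (B / r) * (emeasure lborel (cball p r) + (\<integral>\<^sup>+x\<in>cball p r. ennreal \<bar>\<phi> x\<bar> \<partial>lborel))"
      by (simp add: nn_integral_add nn_integral_cmult)
    also have "\<dots> \<le> (\<integral>\<^sup>+x. ennreal (norm (grad \<phi> x)) \<partial>lborel) + ennreal (B / r) * (ennreal V + ennreal (\<gamma>' * V))"
      using J r by (intro add_left_mono mult_left_mono add_mono) (auto simp: emeasure_cball V_def)
    also have "\<dots> = (\<integral>\<^sup>+x. ennreal (norm (grad \<phi> x)) \<partial>lborel) + ennreal (B / r * (V + \<gamma>' * V))"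
      using V \<gamma>' B(1) r by (simp add: ennreal_plus[symmetric] ennreal_mult'[symmetric] del: ennreal_plus)
    also have "\<dots> < ennreal (\<gamma>' * A) + ennreal (B / r * (V + \<gamma>' * V))"
      unfolding add.commute[of _ "ennreal (B / r * (V + \<gamma>' * V))"] ennreal_add_left_cancel_less
      using g\<phi> by simp
    also have "\<dots> = ennreal (\<gamma>' * A + B / r * (V + \<gamma>' * V))"
      using V \<gamma>' B(1) r A by (intro ennreal_plus[symmetric]) auto
    also have "\<dots> \<le> ennreal (D * r ^ ?k)"
    proof (rule ennreal_leI)
      have "\<gamma>' * A \<le> 1 * A" using A \<gamma>' by (intro mult_right_mono) auto
      moreover have "B / r * (V + \<gamma>' * V) \<le> B / r * (V + 1 * V)"
        using V \<gamma>' B(1) r by (intro mult_left_mono add_left_mono mult_right_mono) auto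
      moreover have "1 * A + B / r * (V + 1 * V) = D * r ^ ?k"
        using r by (simp add: A_def V_def D_def rk algebra_simps)
      ultimately show "\<gamma>' * A + B / r * (V + \<gamma>' * V) \<le> D * r ^ ?k" by linarith
    qed
    finally have "(\<integral>\<^sup>+x. ennreal (norm (grad w x)) \<partial>lborel) < ennreal (D * r ^ ?k)" .
    from c0(2)[OF w \<tau>(1) this lev] obtain E where E: "open E" "smooth_boundary E" "compact (closure E)"
      "closure E \<subseteq> \<Omega>" "{x. \<tau> < w x} \<subseteq> E" "hausdorff_measure ?k (frontier E) \<le> ennreal (c0 * (D * r ^ ?k) / \<tau>)"
      by blast
    let ?Bad = "{x \<in> cball p r. 1 - \<tau> \<le> \<phi> x}"
    have Badm[measurable]: "?Bad \<in> sets borel" by measurable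
    have Bad: "emeasure lborel ?Bad \<le> ennreal ((1 - \<theta>) * V)"
    proof -
      have "ennreal (1 - \<tau>) * emeasure lborel ?Bad = (\<integral>\<^sup>+x. ennreal (1 - \<tau>) * indicator ?Bad x \<partial>lborel)"
        by (simp add: nn_integral_cmult_indicator)
      also have "\<dots> \<le> (\<integral>\<^sup>+x\<in>cball p r. ennreal \<bar>\<phi> x\<bar> \<partial>lborel)"
        by (intro nn_integral_mono) (auto simp: indicator_def intro!: ennreal_leI)
      also note J
      finally have "ennreal (1 / (1 - \<tau>)) * (ennreal (1 - \<tau>) * emeasure lborel ?Bad) \<le>
          ennreal (1 / (1 - \<tau>)) * ennreal (\<gamma>' * V)"
        by (rule mult_left_mono) simp
      also have "\<dots> = ennreal (1 / (1 - \<tau>) * (\<gamma>' * V))"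
        using \<tau> by (intro ennreal_mult'[symmetric]) simp
      also have "1 / (1 - \<tau>) * (\<gamma>' * V) = (1 - \<theta>) * V" unfolding \<theta>'[symmetric] by simp
      also have "ennreal (1 / (1 - \<tau>)) * (ennreal (1 - \<tau>) * emeasure lborel ?Bad) = emeasure lborel ?Bad"
        using \<tau>(2) by (simp add: mult.assoc[symmetric] ennreal_mult'[symmetric])
      finally show ?thesis .
    qed
    have Em[measurable]: "E \<in> sets borel" using E(1) by simp
    \<comment> \<open>On the smaller ball the cutoff is 1, so off the bad set
      \<open>w x = 1 - \<phi> x\<close> exceeds \<tau>.\<close>
    have sub: "cball p (\<rho> * r) \<subseteq> E \<union> ?Bad"
    proof
      fix x assume x: "x \<in> cball p (\<rho> * r)"
      have "\<rho> * r \<le> 1 * r" using \<rho> r by (intro mult_right_mono) auto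
      then have "x \<in> cball p r" using x by auto
      moreover have "w x = 1 - \<phi> x" using \<eta>(4)[OF x] by (simp add: w_def)
      ultimately show "x \<in> E \<union> ?Bad" using E(5) by (auto simp: not_le subset_iff)
    qed
    have "ennreal ((1 - \<theta> / 2) * V) \<le> ennreal (\<rho> ^ ?N * V)"
      using \<rho>(3) V by (intro ennreal_leI mult_right_mono) auto
    also have "\<dots> = emeasure lborel (cball p (\<rho> * r))"
      using \<rho>(1) r by (simp add: emeasure_cball V_def power_mult_distrib mult_ac)
    also have "\<dots> \<le> emeasure lborel (E \<union> ?Bad)"
      by (intro emeasure_mono sub) measurable
    also have "\<dots> \<le> emeasure lborel E + emeasure lborel ?Bad"
      by (rule emeasure_subadditive) auto
    also have "\<dots> \<le> emeasure lborel E + ennreal ((1 - \<theta>) * V)"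
      by (intro add_left_mono Bad)
    finally have "ennreal ((1 - \<theta>) * V) + ennreal (\<theta> / 2 * V) \<le> ennreal ((1 - \<theta>) * V) + emeasure lborel E"
      using \<theta> V by (simp add: ennreal_plus[symmetric] add.commute algebra_simps del: ennreal_plus)
    then have EV: "ennreal (\<theta> / 2 * V) \<le> emeasure lborel E"
      by (subst (asm) ennreal_add_left_cancel_le) auto
    have \<theta>V: "\<theta> / 2 * V > 0" using \<theta> V by simp
    have "E \<noteq> {}" using EV \<theta>V by (auto simp: ennreal_eq_0_iff)
    then have "cheeger_constant \<Omega> \<le> hausdorff_measure ?k (frontier E) / emeasure lborel E"
      unfolding cheeger_constant_def using E by (intro INF_lower2[of E]) auto
    also have "\<dots> \<le> ennreal (c0 * (D * r ^ ?k) / \<tau>) / ennreal (\<theta> / 2 * V)"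
      by (intro ennreal_divide_mono E EV)
    also have "\<dots> = ennreal (c0 * (D * r ^ ?k) / \<tau> / (\<theta> / 2 * V))"
      using c0(1) D r \<tau> \<theta>V by (intro divide_ennreal) auto
    also have "c0 * (D * r ^ ?k) / \<tau> / (\<theta> / 2 * V) = C / r"
      using r less_imp_neq[OF \<omega>] by (simp add: C_def V_def rk field_simps)
    finally show "cheeger_constant \<Omega> \<le> ennreal (C / r)" .
  qed
qed

section \<open>From single balls to the capacitary inradius\<close>

lemma ennreal_times_inverse_le:
  "R \<le> ennreal (C / z) \<Longrightarrow> C > 0 \<Longrightarrow> z > 0 \<Longrightarrow> ennreal z \<le> ennreal C * (1 / R)"
proof -
  assume *: "R \<le> ennreal (C / z)" "C > 0" "z > 0"
  have "ennreal z = ennreal C * (1 / ennreal (C / z))"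
    using *(2,3) by (simp add: divide_ennreal ennreal_1[symmetric] ennreal_mult'[symmetric] del: ennreal_1)
  also have "\<dots> \<le> ennreal C * (1 / R)"
    by (intro mult_left_mono ennreal_divide_mono *(1)) auto
  finally show ?thesis .
qed

lemma ennreal_times_inverse_ge:
  "ennreal (C / z) \<le> R \<Longrightarrow> C > 0 \<Longrightarrow> z > 0 \<Longrightarrow> ennreal C * (1 / R) \<le> ennreal z"
proof -
  assume *: "ennreal (C / z) \<le> R" "C > 0" "z > 0"
  have "ennreal C * (1 / R) \<le> ennreal C * (1 / ennreal (C / z))"
    by (intro mult_left_mono ennreal_divide_mono *(1)) auto
  also have "\<dots> = ennreal z"
    using *(2,3) by (simp add: divide_ennreal ennreal_1[symmetric] ennreal_mult'[symmetric] del: ennreal_1)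
  finally show ?thesis .
qed

lemma dense_ennreal:
  assumes "x < (y::ennreal)"
  obtains z where "z > 0" "x < ennreal z" "ennreal z < y"
proof -
  obtain w where w: "x < w" "w < y" using dense[OF assms] by blast
  then obtain z where "w = ennreal z" "z \<ge> 0" by (cases w) auto
  then show ?thesis using w that[of z] by (cases "z = 0") auto
qed

text \<open>If the quotient of a competitor were below some
  \<open>z < \<sigma> * \<gamma> / R\<close>, small perimeter would give a negligible complement in
  a ball of radius \<open>\<sigma> * \<gamma> / z > R\<close>, against the definition of
  \<open>R\<close> as a supremum.\<close>

lemma cheeger_lower_bound:
  assumes "CARD('n) \<ge> 2"
  obtains \<sigma> :: real where "\<sigma> > 0"
    "\<And>\<gamma> (\<Omega>::(real ^ 'n) set). 0 < \<gamma> \<Longrightarrow> open \<Omega> \<Longrightarrow>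
      ennreal (\<sigma> * \<gamma>) * (1 / capacitary_inradius \<gamma> \<Omega>) \<le> cheeger_constant \<Omega>"
proof -
  have "DIM(real ^ 'n) \<ge> 2" using assms by simp
  then obtain \<sigma> :: real where \<sigma>: "\<sigma> > 0"
    "\<And>\<gamma> (E::(real ^ 'n) set) \<Omega> r. 0 < \<gamma> \<Longrightarrow> open E \<Longrightarrow> E \<noteq> {} \<Longrightarrow> bounded E \<Longrightarrow> E \<subseteq> \<Omega> \<Longrightarrow> open \<Omega> \<Longrightarrow> r > 0 \<Longrightarrow>
      hausdorff_measure (DIM(real ^ 'n) - 1) (frontier E) < ennreal (\<sigma> * \<gamma> / r) * emeasure lborel E \<Longrightarrow>
      \<exists>p. negligible1 \<gamma> p r (cball p r - \<Omega>)"
    by (rule negligible1_if_small_perimeter) blast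
  show ?thesis
  proof (rule that[OF \<sigma>(1)])
    fix \<gamma> :: real and \<Omega> :: "(real ^ 'n) set"
    assume \<gamma>: "0 < \<gamma>" and \<Omega>: "open \<Omega>"
    let ?R = "capacitary_inradius \<gamma> \<Omega>"
    have \<sigma>\<gamma>: "\<sigma> * \<gamma> > 0" using \<sigma>(1) \<gamma> by simp
    show "ennreal (\<sigma> * \<gamma>) * (1 / ?R) \<le> cheeger_constant \<Omega>"
      unfolding cheeger_constant_def
    proof (rule INF_greatest)
      fix E assume "E \<in> {E. open E \<and> E \<noteq> {} \<and> smooth_boundary E \<and> compact (closure E) \<and> closure E \<subseteq> \<Omega>}"
      then have E: "open E" "E \<noteq> {}" "compact (closure E)" "closure E \<subseteq> \<Omega>" by auto
      let ?H = "hausdorff_measure (DIM(real ^ 'n) - 1) (frontier E)"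
      have bE: "bounded E"
        using bounded_subset[OF compact_imp_bounded[OF E(3)] closure_subset] .
      have EO: "E \<subseteq> \<Omega>" using closure_subset E(4) by (rule order_trans)
      have fin: "emeasure lborel E \<noteq> top" using emeasure_bounded_finite[OF bE] by simp
      have pos: "emeasure lborel E \<noteq> 0"
        using open_not_negligible[OF E(1,2)] E(1) by (auto simp: negligible_iff_null_sets null_sets_def)
      show "ennreal (\<sigma> * \<gamma>) * (1 / ?R) \<le> ?H / emeasure lborel E"
      proof (rule ccontr)
        assume "\<not> ?thesis"
        then have "?H / emeasure lborel E < ennreal (\<sigma> * \<gamma>) * (1 / ?R)" by simp
        then obtain z where z: "z > 0" "?H / emeasure lborel E < ennreal z" "ennreal z < ennreal (\<sigma> * \<gamma>) * (1 / ?R)"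
          by (rule dense_ennreal)
        define r where "r = \<sigma> * \<gamma> / z"
        have r: "r > 0" "\<sigma> * \<gamma> / r = z" using \<sigma>\<gamma> z(1) by (auto simp: r_def)
        have "?H < ennreal z * emeasure lborel E"
        proof (rule ccontr)
          assume "\<not> ?thesis"
          then have "ennreal z * emeasure lborel E / emeasure lborel E \<le> ?H / emeasure lborel E"
            by (intro ennreal_divide_mono) auto
          with z(2) show False using pos fin by (simp add: ennreal_mult_divide_eq)
        qed
        then have "\<exists>p. negligible1 \<gamma> p r (cball p r - \<Omega>)"
          using \<sigma>(2)[OF \<gamma> E(1,2) bE EO \<Omega> r(1)] r(2) by simp
        then have "ennreal r \<le> ?R"
          unfolding capacitary_inradius_def using r(1) by (intro SUP_upper) auto
        from ennreal_times_inverse_ge[OF this[unfolded r_def] \<sigma>\<gamma> z(1)] z(3) show False by simp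
      qed
    qed
  qed
qed

text \<open>Any \<open>z\<close> above \<open>C' / R\<close> admits a negligible ball of radius
  \<open>r > C' / z\<close>, which gives \<open>C / r \<le> z\<close>. Allowing every
  \<open>C' \<ge> C\<close> lets the constant be enlarged afterwards to force its
  divergence.\<close>

lemma cheeger_upper_bound:
  assumes "CARD('n) \<ge> 2" "0 < \<gamma>" "\<gamma> < 1"
  obtains C :: real where "C > 0"
    "\<And>C' (\<Omega>::(real ^ 'n) set). C \<le> C' \<Longrightarrow> open \<Omega> \<Longrightarrow>
      cheeger_constant \<Omega> \<le> ennreal C' * (1 / capacitary_inradius \<gamma> \<Omega>)"
proof -
  obtain C :: real where C: "C > 0"
    "\<And>(\<Omega>::(real ^ 'n) set) p r. open \<Omega> \<Longrightarrow> r > 0 \<Longrightarrow> negligible1 \<gamma> p r (cball p r - \<Omega>) \<Longrightarrow>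
      cheeger_constant \<Omega> \<le> ennreal (C / r)"
    by (rule cheeger_constant_le_if_negligible[OF assms]) blast
  show ?thesis
  proof (rule that[OF C(1)])
    fix C' and \<Omega> :: "(real ^ 'n) set"
    assume C': "C \<le> C'" and \<Omega>: "open \<Omega>"
    let ?R = "capacitary_inradius \<gamma> \<Omega>"
    show "cheeger_constant \<Omega> \<le> ennreal C' * (1 / ?R)"
    proof (rule ccontr)
      assume "\<not> ?thesis"
      then have "ennreal C' * (1 / ?R) < cheeger_constant \<Omega>" by simp
      then obtain z where z: "z > 0" "ennreal C' * (1 / ?R) < ennreal z" "ennreal z < cheeger_constant \<Omega>"
        by (rule dense_ennreal)
      have pos: "C' > 0" using C(1) C' by simp
      have "ennreal (C' / z) < ?R"
      proof (rule ccontr)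
        assume "\<not> ?thesis"
        then have "?R \<le> ennreal (C' / z)" by simp
        from ennreal_times_inverse_le[OF this pos z(1)] z(2) show False by simp
      qed
      then obtain r p where r: "r > 0" "negligible1 \<gamma> p r (cball p r - \<Omega>)" "ennreal (C' / z) < ennreal r"
        unfolding capacitary_inradius_def less_SUP_iff by blast
      then have "C' / z < r" using pos z(1) by (simp add: ennreal_less_iff)
      then have "C / r \<le> z" using r(1) z(1) C' by (simp add: field_simps)
      then have "cheeger_constant \<Omega> \<le> ennreal z"
        using C(2)[OF \<Omega> r(1,2)] by (meson ennreal_leI order_trans)
      with z(3) show False by simp
    qed
  qed
qed

theorem corollary1:
  assumes "CARD('n::finite) \<ge> 2"
  shows "(\<exists>(\<sigma>::real) (C::real \<Rightarrow> real).
            \<sigma> > 0 \<and> (\<forall>\<gamma>\<in>{0<..<1}. C \<gamma> > 0) \<and> filterlim C at_top (at_left 1) \<and>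
            (\<forall>\<gamma>\<in>{0<..<1}. \<forall>\<Omega>::(real ^ 'n) set. open \<Omega> \<longrightarrow>
               ennreal (\<sigma> * \<gamma>) * (1 / capacitary_inradius \<gamma> \<Omega>) \<le> cheeger_constant \<Omega> \<and>
               cheeger_constant \<Omega> \<le> ennreal (C \<gamma>) * (1 / capacitary_inradius \<gamma> \<Omega>))) \<and>
         (\<forall>\<Omega>::(real ^ 'n) set. open \<Omega> \<longrightarrow>
            (\<forall>\<gamma>\<in>{0<..<1}. cheeger_constant \<Omega> > 0 \<longleftrightarrow> capacitary_inradius \<gamma> \<Omega> < \<infinity>) \<and>
            (\<forall>\<gamma>\<in>{0<..<1}. \<forall>\<gamma>'\<in>{0<..<1}.
               capacitary_inradius \<gamma> \<Omega> < \<infinity> \<longleftrightarrow> capacitary_inradius \<gamma>' \<Omega> < \<infinity>))"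
proof -
  obtain \<sigma> :: real where \<sigma>: "\<sigma> > 0"
    "\<And>\<gamma> (\<Omega>::(real ^ 'n) set). 0 < \<gamma> \<Longrightarrow> open \<Omega> \<Longrightarrow>
      ennreal (\<sigma> * \<gamma>) * (1 / capacitary_inradius \<gamma> \<Omega>) \<le> cheeger_constant \<Omega>"
    by (rule cheeger_lower_bound[OF assms]) blast
  have "\<forall>\<gamma>\<in>{0<..<1}. \<exists>C>0. \<forall>C'\<ge>C. \<forall>\<Omega>::(real ^ 'n) set. open \<Omega> \<longrightarrow>
      cheeger_constant \<Omega> \<le> ennreal C' * (1 / capacitary_inradius \<gamma> \<Omega>)"
  proof
    fix \<gamma> :: real assume "\<gamma> \<in> {0<..<1}"
    then have "0 < \<gamma>" "\<gamma> < 1" by auto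
    then show "\<exists>C>0. \<forall>C'\<ge>C. \<forall>\<Omega>::(real ^ 'n) set. open \<Omega> \<longrightarrow>
      cheeger_constant \<Omega> \<le> ennreal C' * (1 / capacitary_inradius \<gamma> \<Omega>)"
      by (rule cheeger_upper_bound[OF assms]) blast
  qed
  then obtain C0 where C0: "\<And>\<gamma>. \<gamma> \<in> {0<..<1} \<Longrightarrow> C0 \<gamma> > 0"
    "\<And>\<gamma> C' (\<Omega>::(real ^ 'n) set). \<gamma> \<in> {0<..<1} \<Longrightarrow> C0 \<gamma> \<le> C' \<Longrightarrow> open \<Omega> \<Longrightarrow>
      cheeger_constant \<Omega> \<le> ennreal C' * (1 / capacitary_inradius \<gamma> \<Omega>)"
    unfolding bchoice_iff by blast
  \<comment> \<open>The second argument of \<open>max\<close> provides the divergence as \<gamma>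
    tends to 1.\<close>
  define C where "C \<gamma> = max (C0 \<gamma>) (inverse (1 - \<gamma>))" for \<gamma>
  have lim: "filterlim C at_top (at_left 1)"
  proof (rule filterlim_at_top_mono)
    have "((\<lambda>\<gamma>::real. 1 - \<gamma>) \<longlongrightarrow> 1 - 1) (at_left 1)" by (intro tendsto_intros)
    then show "filterlim (\<lambda>\<gamma>::real. inverse (1 - \<gamma>)) at_top (at_left 1)"
      by (intro filterlim_inverse_at_top) (auto simp: eventually_at_filter)
    show "eventually (\<lambda>\<gamma>. inverse (1 - \<gamma>) \<le> C \<gamma>) (at_left 1)"
      by (simp add: C_def)
  qed
  have bounds: "ennreal (\<sigma> * \<gamma>) * (1 / capacitary_inradius \<gamma> \<Omega>) \<le> cheeger_constant \<Omega> \<and>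
      cheeger_constant \<Omega> \<le> ennreal (C \<gamma>) * (1 / capacitary_inradius \<gamma> \<Omega>)"
    if "\<gamma> \<in> {0<..<1}" "open \<Omega>" for \<gamma> and \<Omega> :: "(real ^ 'n) set"
    using \<sigma>(2)[of \<gamma> \<Omega>] C0(2)[of \<gamma> "C \<gamma>" \<Omega>] that by (simp add: C_def)
  \<comment> \<open>An infinite inradius makes the upper bound 0; a finite one makes the lower bound
    positive, including inradius 0, where \<open>1 / 0 = top\<close>.\<close>
  have iff: "cheeger_constant \<Omega> > 0 \<longleftrightarrow> capacitary_inradius \<gamma> \<Omega> < \<infinity>"
    if "\<gamma> \<in> {0<..<1}" "open \<Omega>" for \<gamma> and \<Omega> :: "(real ^ 'n) set"
  proof
    assume "cheeger_constant \<Omega> > 0"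
    then have "capacitary_inradius \<gamma> \<Omega> \<noteq> top" using bounds[OF that] by auto
    then show "capacitary_inradius \<gamma> \<Omega> < \<infinity>" by (simp add: less_top)
  next
    assume "capacitary_inradius \<gamma> \<Omega> < \<infinity>"
    then have "0 < ennreal (\<sigma> * \<gamma>) * (1 / capacitary_inradius \<gamma> \<Omega>)"
      using \<sigma>(1) that by (auto simp: ennreal_zero_less_mult_iff ennreal_zero_less_divide)
    then show "cheeger_constant \<Omega> > 0" using bounds[OF that] by (metis less_le_trans)
  qed
  have pos: "\<forall>\<gamma>\<in>{0<..<1}. C \<gamma> > 0" using C0(1) by (auto simp: C_def less_max_iff_disj)
  \<comment> \<open>Both sides are equivalent to positivity of the Cheeger constant, which does not
    involve \<gamma>.\<close>
  have indep: "capacitary_inradius \<gamma> \<Omega> < \<infinity> \<longleftrightarrow> capacitary_inradius \<gamma>' \<Omega> < \<infinity>"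
    if "\<gamma> \<in> {0<..<1}" "\<gamma>' \<in> {0<..<1}" "open \<Omega>" for \<gamma> \<gamma>' and \<Omega> :: "(real ^ 'n) set"
    using iff[OF that(1,3)] iff[OF that(2,3)] by (rule trans[OF sym])
  show ?thesis
  proof (rule conjI)
    show "\<exists>(\<sigma>::real) (C::real \<Rightarrow> real).
            \<sigma> > 0 \<and> (\<forall>\<gamma>\<in>{0<..<1}. C \<gamma> > 0) \<and> filterlim C at_top (at_left 1) \<and>
            (\<forall>\<gamma>\<in>{0<..<1}. \<forall>\<Omega>::(real ^ 'n) set. open \<Omega> \<longrightarrow>
               ennreal (\<sigma> * \<gamma>) * (1 / capacitary_inradius \<gamma> \<Omega>) \<le> cheeger_constant \<Omega> \<and>
               cheeger_constant \<Omega> \<le> ennreal (C \<gamma>) * (1 / capacitary_inradius \<gamma> \<Omega>))"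
      using \<sigma>(1) pos lim bounds by (intro exI[of _ \<sigma>] exI[of _ C]) blast
  qed (use iff indep in blast)
qed

end
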